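(* Hopscotch $\mathcal{H}$ is a bijection from the set of pairs $(P;Q)$ with $P$ a tableau, $Q$ a stable tableau, and $Q$ extending $P$, to the set of pairs $(T;U)$ with $T$ a tableau, $U$ a stable tableau, and $T$ extending $U$, and $\mathcal{H}\circ\mathcal{H}$ is the identity. If $\mathcal{H}(P;Q)=(T;U)$ then $P$ is Knuth-equivalent to $T$. Furthermore, two tableaux $P$ and $T$ are $\mathcal{H}$-dual equivalent if and only if they are dual equivalent ($\mathcal{J}$-dual equivalent), and two stable tableaux $Q$ and $U$ are $\mathcal{H}$-dual equivalent if and only if the tableaux $Q^S$ and $U^S$ are dual equivalent.
   Context: Shapes are finite weakly decreasing integer sequences; stable shapes are finite weakly decreasing sequences of integers and symbols $\infty,\bar\infty$ with $\bar\infty<n<\infty$ (arbitrarily many trailing $\bar\infty$ understood), ordered componentwise; $(\infty^i,\gamma)$ prepends $i$ parts $\infty$. Horizontal strip $\beta/\alpha$: $\beta_i\geq\alpha_i\geq\beta_{i+1}$. Stable horizontal strip: stable shapes $\alpha\subseteq\beta$ such that with $\alpha_m$ the first finite part of $\alpha$ and $\beta_n$ the last finite part of $\beta$, $\alpha_{m-1}=\infty=\beta_m>\alpha_m\geq\beta_{m+1}\geq\cdots\geq\alpha_{n-1}\geq\beta_n>\alpha_n=\bar\infty=\beta_{n+1}$. A tableau (resp. stable tableau) with entries from $[k]$ is a chain $\beta^0\subseteq\cdots\subseteq\beta^k$ of shapes (resp. stable shapes) with successive differences horizontal strips (resp. stable horizontal strips); a (stable) tableau $Q$ extends $P$ if the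 inner border of $Q$ equals the outer border of $P$ (after discarding initial $\infty$'s and trailing $\bar\infty$'s when the finite parts occupy the same rows). Stable complement: $T^S:\beta^k\subseteq(\infty,\beta^{k-1})\subseteq\cdots\subseteq(\infty^k,\beta^0)$; it exchanges ordinary and stable tableaux and $T^{SS}=T$ up to vertical shift; tableaux differing by vertical shifts are identified. Internal column insertion $\mathcal{C}$ is the operation on pairs of tableaux sharing an inner (resp. outer) border obtained by writing them along the first row and first column (resp. last row and last column) of a growth diagram (array of shapes whose rows and columns are tableaux, rows of common content, columns of common content) and filling in with the local rule $\delta=\mathcal{C}(\alpha;\beta,\gamma)$: $d_m=0$; for $i=m,\dots,2$: $\delta_i=\min\{\beta_i+\gamma_i+d_i-\alpha_i,\alpha_{i-1}\}$, $d_{i-1}=\max\{\beta_i+\gamma_i+d_i-\alpha_i-\alpha_{i-1},0\}$; $\delta_1=\beta_1+\gamma_1+d_1-\alpha_1$ (resp. its unique inverse), returning $(T,U)$ = (opposite row, opposite column). Hopscotch: for a tableau $P$ and a stable tableau $Q$ with either $P$ extending $Q$ or $Q$ extending $P$, $\mathcal{H}(P;Q):=(T;U^S)$ where $\mathcal{C}(P,Q^S)=(T,U)$. The passages $P\mapsto T$ and $Q\mapsto U^S$ are $\mathcal{H}$-moves; two tableaux (or two stable tableaux) of the same shape are $\mathcal{H}$-dual equivalent if any same sequence of $\mathcal{H}$-moves applied to both gives objects of the same shape. Knuth-equivalence: related by jeu de taquin slides (the empty box at an inner corner exchanges with its right or lower neighbour, the smaller one, the lower if equal, until at an outer corner). Dual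 equivalence: same shape and any same sequence of slides yields equal shapes.
   Formalization: In the last claim the stable tableaux Q and U are required to have entries from the same [k]; otherwise (0)⊆(0) and (0)⊆(0)⊆(0) are dual equivalent but their stable complements differ in shape. H is split into two maps, by whether Q extends P or P extends Q. *)

theory Defs
  imports Main "HOL-Library.Extended"
begin

section \<open>Shapes and tableaux\<close>

text \<open>
  Rows are numbered from 0. A chain of shapes with entries from \<open>[k]\<close> is a list of length
  \<open>k + 1\<close>. An ordinary shape does not record the row in which it starts, so ordinary tableaux
  are automatically taken up to vertical shift.
\<close>

type_synonym shape = "int list"
type_synonym tab = "shape list"

definition is_shape :: "shape \<Rightarrow> bool" where
  "is_shape \<alpha> \<longleftrightarrow> sorted_wrt (\<ge>) \<alpha>"

definition hstrip :: "shape \<Rightarrow> shape \<Rightarrow> bool" where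
  "hstrip \<alpha> \<beta> \<longleftrightarrow> is_shape \<alpha> \<and> is_shape \<beta> \<and> length \<alpha> = length \<beta> \<and>
     (\<forall>i<length \<beta>. \<alpha> ! i \<le> \<beta> ! i) \<and>
     (\<forall>i. Suc i < length \<beta> \<longrightarrow> \<beta> ! Suc i \<le> \<alpha> ! i)"

definition tableau :: "tab \<Rightarrow> bool" where
  "tableau T \<longleftrightarrow> T \<noteq> [] \<and> (\<forall>\<beta>\<in>set T. is_shape \<beta>) \<and>
     (\<forall>i. Suc i < length T \<longrightarrow> hstrip (T ! i) (T ! Suc i))"

definition inner :: "'a list \<Rightarrow> 'a" where "inner T = hd T"
definition outer :: "'a list \<Rightarrow> 'a" where "outer T = last T"

definition chain_shape :: "'a list \<Rightarrow> 'a \<times> 'a" where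
  "chain_shape T = (outer T, inner T)"

definition content :: "tab \<Rightarrow> int list" where
  "content T = map (\<lambda>i. sum_list (T ! Suc i) - sum_list (T ! i)) [0..<length T - 1]"


section \<open>Stable shapes and stable tableaux\<close>

text \<open>
  The trailing parts \<open>\<bar>\<infinity>\<close> of a stable shape are made explicit: a stable shape is an
  infinite sequence that is eventually \<^const>\<open>Minf\<close>.
\<close>

type_synonym sshape = "nat \<Rightarrow> int extended"
type_synonym stab = "sshape list"

definition stable_shape :: "sshape \<Rightarrow> bool" where
  "stable_shape \<sigma> \<longleftrightarrow> antimono \<sigma> \<and> (\<exists>n. \<forall>i\<ge>n. \<sigma> i = Minf)"

text \<open>
  The finite parts of \<open>\<alpha>\<close> are in rows \<open>m, \<dots>, n - 1\<close>, those of \<open>\<beta>\<close> in rows \<open>m + 1, \<dots>, n\<close>.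
  For \<open>m = n\<close> there are no finite parts, which makes the stable complement of a chain of empty
  shapes a stable tableau. The inequalities \<open>\<beta> i \<ge> \<alpha> i\<close> of the interlacing chain are part of
  \<open>\<alpha> \<le> \<beta>\<close>.
\<close>

definition stable_hstrip :: "sshape \<Rightarrow> sshape \<Rightarrow> bool" where
  "stable_hstrip \<alpha> \<beta> \<longleftrightarrow> stable_shape \<alpha> \<and> stable_shape \<beta> \<and> \<alpha> \<le> \<beta> \<and>
     (\<exists>m n. m \<le> n \<and>
        (\<forall>i<m. \<alpha> i = Pinf) \<and> \<beta> m = Pinf \<and>
        (\<forall>i\<in>{m..<n}. Pinf > \<alpha> i \<and> \<alpha> i \<ge> \<beta> (Suc i) \<and> \<beta> (Suc i) > Minf) \<and>
        \<alpha> n = Minf \<and> \<beta> (Suc n) = Minf)"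

definition stable_tableau :: "stab \<Rightarrow> bool" where
  "stable_tableau Q \<longleftrightarrow> Q \<noteq> [] \<and> (\<forall>\<sigma>\<in>set Q. stable_shape \<sigma>) \<and>
     (\<forall>i. Suc i < length Q \<longrightarrow> stable_hstrip (Q ! i) (Q ! Suc i))"

text \<open>\<open>prefix_inf i \<sigma>\<close> is \<open>(\<infinity>\<^sup>i, \<sigma>)\<close>; \<open>of_shape \<gamma>\<close> regards a shape as a stable shape.\<close>

definition prefix_inf :: "nat \<Rightarrow> sshape \<Rightarrow> sshape" where
  "prefix_inf i \<sigma> = (\<lambda>j. if j < i then Pinf else \<sigma> (j - i))"

definition of_shape :: "shape \<Rightarrow> sshape" where
  "of_shape \<gamma> = (\<lambda>j. if j < length \<gamma> then Fin (\<gamma> ! j) else Minf)"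

definition finite_parts :: "sshape \<Rightarrow> shape" where
  "finite_parts \<sigma> = (THE \<gamma>. \<exists>i. \<sigma> = prefix_inf i (of_shape \<gamma>))"

text \<open>
  Stable tableaux are taken up to vertical shift \<open>map (prefix_inf i)\<close>. Each class is represented
  by its unique member whose inner border has no part \<open>\<infinity>\<close>.
\<close>

definition stable_tableau_rep :: "stab \<Rightarrow> bool" where
  "stable_tableau_rep Q \<longleftrightarrow> stable_tableau Q \<and> inner Q 0 \<noteq> Pinf"


subsection \<open>Stable complement\<close>

definition stable_compl :: "stab \<Rightarrow> stab" where
  "stable_compl Q = map (\<lambda>i. prefix_inf i (Q ! (length Q - 1 - i))) [0..<length Q]"

definition compl_tab :: "tab \<Rightarrow> stab" where
  "compl_tab T = stable_compl (map of_shape T)"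

text \<open>
  The stable complement of a stable tableau is a chain of shapes with finite parts in fixed rows;
  the initial \<open>\<infinity>\<close>'s and trailing \<open>\<bar>\<infinity>\<close>'s are discarded.
\<close>

definition compl_stab :: "stab \<Rightarrow> tab" where
  "compl_stab Q = map finite_parts (stable_compl Q)"


subsection \<open>Extension\<close>

definition stab_extends :: "stab \<Rightarrow> tab \<Rightarrow> bool" where
  "stab_extends Q P \<longleftrightarrow> finite_parts (inner Q) = outer P"

definition tab_extends :: "tab \<Rightarrow> stab \<Rightarrow> bool" where
  "tab_extends P Q \<longleftrightarrow> inner P = finite_parts (outer Q)"


section \<open>Internal column insertion\<close>

text \<open>\<open>col_carry \<alpha> \<beta> \<gamma> i\<close> is the number \<open>d\<close> carried into row \<open>i\<close> from the row below.\<close>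

function col_carry :: "shape \<Rightarrow> shape \<Rightarrow> shape \<Rightarrow> nat \<Rightarrow> int" where
  "col_carry \<alpha> \<beta> \<gamma> i =
     (if Suc i < length \<alpha>
      then max (\<beta> ! Suc i + \<gamma> ! Suc i + col_carry \<alpha> \<beta> \<gamma> (Suc i) - \<alpha> ! Suc i - \<alpha> ! i) 0
      else 0)"
  by pat_completeness auto
termination
  by (relation "measure (\<lambda>(\<alpha>, \<beta>, \<gamma>, i). length \<alpha> - i)") auto

declare col_carry.simps [simp del]

definition col_rule :: "shape \<Rightarrow> shape \<Rightarrow> shape \<Rightarrow> shape" where
  "col_rule \<alpha> \<beta> \<gamma> =
     map (\<lambda>i. let x = \<beta> ! i + \<gamma> ! i + col_carry \<alpha> \<beta> \<gamma> i - \<alpha> ! i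
              in if i = 0 then x else min x (\<alpha> ! (i - 1)))
         [0..<length \<alpha>]"

text \<open>The array \<open>G\<close> has rows \<open>0, \<dots>, l\<close> and columns \<open>0, \<dots>, k\<close>.\<close>

definition grow_row :: "nat \<Rightarrow> (nat \<Rightarrow> nat \<Rightarrow> shape) \<Rightarrow> nat \<Rightarrow> tab" where
  "grow_row k G i = map (\<lambda>j. G i j) [0..<Suc k]"

definition grow_col :: "nat \<Rightarrow> (nat \<Rightarrow> nat \<Rightarrow> shape) \<Rightarrow> nat \<Rightarrow> tab" where
  "grow_col l G j = map (\<lambda>i. G i j) [0..<Suc l]"

definition col_growth :: "nat \<Rightarrow> nat \<Rightarrow> (nat \<Rightarrow> nat \<Rightarrow> shape) \<Rightarrow> bool" where
  "col_growth l k G \<longleftrightarrow>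
     (\<forall>i\<le>l. tableau (grow_row k G i) \<and> content (grow_row k G i) = content (grow_row k G 0)) \<and>
     (\<forall>j\<le>k. tableau (grow_col l G j) \<and> content (grow_col l G j) = content (grow_col l G 0)) \<and>
     (\<forall>i<l. \<forall>j<k. G (Suc i) (Suc j) = col_rule (G i j) (G (Suc i) j) (G i (Suc j)))"

text \<open>
  A pair of tableaux may share its inner and its outer border at the same time, and then the two
  instances of internal column insertion give different results. Hence they are two functions.
\<close>

definition col_insert_inner :: "tab \<Rightarrow> tab \<Rightarrow> tab \<times> tab" where
  "col_insert_inner P Q = (THE (T, U). \<exists>l k G. col_growth l k G \<and>
     grow_row k G 0 = P \<and> grow_col l G 0 = Q \<and> grow_row k G l = T \<and> grow_col l G k = U)"

definition col_insert_outer :: "tab \<Rightarrow> tab \<Rightarrow> tab \<times> tab" where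
  "col_insert_outer P Q = (THE (T, U). \<exists>l k G. col_growth l k G \<and>
     grow_row k G l = P \<and> grow_col l G k = Q \<and> grow_row k G 0 = T \<and> grow_col l G 0 = U)"


section \<open>Hopscotch\<close>

text \<open>\<open>Stable_Outside\<close>: \<open>Q\<close> extends \<open>P\<close>; \<open>Stable_Inside\<close>: \<open>P\<close> extends \<open>Q\<close>.\<close>

datatype position = Stable_Outside | Stable_Inside

fun hop_pairs :: "position \<Rightarrow> (tab \<times> stab) set" where
  "hop_pairs Stable_Outside = {(P, Q). tableau P \<and> stable_tableau_rep Q \<and> stab_extends Q P}"
| "hop_pairs Stable_Inside = {(P, Q). tableau P \<and> stable_tableau_rep Q \<and> tab_extends P Q}"

text \<open>
  If \<open>Q\<close> extends \<open>P\<close> then \<open>P\<close> and the complement of \<open>Q\<close> share their outer border; if \<open>P\<close>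
  extends \<open>Q\<close> they share their inner border.
\<close>

fun hopscotch :: "position \<Rightarrow> tab \<times> stab \<Rightarrow> tab \<times> stab" where
  "hopscotch Stable_Outside (P, Q) =
     (let (T, U) = col_insert_outer P (compl_stab Q) in (T, compl_tab U))"
| "hopscotch Stable_Inside (P, Q) =
     (let (T, U) = col_insert_inner P (compl_stab Q) in (T, compl_tab U))"


section \<open>Jeu de taquin\<close>

text \<open>Box \<open>(r, c)\<close> is in row \<open>r\<close> and column \<open>c\<close>; its entry is the \<open>t\<close> whose strip contains it.\<close>

definition filling :: "tab \<Rightarrow> nat \<times> int \<Rightarrow> nat option" where
  "filling T = (\<lambda>(r, c).
     if r < length (inner T) \<and> inner T ! r < c \<and> c \<le> outer T ! r
     then Some (LEAST t. c \<le> T ! t ! r) else None)"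

inductive jdt_step ::
  "(nat \<times> int \<Rightarrow> nat option) \<times> nat \<times> int \<Rightarrow> (nat \<times> int \<Rightarrow> nat option) \<times> nat \<times> int \<Rightarrow> bool"
where
  down: "\<lbrakk> F (Suc r, c) = Some b; \<And>a. F (r, c + 1) = Some a \<Longrightarrow> b \<le> a \<rbrakk> \<Longrightarrow>
     jdt_step (F, r, c) (F((r, c) := Some b, (Suc r, c) := None), Suc r, c)"
| right: "\<lbrakk> F (r, c + 1) = Some a; \<And>b. F (Suc r, c) = Some b \<Longrightarrow> a < b \<rbrakk> \<Longrightarrow>
     jdt_step (F, r, c) (F((r, c) := Some a, (r, c + 1) := None), r, c + 1)"

definition inner_corner :: "tab \<Rightarrow> nat \<Rightarrow> bool" where
  "inner_corner T r \<longleftrightarrow> r < length (inner T) \<and>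
     (Suc r < length (inner T) \<longrightarrow> inner T ! Suc r < inner T ! r)"

text \<open>
  \<open>jdt_slide r s P T\<close>: the empty box starts at the inner corner of \<open>P\<close> in row \<open>r\<close> and stops at an
  outer corner in row \<open>s\<close>. The inner border of \<open>T\<close> is stated because a filling does not
  determine it in rows without boxes.
\<close>

definition jdt_slide :: "nat \<Rightarrow> nat \<Rightarrow> tab \<Rightarrow> tab \<Rightarrow> bool" where
  "jdt_slide r s P T \<longleftrightarrow> tableau P \<and> tableau T \<and> length T = length P \<and> inner_corner P r \<and>
     inner T = (inner P)[r := inner P ! r - 1] \<and>
     (\<exists>c. jdt_step\<^sup>*\<^sup>* (filling P, r, inner P ! r) (filling T, s, c) \<and>
          filling T (s, c + 1) = None \<and> filling T (Suc s, c) = None)"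

definition knuth_equiv :: "tab \<Rightarrow> tab \<Rightarrow> bool" where
  "knuth_equiv = equivclp (\<lambda>P T. \<exists>r s. jdt_slide r s P T)"


section \<open>Dual equivalence\<close>

text \<open>
  Given labelled moves, two objects are dual equivalent if they have the same shape and any
  sequence of labels applicable to both leads to objects of the same shape.
\<close>

fun moves :: "('l \<Rightarrow> 'a \<Rightarrow> 'a \<Rightarrow> bool) \<Rightarrow> 'l list \<Rightarrow> 'a \<Rightarrow> 'a \<Rightarrow> bool" where
  "moves mv [] x y \<longleftrightarrow> x = y"
| "moves mv (a # as) x y \<longleftrightarrow> (\<exists>z. mv a x z \<and> moves mv as z y)"

definition dual_by :: "('l \<Rightarrow> 'b list \<Rightarrow> 'b list \<Rightarrow> bool) \<Rightarrow> 'b list \<Rightarrow> 'b list \<Rightarrow> bool" where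
  "dual_by mv x y \<longleftrightarrow> chain_shape x = chain_shape y \<and>
     (\<forall>as x' y'. moves mv as x x' \<and> moves mv as y y' \<longrightarrow> chain_shape x' = chain_shape y')"

text \<open>
  A forward slide is labelled by the row of the inner corner it starts from, a reverse slide
  (the inverse of a forward slide) by the row of the outer corner it starts from.
\<close>

datatype slide_label = Forward nat | Reverse nat

fun slide_move :: "slide_label \<Rightarrow> tab \<Rightarrow> tab \<Rightarrow> bool" where
  "slide_move (Forward r) P T \<longleftrightarrow> (\<exists>s. jdt_slide r s P T)"
| "slide_move (Reverse s) P T \<longleftrightarrow> (\<exists>r. jdt_slide r s T P)"

definition dual_equiv :: "tab \<Rightarrow> tab \<Rightarrow> bool" where
  "dual_equiv = dual_by slide_move"

fun hop_move_tab :: "position \<times> stab \<Rightarrow> tab \<Rightarrow> tab \<Rightarrow> bool" where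
  "hop_move_tab (p, Q) P T \<longleftrightarrow> (P, Q) \<in> hop_pairs p \<and> T = fst (hopscotch p (P, Q))"

fun hop_move_stab :: "position \<times> tab \<Rightarrow> stab \<Rightarrow> stab \<Rightarrow> bool" where
  "hop_move_stab (p, P) Q U \<longleftrightarrow> (P, Q) \<in> hop_pairs p \<and> U = snd (hopscotch p (P, Q))"

definition hop_dual_tab :: "tab \<Rightarrow> tab \<Rightarrow> bool" where
  "hop_dual_tab = dual_by hop_move_tab"

definition hop_dual_stab :: "stab \<Rightarrow> stab \<Rightarrow> bool" where
  "hop_dual_stab = dual_by hop_move_stab"

end

theory Submission
  imports Defs
begin

text \<open>
  Taking stable complements turns hopscotch into internal column insertion, whose local rule is a
  system of equations that is symmetric in its two middle shapes and invariant under rotation by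
  180 degrees; this gives invertibility and lets every statement about outer borders be reduced to
  one about inner borders.

  To compare column insertion with jeu de taquin, a tableau is viewed as a family of rows whose
  horizontal alignment may be changed. A slide and the insertion of a single box both move one
  entry at a time from a row to the row above, and the entry to be moved is determined by those two
  rows alone: it is the first \<open>j\<close> such that the lower row of the shape filled by the entries up to \<open>j\<close>
  reaches the end of the upper row of the shape filled by the entries below \<open>j\<close>. Such a bump can be realised by a
  slide, and also by the insertion of a box, after all other rows have been moved far away;
  realignments can be realised by either operation too. Therefore a relation between tableaux of
  equal shape is preserved by all slides if and only if it is preserved by all column insertions.
  Applied to dual equivalence this yields the last two claims; applied to equality within a Knuth
  class it yields Knuth equivalence.
\<close>

section \<open>Tableaux as chains of rows\<close>

text \<open>Closed relations are the right object because dual equivalence is the largest relation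
  that respects shapes and is preserved by its moves (\<open>dual_by_iff\<close>); two kinds of
  moves need not simulate each other label by label. Two obstacles shape the argument. A slide or an
  insertion is split into bumps at successive pairs of rows, but the families between two bumps are
  usually not tableaux, so that a relation \<open>D\<close> says nothing about them. They are
  compared by \<open>aligned\<close> instead, which asks for \<open>D\<close> after some common
  realignment; \<open>aligned_D\<close> leads back to tableaux because two admissible realignments
  always have a common lower one. Secondly, only moves that start at the inner border are treated
  this way. Moves from the outer border come from the rotated relation \<open>rot_rel D\<close>.
  Equality of shapes is used essentially for insertions: a move back from the outer border is
  labelled by a tableau that must be the same on both sides, and this holds because the outer
  borders agree. Equal shapes do not fix the number of entries, which is why \<open>k\<close> and
  \<open>k'\<close> are kept apart.\<close>

definition tab_of :: "nat \<Rightarrow> nat \<Rightarrow> (nat \<Rightarrow> nat \<Rightarrow> int) \<Rightarrow> tab" where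
  "tab_of m k R = map (\<lambda>j. map (R j) [0..<m]) [0..<Suc k]"

definition strip :: "nat \<Rightarrow> (nat \<Rightarrow> int) \<Rightarrow> (nat \<Rightarrow> int) \<Rightarrow> bool" where
  "strip m a b \<longleftrightarrow> (\<forall>i<m. a i \<le> b i) \<and> (\<forall>i. Suc i < m \<longrightarrow> b (Suc i) \<le> a i)"

text \<open>\<open>R j i\<close> is the end of row \<open>i\<close> in shape \<open>j\<close>. A
  function is used so that single rows can be shifted, possibly leaving the realm of chains. Weak
  decrease is stated for shape 0 and passes to the others through the interlacing
  (\<open>chain_shapes\<close>).\<close>

definition chain :: "nat \<Rightarrow> nat \<Rightarrow> (nat \<Rightarrow> nat \<Rightarrow> int) \<Rightarrow> bool" where
  "chain m k R \<longleftrightarrow> (\<forall>i. Suc i < m \<longrightarrow> R 0 (Suc i) \<le> R 0 i) \<and> (\<forall>j<k. strip m (R j) (R (Suc j)))"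

lemma is_shape_map: "is_shape (map a [0..<m]) \<longleftrightarrow> (\<forall>i. Suc i < m \<longrightarrow> a (Suc i) \<le> a i)"
proof -
  have "is_shape (map a [0..<m]) \<longleftrightarrow> (\<forall>i. Suc i < m \<longrightarrow> map a [0..<m] ! i \<ge> map a [0..<m] ! Suc i)"
    unfolding is_shape_def by (subst sorted_wrt_iff_nth_Suc_transp) (auto simp: transp_def)
  then show ?thesis by auto
qed

lemma int_mono_upto:
  fixes f :: "nat \<Rightarrow> int"
  assumes "\<And>j. j < k \<Longrightarrow> f j \<le> f (Suc j)" "i \<le> j" "j \<le> k"
  shows "f i \<le> f j"
  using assms(2,3)
proof (induction j rule: dec_induct)
  case (step n)
  then show ?case using assms(1)[of n] by simp
qed simp

lemma chain_shapes:
  assumes "chain m k R" "j \<le> k" "Suc i < m"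
  shows "R j (Suc i) \<le> R j i"
proof (cases j)
  case 0
  then show ?thesis using assms by (simp add: chain_def)
next
  case (Suc j')
  then have "strip m (R j') (R j)" using assms by (auto simp: chain_def)
  then have "R j (Suc i) \<le> R j' i" "R j' i \<le> R j i" using assms(3) by (auto simp: strip_def)
  then show ?thesis by simp
qed

lemma chain_step: "chain m k R \<Longrightarrow> j < k \<Longrightarrow> i < m \<Longrightarrow> R j i \<le> R (Suc j) i"
  by (auto simp: chain_def strip_def)

lemma chain_diag: "chain m k R \<Longrightarrow> j < k \<Longrightarrow> Suc i < m \<Longrightarrow> R (Suc j) (Suc i) \<le> R j i"
  by (auto simp: chain_def strip_def)

lemma hstrip_map:
  "hstrip (map a [0..<m]) (map b [0..<m]) \<longleftrightarrow>
     (\<forall>i. Suc i < m \<longrightarrow> a (Suc i) \<le> a i) \<and> strip m a b"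
  unfolding hstrip_def is_shape_map strip_def by (auto intro: order_trans Suc_lessD)

lemma length_tab_of [simp]: "length (tab_of m k R) = Suc k"
  by (simp add: tab_of_def)

lemma tab_of_nth [simp]: "j \<le> k \<Longrightarrow> tab_of m k R ! j = map (R j) [0..<m]"
  by (simp add: tab_of_def del: upt_Suc)

lemma tab_of_not_Nil [simp]: "tab_of m k R \<noteq> []"
  by (simp add: tab_of_def)

lemma inner_tab_of [simp]: "inner (tab_of m k R) = map (R 0) [0..<m]"
  using hd_conv_nth[of "tab_of m k R"] by (simp add: inner_def)

lemma outer_tab_of [simp]: "outer (tab_of m k R) = map (R k) [0..<m]"
  by (simp add: outer_def last_conv_nth)

lemma tab_of_eq_iff: "tab_of m k R = tab_of m k S \<longleftrightarrow> (\<forall>j\<le>k. \<forall>i<m. R j i = S j i)"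
  by (auto simp: tab_of_def less_Suc_eq_le simp del: upt_Suc)

lemma tableau_tab_of: "tableau (tab_of m k R) \<longleftrightarrow> chain m k R"
proof
  assume T: "tableau (tab_of m k R)"
  have "tab_of m k R ! 0 \<in> set (tab_of m k R)" by (rule nth_mem) simp
  then have "is_shape (map (R 0) [0..<m])" using T by (auto simp: tableau_def)
  then show "chain m k R"
    using T by (auto simp: tableau_def chain_def is_shape_map hstrip_map)
next
  assume C: "chain m k R"
  have "is_shape \<beta>" if "\<beta> \<in> set (tab_of m k R)" for \<beta>
    using that chain_shapes[OF C] by (auto simp: tab_of_def is_shape_map simp del: upt_Suc)
  then show "tableau (tab_of m k R)"
    using C chain_shapes[OF C] by (auto simp: tableau_def hstrip_map chain_def)
qed

lemma tableau_lengths: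
  assumes "tableau T" "j < length T"
  shows "length (T ! j) = length (inner T)"
  using assms(2)
proof (induction j)
  case 0
  then show ?case using assms by (simp add: inner_def hd_conv_nth)
next
  case (Suc j)
  then have "hstrip (T ! j) (T ! Suc j)" using assms by (auto simp: tableau_def)
  then show ?case using Suc by (simp add: hstrip_def)
qed

lemma tableau_as_tab_of:
  assumes "tableau T"
  shows "T = tab_of (length (inner T)) (length T - 1) (\<lambda>j i. T ! j ! i)"
    and "chain (length (inner T)) (length T - 1) (\<lambda>j i. T ! j ! i)"
proof -
  have "T \<noteq> []" using assms by (simp add: tableau_def)
  then show *: "T = tab_of (length (inner T)) (length T - 1) (\<lambda>j i. T ! j ! i)"
    using tableau_lengths[OF assms] by (intro nth_equalityI) (auto simp: less_Suc_eq_le)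
  show "chain (length (inner T)) (length T - 1) (\<lambda>j i. T ! j ! i)"
    using assms * tableau_tab_of by metis
qed

lemma tableauE:
  assumes "tableau T"
  obtains m k R where "T = tab_of m k R" "chain m k R"
  using tableau_as_tab_of[OF assms] by blast

lemma chain_shape_tab_of:
  "chain_shape (tab_of m k R) = chain_shape (tab_of m' k' R') \<longleftrightarrow>
     m = m' \<and> (\<forall>i<m. R 0 i = R' 0 i \<and> R k i = R' k' i)"
proof -
  have "map f [0..<m] = map g [0..<m'] \<longleftrightarrow> m = m' \<and> (\<forall>i<m. f i = g i)" for f g :: "nat \<Rightarrow> int"
    by (auto simp: list_eq_iff_nth_eq)
  then show ?thesis by (auto simp: chain_shape_def)
qed

section \<open>Slides as paths of rows\<close>

text \<open>\<open>\<rho> j\<close> is the row of the hole once the entries up to \<open>j\<close>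
  have passed it; the hole is then the last box of that row in \<open>R j\<close>. Entry
  \<open>Suc j\<close> lets it drop one row if the row below in \<open>R (Suc j)\<close> ends in the
  column of the hole; otherwise the hole runs to the right in its row.\<close>

definition slide_path :: "nat \<Rightarrow> nat \<Rightarrow> (nat \<Rightarrow> nat \<Rightarrow> int) \<Rightarrow> nat \<Rightarrow> (nat \<Rightarrow> nat) \<Rightarrow> bool" where
  "slide_path m k R r \<rho> \<longleftrightarrow> \<rho> 0 = r \<and> r < m \<and> (Suc r < m \<longrightarrow> R 0 (Suc r) < R 0 r) \<and>
     (\<forall>j<k. \<rho> (Suc j) =
        (if Suc (\<rho> j) < m \<and> R (Suc j) (Suc (\<rho> j)) = R j (\<rho> j) then Suc (\<rho> j) else \<rho> j))"

definition minus_box :: "(nat \<Rightarrow> nat \<Rightarrow> int) \<Rightarrow> (nat \<Rightarrow> nat) \<Rightarrow> nat \<Rightarrow> nat \<Rightarrow> int" where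
  "minus_box R \<rho> j i = R j i - of_bool (i = \<rho> j)"

text \<open>Let \<open>p = \<rho> j\<close>. If the hole drops, row \<open>Suc p\<close> of
  \<open>R (Suc j)\<close> ends at \<open>R j p\<close>, beyond \<open>R j (Suc p)\<close>, which
  bounds the next row by interlacing. If it stays and there is a row below, the interlacing at
  \<open>p\<close> is strict.\<close>

lemma slide_path_corner:
  assumes "chain m k R" "slide_path m k R r \<rho>" "j \<le> k"
  shows "\<rho> j < m \<and> (Suc (\<rho> j) < m \<longrightarrow> R j (Suc (\<rho> j)) < R j (\<rho> j))"
  using assms(3)
proof (induction j)
  case 0
  then show ?case using assms(2) by (auto simp: slide_path_def)
next
  case (Suc j)
  then have IH: "\<rho> j < m" "Suc (\<rho> j) < m \<Longrightarrow> R j (Suc (\<rho> j)) < R j (\<rho> j)" and "j < k" by auto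
  have s: "\<rho> (Suc j) =
        (if Suc (\<rho> j) < m \<and> R (Suc j) (Suc (\<rho> j)) = R j (\<rho> j) then Suc (\<rho> j) else \<rho> j)"
    using assms(2) \<open>j < k\<close> by (auto simp: slide_path_def)
  show ?case
  proof (cases "Suc (\<rho> j) < m \<and> R (Suc j) (Suc (\<rho> j)) = R j (\<rho> j)")
    case True
    then show ?thesis
      using s IH chain_diag[OF assms(1) \<open>j < k\<close>, of "Suc (\<rho> j)"] by auto
  next
    case False
    then show ?thesis
      using s IH chain_diag[OF assms(1) \<open>j < k\<close>, of "\<rho> j"] chain_step[OF assms(1) \<open>j < k\<close>, of "\<rho> j"]
      by auto
  qed
qed

lemma chain_minus_box:
  assumes "chain m k R" "slide_path m k R r \<rho>"
  shows "chain m k (minus_box R \<rho>)"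
  unfolding chain_def strip_def
proof (intro conjI allI impI)
  fix i assume "Suc i < m"
  then show "minus_box R \<rho> 0 (Suc i) \<le> minus_box R \<rho> 0 i"
    using slide_path_corner[OF assms, of 0] chain_shapes[OF assms(1), of 0 i]
    by (auto simp: minus_box_def)
next
  fix j i assume ji: "j < k" "i < m"
  show "minus_box R \<rho> j i \<le> minus_box R \<rho> (Suc j) i"
    using slide_path_corner[OF assms, of j] chain_step[OF assms(1) ji] assms(2) ji
    by (auto simp: minus_box_def slide_path_def split: if_splits)
next
  fix j i assume ji: "j < k" "Suc i < m"
  show "minus_box R \<rho> (Suc j) (Suc i) \<le> minus_box R \<rho> j i"
    using slide_path_corner[OF assms, of j] chain_diag[OF assms(1) ji] assms(2) ji
    by (auto simp: minus_box_def slide_path_def split: if_splits)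
qed

section \<open>Fillings and single jeu de taquin steps\<close>

definition entry :: "nat \<Rightarrow> nat \<Rightarrow> (nat \<Rightarrow> nat \<Rightarrow> int) \<Rightarrow> nat \<times> int \<Rightarrow> nat option" where
  "entry m k R = (\<lambda>(r, c). if r < m \<and> R 0 r < c \<and> c \<le> R k r
     then Some (LEAST t. t \<le> k \<and> c \<le> R t r) else None)"

lemma filling_tab_of: "filling (tab_of m k R) = entry m k R"
proof (rule ext, clarify)
  fix r c
  have "(LEAST t. c \<le> tab_of m k R ! t ! r) = (LEAST t. t \<le> k \<and> c \<le> R t r)"
    if "r < m" "c \<le> R k r"
  proof (rule sym, rule Least_equality)
    let ?P = "\<lambda>t. c \<le> tab_of m k R ! t ! r"
    have k: "?P k" using that by simp
    show "(LEAST t. ?P t) \<le> k \<and> c \<le> R (LEAST t. ?P t) r"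
      using LeastI[of ?P, OF k] Least_le[of ?P, OF k] that by simp
    show "(LEAST t. ?P t) \<le> y" if "y \<le> k \<and> c \<le> R y r" for y
      using that \<open>r < m\<close> by (intro Least_le) auto
  qed
  then show "filling (tab_of m k R) (r, c) = entry m k R (r, c)"
    by (auto simp: filling_def entry_def)
qed

lemma entry_cong:
  assumes "\<And>t. t \<le> k \<Longrightarrow> c \<le> R t r \<longleftrightarrow> c \<le> S t r"
  shows "entry m k R (r, c) = entry m k S (r, c)"
proof -
  have "(\<lambda>t. t \<le> k \<and> c \<le> R t r) = (\<lambda>t. t \<le> k \<and> c \<le> S t r)" using assms by auto
  then show ?thesis using assms[of 0] assms[of k] by (auto simp: entry_def)
qed

text \<open>Since rows grow weakly, the \<open>LEAST\<close> collapses to the one shape at which the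
  row passes column \<open>c\<close>.\<close>

lemma entry_eq_Some_iff:
  assumes mono: "\<And>j. j < k \<Longrightarrow> r < m \<Longrightarrow> R j r \<le> R (Suc j) r"
  shows "entry m k R (r, c) = Some b \<longleftrightarrow>
    r < m \<and> (\<exists>t<k. b = Suc t \<and> R t r < c \<and> c \<le> R (Suc t) r)"
proof (cases "r < m")
  case True
  have mono': "R i r \<le> R j r" if "i \<le> j" "j \<le> k" for i j
    using int_mono_upto[of k "\<lambda>j. R j r", OF mono[OF _ True]] that by blast
  have least: "(LEAST t. t \<le> k \<and> c \<le> R t r) = Suc t" if "t < k" "R t r < c" "c \<le> R (Suc t) r" for t
  proof (rule Least_equality)
    fix y assume "y \<le> k \<and> c \<le> R y r"
    then show "Suc t \<le> y" using that mono'[of y t] by (cases "y \<le> t") auto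
  qed (use that in auto)
  show ?thesis
  proof
    assume e: "entry m k R (r, c) = Some b"
    then have c: "R 0 r < c" "c \<le> R k r" and b: "b = (LEAST t. t \<le> k \<and> c \<le> R t r)"
      by (auto simp: entry_def split: if_splits)
    have bP: "b \<le> k \<and> c \<le> R b r"
      unfolding b by (rule LeastI[of _ k]) (use c in auto)
    then obtain t where t: "b = Suc t" using c by (cases b) auto
    have "\<not> (t \<le> k \<and> c \<le> R t r)"
      using not_less_Least[of t "\<lambda>t. t \<le> k \<and> c \<le> R t r"] b t by auto
    then show "r < m \<and> (\<exists>t<k. b = Suc t \<and> R t r < c \<and> c \<le> R (Suc t) r)"
      using True t bP by auto
  next
    assume "r < m \<and> (\<exists>t<k. b = Suc t \<and> R t r < c \<and> c \<le> R (Suc t) r)"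
    then obtain t where t: "t < k" "b = Suc t" "R t r < c" "c \<le> R (Suc t) r" by auto
    have "R 0 r < c" "c \<le> R k r" using mono'[of 0 t] mono'[of "Suc t" k] t by auto
    then show "entry m k R (r, c) = Some b"
      using least t True by (simp add: entry_def)
  qed
qed (simp add: entry_def)

text \<open>Entries up to \<open>j\<close> have already moved, so the box of the hole is the only one where this
  chain and the actual filling disagree.\<close>

definition slid_upto :: "(nat \<Rightarrow> nat \<Rightarrow> int) \<Rightarrow> (nat \<Rightarrow> nat) \<Rightarrow> nat \<Rightarrow> nat \<Rightarrow> nat \<Rightarrow> int" where
  "slid_upto R \<rho> j t = (if t \<le> j then minus_box R \<rho> t else R t)"

lemma slid_upto_mono:
  assumes "chain m k R" "slide_path m k R r \<rho>" "t < k" "i < m"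
  shows "slid_upto R \<rho> j t i \<le> slid_upto R \<rho> j (Suc t) i"
  using chain_step[OF assms(1,3,4)] chain_step[OF chain_minus_box[OF assms(1,2)] assms(3,4)]
  by (auto simp: slid_upto_def minus_box_def)

text \<open>One entry value moves the hole either a single box down or through the whole run of
  boxes \<open>Suc j\<close> on its right, so the many steps of a slide can be grouped by entries
  and matched with \<open>slide_path\<close>.\<close>

lemma jdt_steps_through_letter:
  assumes ch: "chain m k R" and sp: "slide_path m k R r \<rho>" and "j < k"
  shows "jdt_step\<^sup>*\<^sup>*
    ((entry m k (slid_upto R \<rho> j)) ((\<rho> j, R j (\<rho> j)) := None), \<rho> j, R j (\<rho> j))
    ((entry m k (slid_upto R \<rho> (Suc j))) ((\<rho> (Suc j), R (Suc j) (\<rho> (Suc j))) := None),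
      \<rho> (Suc j), R (Suc j) (\<rho> (Suc j)))"
proof -
  let ?E = "entry m k (slid_upto R \<rho> j)"
  let ?p = "\<rho> j" and ?q = "\<rho> (Suc j)" and ?c = "R j (\<rho> j)"
  have Some_iff: "?E (a, c) = Some b \<longleftrightarrow> a < m \<and>
      (\<exists>t<k. b = Suc t \<and> slid_upto R \<rho> j t a < c \<and> c \<le> slid_upto R \<rho> j (Suc t) a)" for a c b
    by (rule entry_eq_Some_iff) (rule slid_upto_mono[OF ch sp])
  have W_mono: "slid_upto R \<rho> j s a \<le> slid_upto R \<rho> j t a" if "s \<le> t" "t \<le> k" "a < m" for s t a
    using int_mono_upto[of k "\<lambda>t. slid_upto R \<rho> j t a", OF slid_upto_mono[OF ch sp]] that by blast
  have pm: "?p < m" and corner: "Suc ?p < m \<Longrightarrow> R j (Suc ?p) < R j ?p"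
    using slide_path_corner[OF ch sp, of j] \<open>j < k\<close> by auto
  have pmono: "R j ?p \<le> R (Suc j) ?p" using chain_step[OF ch \<open>j < k\<close> pm] .
  \<comment> \<open>The two chains differ only in shape \<open>Suc j\<close> at row
    \<open>?q\<close>, and there only by the box in which the hole ends up; erasing that box makes
    the fillings agree.\<close>
  have same: "?E((?q, R (Suc j) ?q) := None)
      = (entry m k (slid_upto R \<rho> (Suc j)))((?q, R (Suc j) ?q) := None)"
  proof (rule ext, clarify)
    fix a c
    have "?E (a, c) = entry m k (slid_upto R \<rho> (Suc j)) (a, c)" if "(a, c) \<noteq> (?q, R (Suc j) ?q)"
      using that by (intro entry_cong) (auto simp: slid_upto_def minus_box_def le_Suc_eq)
    then show "(?E((?q, R (Suc j) ?q) := None)) (a, c)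
      = ((entry m k (slid_upto R \<rho> (Suc j)))((?q, R (Suc j) ?q) := None)) (a, c)" by auto
  qed
  \<comment> \<open>\<open>minus_box\<close> has taken the box of the hole out of shape
    \<open>j\<close>, so in \<open>?E\<close> this box carries \<open>Suc j\<close> too: the entry
    that is to move into it is already written there.\<close>
  have letter: "?E (?p, c) = Some (Suc j)" if "?c \<le> c" "c \<le> R (Suc j) ?p" for c
    unfolding Some_iff using that pm \<open>j < k\<close>
    by (intro conjI exI[of _ j]) (auto simp: slid_upto_def minus_box_def)
  \<comment> \<open>The right neighbour of the hole is at least \<open>Suc j\<close>, and ties
    favour the lower neighbour, so an entry \<open>Suc j\<close> below the hole moves.\<close>
  have large: "Suc j \<le> b" if "?E (?p, c) = Some b" "?c < c" for b c
  proof -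
    from that(1) obtain t where t: "t < k" "b = Suc t" "c \<le> slid_upto R \<rho> j (Suc t) ?p"
      unfolding Some_iff by auto
    have "Suc t \<le> j \<Longrightarrow> slid_upto R \<rho> j (Suc t) ?p \<le> slid_upto R \<rho> j j ?p"
      using W_mono \<open>j < k\<close> pm by simp
    then show ?thesis using t that(2) by (auto simp: slid_upto_def minus_box_def split: if_splits)
  qed
  show ?thesis
  proof (cases "Suc ?p < m \<and> R (Suc j) (Suc ?p) = ?c")
    case True
    then have q: "?q = Suc ?p" using sp \<open>j < k\<close> by (auto simp: slide_path_def)
    have Ed: "?E (Suc ?p, ?c) = Some (Suc j)"
      unfolding Some_iff using True \<open>j < k\<close> corner
      by (intro conjI exI[of _ j]) (auto simp: slid_upto_def minus_box_def)
    have "jdt_step (?E((?p, ?c) := None), ?p, ?c)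
        ((?E((?p, ?c) := None))((?p, ?c) := Some (Suc j), (Suc ?p, ?c) := None), Suc ?p, ?c)"
      by (rule jdt_step.down) (use Ed large in auto)
    moreover have "(?E((?p, ?c) := None))((?p, ?c) := Some (Suc j), (Suc ?p, ?c) := None)
        = ?E((Suc ?p, ?c) := None)"
      using letter[of ?c] pmono by (auto simp: fun_eq_iff)
    ultimately show ?thesis using same True q by auto
  next
    case False
    then have q: "?q = ?p" using sp \<open>j < k\<close> by (auto simp: slide_path_def)
    have "jdt_step\<^sup>*\<^sup>* (?E((?p, ?c) := None), ?p, ?c) (?E((?p, ?c + int n) := None), ?p, ?c + int n)"
      if "?c + int n \<le> R (Suc j) ?p" for n
      using that
    proof (induction n)
      case (Suc n)
      let ?d = "?c + int n"
      have d: "?d + 1 = ?c + int (Suc n)" by simp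
      have "jdt_step (?E((?p, ?d) := None), ?p, ?d)
        ((?E((?p, ?d) := None))((?p, ?d) := Some (Suc j), (?p, ?d + 1) := None), ?p, ?d + 1)"
      proof (rule jdt_step.right)
        show "(?E((?p, ?d) := None)) (?p, ?d + 1) = Some (Suc j)"
          using letter[of "?d + 1"] Suc.prems by simp
        fix b assume "(?E((?p, ?d) := None)) (Suc ?p, ?d) = Some b"
        then have "?E (Suc ?p, ?d) = Some b" by simp
        then obtain t where t: "Suc ?p < m" "t < k" "b = Suc t" "?d \<le> slid_upto R \<rho> j (Suc t) (Suc ?p)"
          unfolding Some_iff by auto
        have lt: "R (Suc j) (Suc ?p) < ?c"
          using False chain_diag[OF ch \<open>j < k\<close> t(1)] t(1) by auto
        have "Suc t \<le> Suc j \<Longrightarrow>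
            slid_upto R \<rho> j (Suc t) (Suc ?p) \<le> slid_upto R \<rho> j (Suc j) (Suc ?p)"
          using W_mono \<open>j < k\<close> t(1) by simp
        then show "Suc j < b" using t lt by (cases "t \<le> j") (auto simp: slid_upto_def)
      qed
      moreover have "(?E((?p, ?d) := None))((?p, ?d) := Some (Suc j), (?p, ?d + 1) := None)
          = ?E((?p, ?d + 1) := None)"
        using letter[of ?d] Suc.prems by (auto simp: fun_eq_iff)
      ultimately have "jdt_step (?E((?p, ?d) := None), ?p, ?d) (?E((?p, ?d + 1) := None), ?p, ?d + 1)"
        by simp
      moreover have "jdt_step\<^sup>*\<^sup>* (?E((?p, ?c) := None), ?p, ?c) (?E((?p, ?d) := None), ?p, ?d)"
        using Suc by (simp del: fun_upd_apply)
      ultimately show ?case unfolding d by (rule rtranclp.rtrancl_into_rtrancl[rotated])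
    qed simp
    \<comment> \<open>The hole crosses exactly the boxes that entry \<open>Suc j\<close> adds to row
      \<open>?p\<close>.\<close>
    from this[of "nat (R (Suc j) ?p - ?c)"] show ?thesis using same q pmono by simp
  qed
qed

lemma jdt_slide_path:
  assumes ch: "chain m k R" and sp: "slide_path m k R r \<rho>"
  shows "jdt_slide r (\<rho> k) (tab_of m k R) (tab_of m k (minus_box R \<rho>))"
proof -
  let ?st = "\<lambda>j. ((entry m k (slid_upto R \<rho> j)) ((\<rho> j, R j (\<rho> j)) := None), \<rho> j, R j (\<rho> j))"
  have r: "\<rho> 0 = r" "r < m" "Suc r < m \<Longrightarrow> R 0 (Suc r) < R 0 r"
    using sp by (auto simp: slide_path_def)
  have start: "?st 0 = (entry m k R, r, R 0 r)"
  proof -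
    have "entry m k (slid_upto R \<rho> 0) (a, c) = entry m k R (a, c)" if "(a, c) \<noteq> (r, R 0 r)" for a c
      using that r by (intro entry_cong) (auto simp: slid_upto_def minus_box_def)
    moreover have "entry m k R (r, R 0 r) = None" by (simp add: entry_def)
    ultimately show ?thesis using r by (auto simp: fun_eq_iff)
  qed
  have stop: "?st k = (entry m k (minus_box R \<rho>), \<rho> k, R k (\<rho> k))"
  proof -
    have "entry m k (slid_upto R \<rho> k) (a, c) = entry m k (minus_box R \<rho>) (a, c)" for a c
      by (intro entry_cong) (auto simp: slid_upto_def)
    moreover have "entry m k (minus_box R \<rho>) (\<rho> k, R k (\<rho> k)) = None"
      by (simp add: entry_def minus_box_def)
    ultimately show ?thesis by (auto simp: fun_eq_iff)
  qed
  have "jdt_step\<^sup>*\<^sup>* (?st 0) (?st j)" if "j \<le> k" for j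
    using that
  proof (induction j)
    case (Suc j)
    then show ?case using jdt_steps_through_letter[OF ch sp, of j]
      by (meson Suc_le_lessD Suc_leD rtranclp_trans)
  qed simp
  from this[of k] have steps:
    "jdt_step\<^sup>*\<^sup>* (entry m k R, r, R 0 r) (entry m k (minus_box R \<rho>), \<rho> k, R k (\<rho> k))"
    unfolding start stop by simp
  have "entry m k (minus_box R \<rho>) (Suc (\<rho> k), R k (\<rho> k)) = None"
    using slide_path_corner[OF ch sp, of k] by (auto simp: entry_def minus_box_def)
  moreover have "entry m k (minus_box R \<rho>) (\<rho> k, R k (\<rho> k) + 1) = None"
    by (auto simp: entry_def minus_box_def)
  ultimately have "\<exists>c. jdt_step\<^sup>*\<^sup>* (entry m k R, r, R 0 r) (entry m k (minus_box R \<rho>), \<rho> k, c) \<and>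
      entry m k (minus_box R \<rho>) (\<rho> k, c + 1) = None \<and>
      entry m k (minus_box R \<rho>) (Suc (\<rho> k), c) = None"
    using steps by blast
  moreover have "map (minus_box R \<rho> 0) [0..<m] = (map (R 0) [0..<m])[r := R 0 r - 1]"
    using r by (auto simp: list_eq_iff_nth_eq minus_box_def nth_list_update)
  ultimately show ?thesis
    using r chain_minus_box[OF ch sp] ch
    by (simp add: jdt_slide_def tableau_tab_of inner_corner_def filling_tab_of)
qed

section \<open>Uniqueness of the result of a slide\<close>

lemma jdt_step_deterministic: "jdt_step x y \<Longrightarrow> jdt_step x z \<Longrightarrow> y = z"
  by (erule jdt_step.cases; erule jdt_step.cases) fastforce+

lemma jdt_steps_normal_unique:
  assumes "jdt_step\<^sup>*\<^sup>* x y" "jdt_step\<^sup>*\<^sup>* x z" "\<nexists>w. jdt_step y w" "\<nexists>w. jdt_step z w"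
  shows "y = z"
  using assms(1,2)
proof (induction rule: converse_rtranclp_induct)
  case base
  then show ?case using assms(3) by (metis converse_rtranclpE)
next
  case (step x x')
  from \<open>jdt_step\<^sup>*\<^sup>* x z\<close> show ?case
  proof (cases rule: converse_rtranclpE)
    case base
    then show ?thesis using step(1) assms(4) by blast
  next
    case (step w)
    then show ?thesis using \<open>jdt_step x x'\<close> step.IH jdt_step_deterministic by metis
  qed
qed

text \<open>If a row were longer in \<open>B j\<close> than in \<open>A j\<close>, its last box
  would carry an entry at most \<open>j\<close> in the common filling and hence lie in
  \<open>A j\<close>. Equal inner borders ensure that this box is filled.\<close>

lemma entry_determines_chain:
  assumes "chain m k R" "chain m k S" "entry m k R = entry m k S" "\<And>i. i < m \<Longrightarrow> R 0 i = S 0 i"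
    "j \<le> k" "i < m"
  shows "R j i = S j i"
proof -
  have le: "B j i \<le> A j i"
    if ch: "chain m k A" "chain m k B" and eq: "entry m k A = entry m k B" "A 0 i = B 0 i" for A B
  proof (rule ccontr)
    assume lt: "\<not> B j i \<le> A j i"
    have sA: "entry m k A (i, c) = Some b \<longleftrightarrow> (\<exists>t<k. b = Suc t \<and> A t i < c \<and> c \<le> A (Suc t) i)" for c b
      using entry_eq_Some_iff[of k i m A c b] chain_step[OF ch(1)] assms(6) by blast
    have sB: "entry m k B (i, c) = Some b \<longleftrightarrow> (\<exists>t<k. b = Suc t \<and> B t i < c \<and> c \<le> B (Suc t) i)" for c b
      using entry_eq_Some_iff[of k i m B c b] chain_step[OF ch(2)] assms(6) by blast
    have mB: "B s i \<le> B t i" if "s \<le> t" "t \<le> k" for s t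
      using int_mono_upto[of k "\<lambda>j. B j i"] chain_step[OF ch(2)] assms(6) that by blast
    have mA: "A s i \<le> A t i" if "s \<le> t" "t \<le> k" for s t
      using int_mono_upto[of k "\<lambda>j. A j i"] chain_step[OF ch(1)] assms(6) that by blast
    have "B 0 i < B j i" using lt mA[of 0 j] eq(2) assms(5) by simp
    then have "entry m k B (i, B j i) \<noteq> None"
      using mB[of j k] assms(5,6) by (simp add: entry_def)
    then obtain b where b: "entry m k B (i, B j i) = Some b" by auto
    then obtain t where t: "t < k" "b = Suc t" "B t i < B j i" unfolding sB by auto
    then have "t < j" using mB[of j t] by (cases "t < j") auto
    from b t obtain "B j i \<le> A (Suc t) i" unfolding eq(1)[symmetric] sA by auto
    then show False using mA[of "Suc t" j] \<open>t < j\<close> assms(5) lt by simp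
  qed
  show ?thesis using le[of R S] le[of S R] assms by force
qed

text \<open>Steps are deterministic and both results sit where no step applies, so final filling and
  hole coincide; the prescribed inner border then recovers the tableau.\<close>

lemma jdt_slide_unique:
  assumes "jdt_slide r s P T" "jdt_slide r s' P T'"
  shows "s = s' \<and> T = T'"
proof -
  let ?x = "(filling P, r, inner P ! r)"
  from assms(1) obtain c where c: "jdt_step\<^sup>*\<^sup>* ?x (filling T, s, c)"
    "filling T (s, c + 1) = None" "filling T (Suc s, c) = None" by (auto simp: jdt_slide_def)
  from assms(2) obtain c' where c': "jdt_step\<^sup>*\<^sup>* ?x (filling T', s', c')"
    "filling T' (s', c' + 1) = None" "filling T' (Suc s', c') = None" by (auto simp: jdt_slide_def)
  have "(filling T, s, c) = (filling T', s', c')"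
    using c c' by (intro jdt_steps_normal_unique[of ?x]) (auto elim!: jdt_step.cases)
  then have eq: "filling T = filling T'" "s = s'" by auto
  from assms obtain m k R where T: "T = tab_of m k R" "chain m k R"
    by (auto simp: jdt_slide_def elim: tableauE)
  from assms obtain m' k' R' where T': "T' = tab_of m' k' R'" "chain m' k' R'"
    by (auto simp: jdt_slide_def elim: tableauE)
  have "length T = length T'" and i: "inner T = inner T'" using assms by (auto simp: jdt_slide_def)
  then have k: "k' = k" using T T' by simp
  have m: "m' = m" using arg_cong[OF i, of length] T T' by simp
  have "R 0 i = R' 0 i" if "i < m" for i
    using arg_cong[OF i, of "\<lambda>l. l ! i"] that T T' m by simp
  then have "R j i = R' j i" if "j \<le> k" "i < m" for j i
    using entry_determines_chain[of m k R R'] T T' that eq(1) k m by (simp add: filling_tab_of)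
  then show ?thesis using eq T T' k m by (simp add: tab_of_eq_iff)
qed

lemma slide_path_exists:
  assumes "r < m" "Suc r < m \<longrightarrow> R 0 (Suc r) < R 0 r"
  obtains \<rho> where "slide_path m k R r \<rho>"
proof
  show "slide_path m k R r (rec_nat r (\<lambda>j p. if Suc p < m \<and> R (Suc j) (Suc p) = R j p then Suc p else p))"
    using assms by (simp add: slide_path_def)
qed

text \<open>The explicit path gives one result and results are unique, so arguments about slides
  become arguments about \<open>slide_path\<close>.\<close>

lemma jdt_slideE:
  assumes "jdt_slide r s P T"
  obtains m k R \<rho> where "P = tab_of m k R" "chain m k R" "slide_path m k R r \<rho>" "s = \<rho> k"
    "T = tab_of m k (minus_box R \<rho>)"
proof -
  from assms have "tableau P" "inner_corner P r" by (auto simp: jdt_slide_def)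
  then obtain m k R where P: "P = tab_of m k R" "chain m k R" by (auto elim: tableauE)
  with \<open>inner_corner P r\<close> obtain \<rho> where "slide_path m k R r \<rho>"
    using slide_path_exists[of r m R k] by (auto simp: inner_corner_def)
  with P that show ?thesis
    using jdt_slide_unique[OF assms] jdt_slide_path[of m k R r \<rho>] by metis
qed

section \<open>Rotation by 180 degrees\<close>

definition rot :: "tab \<Rightarrow> tab" where
  "rot T = rev (map (\<lambda>\<alpha>. rev (map uminus \<alpha>)) T)"

definition rot_chain :: "nat \<Rightarrow> nat \<Rightarrow> (nat \<Rightarrow> nat \<Rightarrow> int) \<Rightarrow> nat \<Rightarrow> nat \<Rightarrow> int" where
  "rot_chain m k R j i = - R (k - j) (m - 1 - i)"

lemma rot_tab_of: "rot (tab_of m k R) = tab_of m k (rot_chain m k R)"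
proof (rule nth_equalityI)
  fix j assume "j < length (rot (tab_of m k R))"
  then have j: "j \<le> k" by (simp add: rot_def)
  have "rot (tab_of m k R) ! j = rev (map uminus (map (R (k - j)) [0..<m]))"
    using j tab_of_nth[of "k - j" k m R] by (simp add: rot_def rev_nth del: map_map tab_of_nth)
  also have "\<dots> = map (rot_chain m k R j) [0..<m]"
    by (rule nth_equalityI) (auto simp: rev_nth rot_chain_def)
  finally show "rot (tab_of m k R) ! j = tab_of m k (rot_chain m k R) ! j" using j by simp
qed (simp add: rot_def)

lemma rot_rot [simp]: "rot (rot T) = T"
  by (simp add: rot_def rev_map comp_def)

lemma chain_rot:
  assumes "chain m k R"
  shows "chain m k (rot_chain m k R)"
  unfolding chain_def strip_def
proof (intro conjI allI impI)
  fix i assume "Suc i < m"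
  then show "rot_chain m k R 0 (Suc i) \<le> rot_chain m k R 0 i"
    using chain_shapes[OF assms, of k "m - 1 - Suc i"] by (simp add: rot_chain_def Suc_diff_Suc)
next
  fix j i assume ji: "j < k" "i < m"
  then show "rot_chain m k R j i \<le> rot_chain m k R (Suc j) i"
    using chain_step[OF assms, of "k - Suc j" "m - 1 - i"] by (simp add: rot_chain_def Suc_diff_Suc)
next
  fix j i assume ji: "j < k" "Suc i < m"
  then show "rot_chain m k R (Suc j) (Suc i) \<le> rot_chain m k R j i"
    using chain_diag[OF assms, of "k - Suc j" "m - 1 - Suc i"]
    by (simp add: rot_chain_def Suc_diff_Suc)
qed

lemma tableau_rot: "tableau (rot T) \<longleftrightarrow> tableau T"
  by (metis chain_rot rot_rot rot_tab_of tableauE tableau_tab_of)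

lemma chain_shape_rot:
  assumes "T \<noteq> []"
  shows "chain_shape (rot T) = map_prod (\<lambda>\<alpha>. rev (map uminus \<alpha>)) (\<lambda>\<alpha>. rev (map uminus \<alpha>))
    (prod.swap (chain_shape T))"
  using assms by (simp add: chain_shape_def inner_def outer_def rot_def hd_rev last_rev hd_map last_map)

text \<open>After rotation the hole retraces its path. Where it had dropped, both compared rows have
  lost a box and the equality survives; where it had stayed, only one has, and interlacing makes the
  comparison strict.\<close>

lemma slide_path_rot:
  assumes ch: "chain m k R" and sp: "slide_path m k R r \<rho>"
  shows "slide_path m k (rot_chain m k (minus_box R \<rho>)) (m - 1 - \<rho> k) (\<lambda>j. m - 1 - \<rho> (k - j))"
proof -
  let ?T = "rot_chain m k (minus_box R \<rho>)"
  have lt: "\<rho> j < m" if "j \<le> k" for j using slide_path_corner[OF ch sp that] by blast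
  have k: "\<rho> k < m" using lt by simp
  have corner: "?T 0 (Suc (m - 1 - \<rho> k)) < ?T 0 (m - 1 - \<rho> k)" if "Suc (m - 1 - \<rho> k) < m"
  proof -
    have "0 < \<rho> k" using that by simp
    then show ?thesis using k chain_shapes[OF ch, of k "\<rho> k - 1"]
      by (simp add: rot_chain_def minus_box_def Suc_diff_Suc)
  qed
  have step: "m - 1 - \<rho> (k - Suc j) = (if Suc (m - 1 - \<rho> (k - j)) < m \<and>
      ?T (Suc j) (Suc (m - 1 - \<rho> (k - j))) = ?T j (m - 1 - \<rho> (k - j))
      then Suc (m - 1 - \<rho> (k - j)) else m - 1 - \<rho> (k - j))" if "j < k" for j
  proof -
    define n where "n = k - Suc j"
    have n: "k - j = Suc n" "n < k" using that by (auto simp: n_def)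
    have pm: "\<rho> n < m" "\<rho> (Suc n) < m" using lt n by auto
    have sn: "\<rho> (Suc n) =
        (if Suc (\<rho> n) < m \<and> R (Suc n) (Suc (\<rho> n)) = R n (\<rho> n) then Suc (\<rho> n) else \<rho> n)"
      using sp n by (auto simp: slide_path_def)
    have index: "m - Suc (Suc (m - Suc (\<rho> (Suc n)))) = \<rho> (Suc n) - Suc 0" using pm by simp
    have T: "?T (Suc j) (Suc (m - 1 - \<rho> (Suc n))) = - minus_box R \<rho> n (\<rho> (Suc n) - 1)"
      "?T j (m - 1 - \<rho> (Suc n)) = - minus_box R \<rho> (Suc n) (\<rho> (Suc n))"
      using pm n index by (auto simp: rot_chain_def n_def[symmetric])
    show ?thesis
    proof (cases "\<rho> (Suc n) = Suc (\<rho> n)")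
      case True
      then have "R (Suc n) (Suc (\<rho> n)) = R n (\<rho> n)" using sn by (auto split: if_splits)
      then show ?thesis using T True pm n by (auto simp: minus_box_def n_def[symmetric])
    next
      case False
      then have eq: "\<rho> (Suc n) = \<rho> n" using sn by (auto split: if_splits)
      have "R (Suc n) (\<rho> n) \<le> R n (\<rho> n - 1)" if "0 < \<rho> n"
        using chain_diag[OF ch \<open>n < k\<close>, of "\<rho> n - 1"] that pm by simp
      then show ?thesis using T eq pm n
        by (cases "\<rho> n = 0") (auto simp: minus_box_def n_def[symmetric])
    qed
  qed
  show ?thesis unfolding slide_path_def using k corner step by auto
qed

lemma jdt_slide_rot:
  assumes "jdt_slide r s P T"
  shows "jdt_slide (length (inner P) - 1 - s) (length (inner P) - 1 - r) (rot T) (rot P)"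
  using assms
proof (rule jdt_slideE)
  fix m k R \<rho>
  assume *: "P = tab_of m k R" "chain m k R" "slide_path m k R r \<rho>" "s = \<rho> k"
    "T = tab_of m k (minus_box R \<rho>)"
  let ?R = "rot_chain m k (minus_box R \<rho>)" and ?\<rho> = "\<lambda>j. m - 1 - \<rho> (k - j)"
  have "\<rho> j < m" if "j \<le> k" for j using slide_path_corner[OF *(2,3) that] by blast
  then have "m - 1 - \<rho> (k - j) = i \<longleftrightarrow> m - 1 - i = \<rho> (k - j)" if "j \<le> k" "i < m" for j i
    using that by (metis One_nat_def Suc_pred diff_diff_cancel diff_le_self gr0I less_Suc_eq_le less_nat_zero_code)
  then have "tab_of m k (rot_chain m k R) = tab_of m k (minus_box ?R ?\<rho>)"
    by (auto simp: tab_of_eq_iff minus_box_def rot_chain_def)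
  then show ?thesis
    using jdt_slide_path[OF chain_rot[OF chain_minus_box[OF *(2,3)]] slide_path_rot[OF *(2,3)]] *
    by (simp add: rot_tab_of slide_path_def)
qed

section \<open>The local rule as a system of equations\<close>

text \<open>Here \<open>d i\<close> is the amount carried from row \<open>i\<close> to row \<open>i - 1\<close>. In this form the rule is
  visibly symmetric in \<open>b\<close>, \<open>c\<close>, and rotation by 180 degrees exchanges \<open>a\<close> and \<open>e\<close>.\<close>

definition crule :: "nat \<Rightarrow> (nat \<Rightarrow> int) \<Rightarrow> (nat \<Rightarrow> int) \<Rightarrow> (nat \<Rightarrow> int) \<Rightarrow> (nat \<Rightarrow> int) \<Rightarrow> bool" where
  "crule m a b c e \<longleftrightarrow> (\<exists>d. d 0 = 0 \<and> d m = 0 \<and>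
     (\<forall>i<m. 0 \<le> d i \<and> e i + d i = b i + c i + d (Suc i) - a i) \<and>
     (\<forall>i. Suc i < m \<longrightarrow> e (Suc i) \<le> a i \<and> (d (Suc i) = 0 \<or> e (Suc i) = a i)))"

lemma crule_sym: "crule m a b c e \<Longrightarrow> crule m a c b e"
  unfolding crule_def by (auto simp: add.commute)

lemma crule_cong:
  assumes "\<And>i. i < m \<Longrightarrow> a i = a' i" "\<And>i. i < m \<Longrightarrow> b i = b' i" "\<And>i. i < m \<Longrightarrow> c i = c' i"
    "\<And>i. i < m \<Longrightarrow> e i = e' i"
  shows "crule m a b c e = crule m a' b' c' e'"
  unfolding crule_def using assms by (auto simp: Suc_lessD)

text \<open>Carries are determined from the bottom upwards: \<open>d (Suc i)\<close> fixes
  \<open>e i + d i\<close>, and since \<open>d i\<close> vanishes unless \<open>e i\<close> reaches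
  its bound \<open>a (i - 1)\<close>, the sum splits in one way. Row 0 has no bound, but
  \<open>d 0 = 0\<close>.\<close>

lemma crule_unique:
  assumes "crule m a b c e" "crule m a b c e'" "i < m"
  shows "e i = e' i"
proof -
  from assms(1) obtain d where d: "d 0 = 0" "d m = 0"
    "\<And>i. i < m \<Longrightarrow> 0 \<le> d i \<and> e i + d i = b i + c i + d (Suc i) - a i"
    "\<And>i. Suc i < m \<Longrightarrow> e (Suc i) \<le> a i \<and> (d (Suc i) = 0 \<or> e (Suc i) = a i)"
    unfolding crule_def by blast
  from assms(2) obtain d' where d': "d' 0 = 0" "d' m = 0"
    "\<And>i. i < m \<Longrightarrow> 0 \<le> d' i \<and> e' i + d' i = b i + c i + d' (Suc i) - a i"
    "\<And>i. Suc i < m \<Longrightarrow> e' (Suc i) \<le> a i \<and> (d' (Suc i) = 0 \<or> e' (Suc i) = a i)"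
    unfolding crule_def by blast
  have step: "d i = d' i \<and> e i = e' i" if "i < m" "d (Suc i) = d' (Suc i)" for i
  proof (cases i)
    case 0
    then show ?thesis using d(1) d(3)[OF that(1)] d'(1) d'(3)[OF that(1)] that(2) by simp
  next
    case (Suc i')
    then show ?thesis using d(3)[OF that(1)] d'(3)[OF that(1)] d(4)[of i'] d'(4)[of i'] that by auto
  qed
  have "d i = d' i" if "i \<le> m" for i
    using that
  proof (induction i rule: inc_induct)
    case base
    then show ?case using d(2) d'(2) by simp
  next
    case (step n)
    then show ?case using \<open>\<And>i. i < m \<Longrightarrow> d (Suc i) = d' (Suc i) \<Longrightarrow> d i = d' i \<and> e i = e' i\<close> by blast
  qed
  then show ?thesis using step[OF assms(3)] assms(3) by simp
qed

lemma crule_rot: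
  assumes "crule m a b c e"
  shows "crule m (\<lambda>i. - e (m - 1 - i)) (\<lambda>i. - b (m - 1 - i)) (\<lambda>i. - c (m - 1 - i))
    (\<lambda>i. - a (m - 1 - i))"
proof -
  from assms obtain d where d: "d 0 = 0" "d m = 0"
    "\<And>i. i < m \<Longrightarrow> 0 \<le> d i \<and> e i + d i = b i + c i + d (Suc i) - a i"
    "\<And>i. Suc i < m \<Longrightarrow> e (Suc i) \<le> a i \<and> (d (Suc i) = 0 \<or> e (Suc i) = a i)"
    unfolding crule_def by blast
  have nonneg: "0 \<le> d i" if "i \<le> m" for i using d(2) d(3)[of i] that by (cases "i = m") auto
  show ?thesis
    unfolding crule_def
  \<comment> \<open>The carry from row \<open>i\<close> to row \<open>i - 1\<close> becomes the one
    across the mirrored boundary, between rows \<open>m - i\<close> and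
    \<open>m - 1 - i\<close>.\<close>
  proof (intro exI[of _ "\<lambda>i. d (m - i)"] conjI allI impI)
    fix i assume i: "i < m"
    have eq: "m - i = Suc (m - 1 - i)" "m - Suc i = m - 1 - i" using i by auto
    show "0 \<le> d (m - i)" using nonneg by simp
    show "- a (m - 1 - i) + d (m - i)
        = - b (m - 1 - i) + - c (m - 1 - i) + d (m - Suc i) - - e (m - 1 - i)"
      unfolding eq using d(3)[of "m - 1 - i"] i by simp
  next
    fix i assume i: "Suc i < m"
    have eq: "m - 1 - i = Suc (m - 1 - Suc i)" "m - Suc i = Suc (m - 1 - Suc i)" using i by auto
    show "- a (m - 1 - Suc i) \<le> - e (m - 1 - i)"
      "d (m - Suc i) = 0 \<or> - a (m - 1 - Suc i) = - e (m - 1 - i)"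
      unfolding eq using d(4)[of "m - 1 - Suc i"] i by auto
  qed (use d in auto)
qed

text \<open>In a row without outgoing carry, \<open>e i\<close> exceeds \<open>b i\<close> by
  \<open>c i - a i\<close> plus the incoming carry. With a carry, \<open>e i\<close> equals
  \<open>a (i - 1)\<close>, which bounds \<open>b i\<close> because \<open>b\<close> is a strip over
  \<open>a\<close>.\<close>

lemma crule_strip:
  assumes ab: "strip m a b" and ac: "strip m a c" and cr: "crule m a b c e"
  shows "strip m b e"
proof -
  from cr obtain d where d: "d 0 = 0" "d m = 0"
    "\<And>i. i < m \<Longrightarrow> 0 \<le> d i \<and> e i + d i = b i + c i + d (Suc i) - a i"
    "\<And>i. Suc i < m \<Longrightarrow> e (Suc i) \<le> a i \<and> (d (Suc i) = 0 \<or> e (Suc i) = a i)"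
    unfolding crule_def by blast
  have nonneg: "0 \<le> d i" if "i \<le> m" for i using d(2) d(3)[of i] that by (cases "i = m") auto
  show ?thesis unfolding strip_def
  proof (intro conjI allI impI)
    fix i assume i: "i < m"
    have "a i \<le> c i" using ac i by (simp add: strip_def)
    then have "d i = 0 \<Longrightarrow> b i \<le> e i" using d(3)[OF i] nonneg[of "Suc i"] i by simp
    then show "b i \<le> e i"
      using d(1) d(4)[of "i - 1"] ab i by (cases i) (auto simp: strip_def)
  next
    fix i assume i: "Suc i < m"
    then have "a i \<le> b i" using ab by (simp add: strip_def)
    then show "e (Suc i) \<le> b i" using d(4)[OF i] by simp
  qed
qed

lemma crule_sum:
  assumes "crule m a b c e"
  shows "(\<Sum>i<m. e i) + (\<Sum>i<m. a i) = (\<Sum>i<m. b i) + (\<Sum>i<m. c i)"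
proof -
  from assms obtain d where d: "d 0 = 0" "d m = 0"
    "\<And>i. i < m \<Longrightarrow> e i + d i = b i + c i + d (Suc i) - a i"
    unfolding crule_def by blast
  have "(\<Sum>i<m. e i + a i) = (\<Sum>i<m. b i + c i + (d (Suc i) - d i))"
    using d(3) by (intro sum.cong) (auto simp: algebra_simps)
  also have "\<dots> = (\<Sum>i<m. b i + c i) + (d m - d 0)"
    by (simp add: sum.distrib sum_lessThan_telescope)
  finally show ?thesis using d by (simp add: sum.distrib)
qed

lemma col_rule_crule:
  "crule (length \<alpha>) ((!) \<alpha>) ((!) \<beta>) ((!) \<gamma>) ((!) (col_rule \<alpha> \<beta> \<gamma>))"
proof -
  \<comment> \<open>\<open>crule\<close> indexes a carry by the row it leaves,
    \<open>col_carry\<close> by the row it enters; nothing leaves row 0, which is not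
    capped.\<close>
  let ?d = "\<lambda>i. if i = 0 then 0 else col_carry \<alpha> \<beta> \<gamma> (i - 1)"
  have carry: "col_carry \<alpha> \<beta> \<gamma> i =
    (if Suc i < length \<alpha>
     then max (\<beta> ! Suc i + \<gamma> ! Suc i + col_carry \<alpha> \<beta> \<gamma> (Suc i) - \<alpha> ! Suc i - \<alpha> ! i) 0 else 0)" for i
    by (rule col_carry.simps)
  show ?thesis unfolding crule_def
  proof (intro exI[of _ ?d] conjI allI impI)
    show "?d (length \<alpha>) = 0" using carry[of "length \<alpha> - 1"] by simp
  next
    fix i assume i: "i < length \<alpha>"
    show "0 \<le> ?d i" using carry[of "i - 1"] by auto
    show "col_rule \<alpha> \<beta> \<gamma> ! i + ?d i = \<beta> ! i + \<gamma> ! i + ?d (Suc i) - \<alpha> ! i"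
      using carry[of "i - 1"] i by (cases i) (auto simp: col_rule_def Let_def)
  next
    fix i assume i: "Suc i < length \<alpha>"
    show "col_rule \<alpha> \<beta> \<gamma> ! Suc i \<le> \<alpha> ! i"
      "?d (Suc i) = 0 \<or> col_rule \<alpha> \<beta> \<gamma> ! Suc i = \<alpha> ! i"
      using carry[of i] i by (auto simp: col_rule_def Let_def)
  qed simp
qed

lemma col_rule_map:
  "map e [0..<m] = col_rule (map a [0..<m]) (map b [0..<m]) (map c [0..<m]) \<longleftrightarrow> crule m a b c e"
proof -
  let ?\<delta> = "col_rule (map a [0..<m]) (map b [0..<m]) (map c [0..<m])"
  have "crule m ((!) (map a [0..<m])) ((!) (map b [0..<m])) ((!) (map c [0..<m])) ((!) ?\<delta>)"
    using col_rule_crule[of "map a [0..<m]"] by simp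
  also have "?this \<longleftrightarrow> crule m a b c ((!) ?\<delta>)"
    by (rule crule_cong) auto
  finally have c: "crule m a b c ((!) ?\<delta>)" .
  have len: "length ?\<delta> = m" by (simp add: col_rule_def)
  show ?thesis
  proof
    assume "map e [0..<m] = ?\<delta>"
    then have "e i = ?\<delta> ! i" if "i < m" for i using that by (metis add_0 diff_zero length_upt nth_map nth_upt)
    then show "crule m a b c e" using c crule_cong[of m a a b b c c e "(!) ?\<delta>"] by simp
  next
    assume "crule m a b c e"
    then show "map e [0..<m] = ?\<delta>"
      using crule_unique[OF _ c] len by (intro nth_equalityI) auto
  qed
qed

lemma crule_exists: "\<exists>e. crule m a b c e"
proof -
  let ?\<delta> = "col_rule (map a [0..<m]) (map b [0..<m]) (map c [0..<m])"
  have "map ((!) ?\<delta>) [0..<m] = ?\<delta>" by (rule nth_equalityI) (auto simp: col_rule_def)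
  then show ?thesis using col_rule_map by blast
qed

section \<open>Growth diagrams\<close>

text \<open>One row of cells of a growth diagram, with \<open>R\<close> above and \<open>T\<close>
  below: given \<open>R\<close>, only the left border \<open>T 0\<close> is free.\<close>

definition cstep :: "nat \<Rightarrow> nat \<Rightarrow> (nat \<Rightarrow> nat \<Rightarrow> int) \<Rightarrow> (nat \<Rightarrow> nat \<Rightarrow> int) \<Rightarrow> bool" where
  "cstep m k R T \<longleftrightarrow> (\<forall>j<k. crule m (R j) (T j) (R (Suc j)) (T (Suc j)))"

lemma cstep_strip:
  assumes "chain m k R" "strip m (R 0) (T 0)" "cstep m k R T" "j \<le> k"
  shows "strip m (R j) (T j)"
  using assms(4)
proof (induction j)
  case 0
  show ?case by fact
next
  case (Suc j)
  then have "strip m (R j) (T j)" "strip m (R j) (R (Suc j))"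
    "crule m (R j) (T j) (R (Suc j)) (T (Suc j))"
    using assms by (auto simp: chain_def cstep_def)
  then show ?case using crule_strip crule_sym by blast
qed

lemma cstep_chain:
  assumes "chain m k R" "strip m (R 0) (T 0)" "cstep m k R T"
  shows "chain m k T"
  unfolding chain_def
proof (intro conjI allI impI)
  fix i assume i: "Suc i < m"
  have "T 0 (Suc i) \<le> R 0 i" "R 0 i \<le> T 0 i" using assms(2) i by (auto simp: strip_def)
  then show "T 0 (Suc i) \<le> T 0 i" by simp
next
  fix j assume j: "j < k"
  then have "strip m (R j) (T j)" "strip m (R j) (R (Suc j))"
    "crule m (R j) (T j) (R (Suc j)) (T (Suc j))"
    using assms cstep_strip[OF assms, of j] by (auto simp: chain_def cstep_def)
  then show "strip m (T j) (T (Suc j))" using crule_strip by blast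
qed

lemma cstep_unique:
  assumes "cstep m k R T" "cstep m k R' T'"
    and "\<And>j i. j \<le> k \<Longrightarrow> i < m \<Longrightarrow> R j i = R' j i" "\<And>i. i < m \<Longrightarrow> T 0 i = T' 0 i"
  shows "j \<le> k \<Longrightarrow> i < m \<Longrightarrow> T j i = T' j i"
proof (induction j arbitrary: i)
  case 0
  then show ?case using assms by simp
next
  case (Suc j)
  have "crule m (R' j) (T' j) (R' (Suc j)) (T (Suc j))
      = crule m (R j) (T j) (R (Suc j)) (T (Suc j))"
    using Suc assms(3) by (intro crule_cong) auto
  then show ?case using crule_unique[of m "R' j" "T' j" "R' (Suc j)"] assms(1,2) Suc.prems
    by (auto simp: cstep_def)
qed

lemma cstep_exists: "\<exists>T. T 0 = t \<and> cstep m k R T"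
proof -
  obtain f where f: "\<And>a b c. crule m a b c (f a b c)" using crule_exists by metis
  let ?T = "rec_nat t (\<lambda>j t. f (R j) t (R (Suc j)))"
  have "?T 0 = t \<and> cstep m k R ?T" using f by (auto simp: cstep_def)
  then show ?thesis by blast
qed

definition fgrow :: "nat \<Rightarrow> nat \<Rightarrow> nat \<Rightarrow> (nat \<Rightarrow> nat \<Rightarrow> nat \<Rightarrow> int) \<Rightarrow> bool" where
  "fgrow m l k X \<longleftrightarrow> (\<forall>i\<le>l. chain m k (X i)) \<and> (\<forall>j\<le>k. chain m l (\<lambda>i. X i j)) \<and>
     (\<forall>i<l. cstep m k (X i) (X (Suc i)))"

text \<open>A single relation between the four borders serves both instances of column insertion,
  read from \<open>P\<close>, \<open>Q\<close> or from \<open>T\<close>, \<open>U\<close>.\<close>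

definition cgrow :: "tab \<Rightarrow> tab \<Rightarrow> tab \<Rightarrow> tab \<Rightarrow> bool" where
  "cgrow P Q T U \<longleftrightarrow> (\<exists>m l k X. fgrow m l k X \<and> P = tab_of m k (X 0) \<and>
     Q = tab_of m l (\<lambda>i. X i 0) \<and> T = tab_of m k (X l) \<and> U = tab_of m l (\<lambda>i. X i k))"

lemma content_tab_of:
  "content (tab_of m k R) = map (\<lambda>j. (\<Sum>i<m. R (Suc j) i) - (\<Sum>i<m. R j i)) [0..<k]"
  by (auto simp: content_def interv_sum_list_conv_sum_set_nat atLeast0LessThan)

text \<open>Supplies the content condition of \<open>col_growth\<close>; cell by cell it is
  \<open>crule_sum\<close>, where the carries telescope.\<close>

lemma fgrow_content:
  assumes "fgrow m l k X" "i \<le> l"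
  shows "content (tab_of m k (X i)) = content (tab_of m k (X 0))"
  using assms(2)
proof (induction i)
  case (Suc i)
  have "content (tab_of m k (X (Suc i))) = content (tab_of m k (X i))"
    unfolding content_tab_of
  proof (rule map_cong[OF refl])
    fix j assume "j \<in> set [0..<k]"
    then have "crule m (X i j) (X (Suc i) j) (X i (Suc j)) (X (Suc i) (Suc j))"
      using assms(1) Suc.prems by (auto simp: fgrow_def cstep_def)
    from crule_sum[OF this] show "(\<Sum>p<m. X (Suc i) (Suc j) p) - (\<Sum>p<m. X (Suc i) j p)
        = (\<Sum>p<m. X i (Suc j) p) - (\<Sum>p<m. X i j p)" by simp
  qed
  then show ?case using Suc by simp
qed simp

lemma fgrow_transpose:
  assumes "fgrow m l k X"
  shows "fgrow m k l (\<lambda>j i. X i j)"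
  using assms by (auto simp: fgrow_def cstep_def intro: crule_sym)

lemma col_growth_iff_fgrow:
  assumes "\<And>i j. i \<le> l \<Longrightarrow> j \<le> k \<Longrightarrow> G i j = map (X i j) [0..<m]"
  shows "col_growth l k G \<longleftrightarrow> fgrow m l k X"
proof -
  have r: "grow_row k G i = tab_of m k (X i)" if "i \<le> l" for i
    using assms that by (auto simp: grow_row_def tab_of_def)
  have c: "grow_col l G j = tab_of m l (\<lambda>i. X i j)" if "j \<le> k" for j
    using assms that by (auto simp: grow_col_def tab_of_def)
  have loc: "G (Suc i) (Suc j) = col_rule (G i j) (G (Suc i) j) (G i (Suc j)) \<longleftrightarrow>
      crule m (X i j) (X (Suc i) j) (X i (Suc j)) (X (Suc i) (Suc j))" if "i < l" "j < k" for i j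
    using assms that by (simp add: col_rule_map)
  show ?thesis
  proof
    assume "col_growth l k G"
    then show "fgrow m l k X"
      by (auto simp: col_growth_def fgrow_def r c loc tableau_tab_of cstep_def)
  next
    assume X: "fgrow m l k X"
    show "col_growth l k G"
      unfolding col_growth_def
    proof (intro conjI allI impI)
      fix i assume i: "i \<le> l"
      show "tableau (grow_row k G i)" using X i by (simp add: r tableau_tab_of fgrow_def)
      show "content (grow_row k G i) = content (grow_row k G 0)"
        using fgrow_content[OF X i] i by (simp add: r)
    next
      fix j assume j: "j \<le> k"
      show "tableau (grow_col l G j)" using X j by (simp add: c tableau_tab_of fgrow_def)
      show "content (grow_col l G j) = content (grow_col l G 0)"
        using fgrow_content[OF fgrow_transpose[OF X] j] j by (simp add: c)
    next
      fix i j assume "i < l" "j < k"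
      then show "G (Suc i) (Suc j) = col_rule (G i j) (G (Suc i) j) (G i (Suc j))"
        using X by (simp add: loc fgrow_def cstep_def)
    qed
  qed
qed

lemma col_growth_lengths:
  assumes "col_growth l k G" "i \<le> l" "j \<le> k"
  shows "length (G i j) = length (G 0 0)"
proof -
  have r: "tableau (grow_row k G i)" and c: "tableau (grow_col l G 0)"
    using assms by (auto simp: col_growth_def)
  have "length (G i j) = length (G i 0)"
    using tableau_lengths[OF r, of j] tableau_lengths[OF r, of 0] assms(3)
    by (simp add: grow_row_def del: upt_Suc)
  also have "\<dots> = length (G 0 0)"
    using tableau_lengths[OF c, of i] tableau_lengths[OF c, of 0] assms(2)
    by (simp add: grow_col_def del: upt_Suc)
  finally show ?thesis .
qed

lemma cgrow_iff_col_growth: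
  "cgrow P Q T U \<longleftrightarrow> (\<exists>l k G. col_growth l k G \<and>
     grow_row k G 0 = P \<and> grow_col l G 0 = Q \<and> grow_row k G l = T \<and> grow_col l G k = U)"
proof
  assume "cgrow P Q T U"
  then obtain m l k X where X: "fgrow m l k X" "P = tab_of m k (X 0)"
     "Q = tab_of m l (\<lambda>i. X i 0)" "T = tab_of m k (X l)" "U = tab_of m l (\<lambda>i. X i k)"
    unfolding cgrow_def by blast
  let ?G = "\<lambda>i j. map (X i j) [0..<m]"
  have "col_growth l k ?G" using X(1) by (subst col_growth_iff_fgrow) auto
  then show "\<exists>l k G. col_growth l k G \<and>
     grow_row k G 0 = P \<and> grow_col l G 0 = Q \<and> grow_row k G l = T \<and> grow_col l G k = U"
    using X(2-5) by (intro exI[of _ l] exI[of _ k] exI[of _ ?G])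
      (simp add: grow_row_def grow_col_def tab_of_def)
next
  assume "\<exists>l k G. col_growth l k G \<and>
     grow_row k G 0 = P \<and> grow_col l G 0 = Q \<and> grow_row k G l = T \<and> grow_col l G k = U"
  then obtain l k G where G: "col_growth l k G"
     "grow_row k G 0 = P" "grow_col l G 0 = Q" "grow_row k G l = T" "grow_col l G k = U" by blast
  let ?m = "length (G 0 0)" and ?X = "\<lambda>i j p. G i j ! p"
  have nth: "G i j = map (?X i j) [0..<?m]" if "i \<le> l" "j \<le> k" for i j
    unfolding col_growth_lengths[OF G(1) that, symmetric] by (rule map_nth[symmetric])
  have "fgrow ?m l k ?X" using G(1) col_growth_iff_fgrow[of l k G ?X ?m, OF nth] by simp
  moreover have "P = tab_of ?m k (?X 0)" "Q = tab_of ?m l (\<lambda>i. ?X i 0)"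
    "T = tab_of ?m k (?X l)" "U = tab_of ?m l (\<lambda>i. ?X i k)"
    unfolding G(2-5)[symmetric] grow_row_def grow_col_def tab_of_def
    by (intro map_cong refl nth; simp del: upt_Suc; fail)+
  ultimately show "cgrow P Q T U" unfolding cgrow_def by blast
qed

lemma cgrow_sym: "cgrow P Q T U \<Longrightarrow> cgrow Q P U T"
  unfolding cgrow_def using fgrow_transpose by blast

text \<open>\<open>crule_rot\<close> exchanges the two extreme corners of every cell. Existence and
  uniqueness for given outer borders thus follow from those for given inner borders.\<close>

lemma cgrow_rot:
  assumes "cgrow P Q T U"
  shows "cgrow (rot T) (rot U) (rot P) (rot Q)"
proof -
  from assms obtain m l k X where X: "fgrow m l k X" "P = tab_of m k (X 0)"
     "Q = tab_of m l (\<lambda>i. X i 0)" "T = tab_of m k (X l)" "U = tab_of m l (\<lambda>i. X i k)"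
    unfolding cgrow_def by blast
  let ?Y = "\<lambda>i j p. - X (l - i) (k - j) (m - 1 - p)"
  have Y: "?Y i = rot_chain m k (X (l - i))" "(\<lambda>i. ?Y i j) = rot_chain m l (\<lambda>i. X i (k - j))" for i j
    by (simp_all add: rot_chain_def fun_eq_iff)
  have "cstep m k (?Y i) (?Y (Suc i))" if "i < l" for i
    unfolding cstep_def
  proof (intro allI impI)
    fix j assume "j < k"
    then have s: "k - j = Suc (k - Suc j)" "l - i = Suc (l - Suc i)" "k - Suc j < k" "l - Suc i < l"
      using that by auto
    have "crule m (X (l - Suc i) (k - Suc j)) (X (l - i) (k - Suc j))
        (X (l - Suc i) (k - j)) (X (l - i) (k - j))"
      unfolding s(1,2) using X(1) s(3,4) by (auto simp: fgrow_def cstep_def)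
    from crule_sym[OF crule_rot[OF this]]
    show "crule m (?Y i j) (?Y (Suc i) j) (?Y i (Suc j)) (?Y (Suc i) (Suc j))" .
  qed
  moreover have "chain m k (?Y i)" for i
    unfolding Y using X(1) by (auto simp: fgrow_def intro!: chain_rot)
  moreover have "chain m l (\<lambda>i. ?Y i j)" for j
    unfolding Y using X(1) by (auto simp: fgrow_def intro!: chain_rot)
  ultimately have "fgrow m l k ?Y" by (auto simp: fgrow_def)
  moreover have "rot T = tab_of m k (?Y 0)" "rot U = tab_of m l (\<lambda>i. ?Y i 0)"
    "rot P = tab_of m k (?Y l)" "rot Q = tab_of m l (\<lambda>i. ?Y i k)"
    unfolding Y using X(2-5) by (auto simp: rot_tab_of)
  ultimately show ?thesis unfolding cgrow_def by blast
qed

lemma cgrow_tableaux: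
  assumes "cgrow P Q T U"
  shows "tableau P" "tableau Q" "tableau T" "tableau U"
    "inner P = inner Q" "outer T = outer U" "inner T = outer Q" "inner U = outer P"
    "length T = length P" "length U = length Q"
  using assms by (auto simp: cgrow_def fgrow_def tableau_tab_of)

lemma cgrow_exists:
  assumes "tableau P" "tableau Q" "inner P = inner Q"
  obtains T U where "cgrow P Q T U"
proof -
  from assms(1) obtain m k R where P: "P = tab_of m k R" "chain m k R" by (rule tableauE)
  from assms(2) obtain m' l S where Q: "Q = tab_of m' l S" "chain m' l S" by (rule tableauE)
  have m: "m' = m" using arg_cong[OF assms(3), of length] P Q by simp
  have RS: "R 0 p = S 0 p" if "p < m" for p
    using arg_cong[OF assms(3), of "\<lambda>a. a ! p"] P Q that m by simp
  \<comment> \<open>Each row of the diagram is computed from the one above it and the next shape of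
    \<open>Q\<close>.\<close>
  define X where "X = rec_nat R (\<lambda>i R'. SOME T. T 0 = S (Suc i) \<and> cstep m k R' T)"
  have X0: "X 0 = R" by (simp add: X_def)
  have XS: "X (Suc i) 0 = S (Suc i) \<and> cstep m k (X i) (X (Suc i))" for i
    unfolding X_def using someI_ex[OF cstep_exists] by simp
  have Xc: "X i 0 p = S i p" if "p < m" for i p using RS X0 XS that by (cases i) auto
  have Sst: "strip m (X i 0) (X (Suc i) 0)" if "i < l" for i
  proof -
    have "strip m (S i) (S (Suc i))" using Q(2) m that by (simp add: chain_def)
    then show ?thesis using Xc by (simp add: strip_def Suc_lessD)
  qed
  have ch: "chain m k (X i)" if "i \<le> l" for i
    using that
  proof (induction i)
    case (Suc i)
    then show ?case using cstep_chain[of m k "X i" "X (Suc i)"] XS Sst by simp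
  qed (simp add: X0 P)
  have "chain m l (\<lambda>i. X i j)" if "j \<le> k" for j
    unfolding chain_def
  proof (intro conjI allI impI)
    fix i assume "i < l"
    then show "strip m (X i j) (X (Suc i) j)"
      using cstep_strip[of m k "X i" "X (Suc i)" j] ch Sst XS that by simp
  qed (use chain_shapes[OF ch that, of 0] in simp)
  then have "fgrow m l k X" unfolding fgrow_def using ch XS by simp
  moreover have "P = tab_of m k (X 0)" "Q = tab_of m l (\<lambda>i. X i 0)"
    using P Q m X0 Xc by (auto simp: tab_of_eq_iff)
  ultimately show ?thesis using that unfolding cgrow_def by blast
qed

lemma cgrow_unique:
  assumes "cgrow P Q T U" "cgrow P Q T' U'"
  shows "T = T' \<and> U = U'"
proof -
  from assms(1) obtain m l k X where X: "fgrow m l k X" "P = tab_of m k (X 0)"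
     "Q = tab_of m l (\<lambda>i. X i 0)" "T = tab_of m k (X l)" "U = tab_of m l (\<lambda>i. X i k)"
    unfolding cgrow_def by blast
  from assms(2) obtain m' l' k' X' where X': "fgrow m' l' k' X'" "P = tab_of m' k' (X' 0)"
     "Q = tab_of m' l' (\<lambda>i. X' i 0)" "T' = tab_of m' k' (X' l')" "U' = tab_of m' l' (\<lambda>i. X' i k')"
    unfolding cgrow_def by blast
  have k: "k' = k" using X(2) X'(2) length_tab_of by (metis Suc_inject)
  have l: "l' = l" using X(3) X'(3) length_tab_of by (metis Suc_inject)
  have m: "m' = m" using X(2) X'(2) inner_tab_of by (metis length_map length_upt diff_zero)
  have "X i j p = X' i j p" if "i \<le> l" "j \<le> k" "p < m" for i j p
    using that
  proof (induction i arbitrary: j p)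
    case 0
    then show ?case using X(2) X'(2) k m by (simp add: tab_of_eq_iff)
  next
    case (Suc i)
    have "X (Suc i) 0 p = X' (Suc i) 0 p" if "p < m" for p
      using X(3) X'(3) l m Suc.prems that by (simp add: tab_of_eq_iff)
    moreover have "cstep m k (X i) (X (Suc i))" "cstep m k (X' i) (X' (Suc i))"
      using X(1) X'(1) Suc.prems k l m by (auto simp: fgrow_def)
    ultimately show ?case using cstep_unique[of m k "X i" "X (Suc i)" "X' i" "X' (Suc i)"] Suc
      by auto
  qed
  then show ?thesis using X X' k l m by (simp add: tab_of_eq_iff)
qed

lemma cgrow_unique_outer: "cgrow P Q T U \<Longrightarrow> cgrow P' Q' T U \<Longrightarrow> P = P' \<and> Q = Q'"
  using cgrow_unique[OF cgrow_rot cgrow_rot] rot_rot by metis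

lemma inner_rot: "T \<noteq> [] \<Longrightarrow> inner (rot T) = rev (map uminus (outer T))"
  by (simp add: inner_def outer_def rot_def hd_rev last_map)

lemma cgrow_exists_outer:
  assumes "tableau T" "tableau U" "outer T = outer U"
  obtains P Q where "cgrow P Q T U"
proof -
  have "inner (rot T) = inner (rot U)"
    using assms by (simp add: inner_rot tableau_def)
  then obtain P Q where "cgrow (rot T) (rot U) P Q"
    using assms cgrow_exists[of "rot T" "rot U"] by (auto simp: tableau_rot)
  then have "cgrow (rot P) (rot Q) T U" using cgrow_rot by fastforce
  then show ?thesis using that by blast
qed

lemma col_insert_inner_eq: "cgrow P Q T U \<Longrightarrow> col_insert_inner P Q = (T, U)"
  unfolding col_insert_inner_def cgrow_iff_col_growth[symmetric]
  by (rule the_equality) (auto dest: cgrow_unique)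

lemma col_insert_outer_eq: "cgrow T U P Q \<Longrightarrow> col_insert_outer P Q = (T, U)"
proof -
  assume c: "cgrow T U P Q"
  have "(\<exists>l k G. col_growth l k G \<and>
     grow_row k G l = P \<and> grow_col l G k = Q \<and> grow_row k G 0 = T \<and> grow_col l G 0 = U)
     \<longleftrightarrow> cgrow T U P Q" for T U
    unfolding cgrow_iff_col_growth by blast
  then show ?thesis
    unfolding col_insert_outer_def using c by (intro the_equality) (auto dest: cgrow_unique_outer)
qed

section \<open>Column insertion of a single box\<close>

text \<open>\<open>\<iota> j\<close> is the row of the additional box in shape \<open>j\<close>. It
  climbs through rows that are full, in the sense that one more box would break the interlacing, and
  may pass several of them at one entry, whereas the hole of a slide drops at most one row per
  entry.\<close>

definition col_path :: "nat \<Rightarrow> nat \<Rightarrow> (nat \<Rightarrow> nat \<Rightarrow> int) \<Rightarrow> nat \<Rightarrow> (nat \<Rightarrow> nat) \<Rightarrow> bool" where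
  "col_path m k R i \<iota> \<longleftrightarrow> \<iota> 0 = i \<and> i < m \<and> (0 < i \<longrightarrow> R 0 i < R 0 (i - 1)) \<and>
     (\<forall>j<k. \<iota> (Suc j) \<le> \<iota> j \<and>
        (\<forall>a. \<iota> (Suc j) < a \<and> a \<le> \<iota> j \<longrightarrow> R (Suc j) a = R j (a - 1)) \<and>
        (0 < \<iota> (Suc j) \<longrightarrow> R (Suc j) (\<iota> (Suc j)) \<noteq> R j (\<iota> (Suc j) - 1)))"

definition plus_box :: "(nat \<Rightarrow> nat \<Rightarrow> int) \<Rightarrow> (nat \<Rightarrow> nat) \<Rightarrow> nat \<Rightarrow> nat \<Rightarrow> int" where
  "plus_box R \<iota> j i = R j i + of_bool (i = \<iota> j)"

text \<open>The box stops in the \<open>LEAST\<close> row that it can reach through full rows: were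
  that row full as well, the row above it would be reachable.\<close>

lemma col_path_exists:
  assumes "i < m" "0 < i \<longrightarrow> R 0 i < R 0 (i - 1)"
  obtains \<iota> where "col_path m k R i \<iota>"
proof
  let ?P = "\<lambda>j p q. q \<le> p \<and> (\<forall>a. q < a \<and> a \<le> p \<longrightarrow> R (Suc j) a = R j (a - 1))"
  define \<iota> where "\<iota> = rec_nat i (\<lambda>j p. LEAST q. ?P j p q)"
  have step: "\<iota> (Suc j) = (LEAST q. ?P j (\<iota> j) q)" for j by (simp add: \<iota>_def)
  have P: "?P j (\<iota> j) (\<iota> (Suc j))" for j
    unfolding step by (rule LeastI[of _ "\<iota> j"]) auto
  have "R (Suc j) (\<iota> (Suc j)) \<noteq> R j (\<iota> (Suc j) - 1)" if "0 < \<iota> (Suc j)" for j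
  proof
    assume eq: "R (Suc j) (\<iota> (Suc j)) = R j (\<iota> (Suc j) - 1)"
    have "?P j (\<iota> j) (\<iota> (Suc j) - 1)"
    proof (intro conjI allI impI)
      show "\<iota> (Suc j) - 1 \<le> \<iota> j" using conjunct1[OF P[of j]] by linarith
      fix a assume a: "\<iota> (Suc j) - 1 < a \<and> a \<le> \<iota> j"
      show "R (Suc j) a = R j (a - 1)"
      proof (cases "a = \<iota> (Suc j)")
        case False
        then have "\<iota> (Suc j) < a" using a by linarith
        then show ?thesis using a P[of j] by blast
      qed (use eq in simp)
    qed
    from Least_le[of "?P j (\<iota> j)", OF this] show False using step[of j] that by linarith
  qed
  moreover have "\<iota> 0 = i" by (simp add: \<iota>_def)
  ultimately show "col_path m k R i \<iota>"
    unfolding col_path_def using assms P by blast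
qed

lemma col_path_le:
  assumes "col_path m k R i \<iota>" "j \<le> k"
  shows "\<iota> j \<le> i" "\<iota> j < m"
proof -
  show "\<iota> j \<le> i" using assms(2)
  proof (induction j)
    case 0
    then show ?case using assms(1) by (simp add: col_path_def)
  next
    case (Suc j)
    then have "\<iota> (Suc j) \<le> \<iota> j" using assms(1) by (simp add: col_path_def)
    then show ?case using Suc by simp
  qed
  then show "\<iota> j < m" using assms(1) by (simp add: col_path_def)
qed

lemma cstep_plus_box:
  assumes ch: "chain m k R" and cp: "col_path m k R i \<iota>"
  shows "cstep m k R (plus_box R \<iota>)"
  unfolding cstep_def
proof (intro allI impI)
  fix j assume j: "j < k"
  \<comment> \<open>One box is carried out of exactly those rows through which it climbs.\<close>
  let ?d = "\<lambda>a. of_bool (\<iota> (Suc j) < a \<and> a \<le> \<iota> j) :: int"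
  have le: "\<iota> (Suc j) \<le> \<iota> j" and bump: "\<And>a. \<iota> (Suc j) < a \<Longrightarrow> a \<le> \<iota> j \<Longrightarrow> R (Suc j) a = R j (a - 1)"
    and stop: "0 < \<iota> (Suc j) \<Longrightarrow> R (Suc j) (\<iota> (Suc j)) \<noteq> R j (\<iota> (Suc j) - 1)"
    using cp j by (auto simp: col_path_def)
  show "crule m (R j) (plus_box R \<iota> j) (R (Suc j)) (plus_box R \<iota> (Suc j))"
    unfolding crule_def
  proof (intro exI[of _ ?d] conjI allI impI)
    show "?d m = 0" using col_path_le[OF cp, of j] j by simp
  next
    fix a assume "a < m"
    show "0 \<le> ?d a" by simp
    show "plus_box R \<iota> (Suc j) a + ?d a = plus_box R \<iota> j a + R (Suc j) a + ?d (Suc a) - R j a"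
      using le by (auto simp: plus_box_def of_bool_def)
  next
    fix a assume a: "Suc a < m"
    have stop': "Suc a = \<iota> (Suc j) \<Longrightarrow> R (Suc j) (Suc a) \<noteq> R j a"
      using stop by (metis diff_Suc_1 zero_less_Suc)
    show "plus_box R \<iota> (Suc j) (Suc a) \<le> R j a"
      using chain_diag[OF ch j a] stop' by (auto simp: plus_box_def of_bool_def)
    show "?d (Suc a) = 0 \<or> plus_box R \<iota> (Suc j) (Suc a) = R j a"
      using bump[of "Suc a"] by (auto simp: plus_box_def of_bool_def)
  qed simp
qed

lemma strip_plus_box:
  assumes ch: "chain m k R" and cp: "col_path m k R i \<iota>"
  shows "strip m (R 0) (plus_box R \<iota> 0)"
  unfolding strip_def
proof (intro conjI allI impI)
  fix q assume q: "Suc q < m"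
  show "plus_box R \<iota> 0 (Suc q) \<le> R 0 q"
  proof (cases "Suc q = i")
    case True
    then show ?thesis using cp by (auto simp: plus_box_def col_path_def)
  next
    case False
    then show ?thesis using cp chain_shapes[OF ch _ q, of 0] by (auto simp: plus_box_def col_path_def)
  qed
qed (simp add: plus_box_def)

lemma crule_refl:
  assumes "strip m a b"
  shows "crule m a a b b"
  unfolding crule_def using assms by (intro exI[of _ "\<lambda>_. 0"]) (auto simp: strip_def)

text \<open>Stacks the cell inserting one box, which sits in row \<open>s\<close> of
  \<open>z\<close> and row \<open>s'\<close> of \<open>f\<close>, on the cell inserting the rest;
  the carries add up. Rows the box has passed are full, so \<open>g\<close> agrees with
  \<open>b\<close> there and the capping equations survive for the sum. This relies on
  \<open>ya\<close>: the rest must not touch rows below \<open>s\<close>, so the lowest box goes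
  first.\<close>

lemma crule_compose:
  assumes s: "s' \<le> s" "s < m"
    and z: "\<And>p. z p = a p + of_bool (p = s)" and f: "\<And>p. f p = b p + of_bool (p = s')"
    and ya: "\<And>p. s < p \<Longrightarrow> p < m \<Longrightarrow> y p = a p"
    and bump: "\<And>p. s' < p \<Longrightarrow> p \<le> s \<Longrightarrow> b p = a (p - 1)"
    and ab: "strip m a b" and fg: "strip m f g" and cr: "crule m z y f g"
  shows "crule m a y b g" "\<And>p. s' < p \<Longrightarrow> p < m \<Longrightarrow> g p = b p"
proof -
  from cr obtain d where d: "d 0 = 0" "d m = 0"
    "\<And>i. i < m \<Longrightarrow> 0 \<le> d i \<and> g i + d i = y i + f i + d (Suc i) - z i"
    "\<And>i. Suc i < m \<Longrightarrow> g (Suc i) \<le> z i \<and> (d (Suc i) = 0 \<or> g (Suc i) = z i)"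
    unfolding crule_def by blast
  have fle: "f p \<le> g p" if "p < m" for p using fg that by (simp add: strip_def)
  have below: "d p = 0 \<and> (p < m \<longrightarrow> g p = b p)" if "s < p" "p \<le> m" for p
    using that(2,1)
  proof (induction p rule: inc_induct)
    case base
    then show ?case using d(2) by simp
  next
    case (step n)
    have "y n = z n" "f n = b n" using ya z f s step by auto
    then show ?case using d(3)[of n] fle[of n] step by auto
  qed
  have tail: "g p = b p" if p: "s' < p" "p < m" for p
  proof (cases "s < p")
    case True
    then show ?thesis using below that by simp
  next
    case False
    then obtain q where q: "p = Suc q" "q < s" using p by (cases p) auto
    then have "g p \<le> a q" using d(4)[of q] z[of q] that by simp
    moreover have "b p = a q" using bump[of p] q that by simp
    moreover have "b p \<le> g p" using f[of p] fle[of p] that by simp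
    ultimately show ?thesis by simp
  qed
  then show "\<And>p. s' < p \<Longrightarrow> p < m \<Longrightarrow> g p = b p" .
  let ?d = "\<lambda>p. of_bool (s' < p \<and> p \<le> s) + d p"
  show "crule m a y b g"
    unfolding crule_def
  proof (intro exI[of _ ?d] conjI allI impI)
    fix p assume p: "p < m"
    show "0 \<le> ?d p" using d(3)[OF p] by simp
    show "g p + ?d p = y p + b p + ?d (Suc p) - a p"
      using d(3)[OF p] z[of p] f[of p] s by (auto simp: of_bool_def split: if_splits)
  next
    fix p assume p: "Suc p < m"
    show "g (Suc p) \<le> a p"
    proof (cases "p = s")
      case True
      then show ?thesis using below[of "Suc s"] p ab by (simp add: strip_def)
    next
      case False
      then show ?thesis using d(4)[OF p] z[of p] by simp
    qed
    show "?d (Suc p) = 0 \<or> g (Suc p) = a p"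
    proof (cases "s' < Suc p \<and> Suc p \<le> s")
      case True
      then show ?thesis using tail[of "Suc p"] p bump[of "Suc p"] by simp
    next
      case False
      then show ?thesis using d(4)[OF p] z[of p] below[of "Suc p"] p by (cases "p = s") auto
    qed
  qed (use d s in auto)
qed

text \<open>The second conclusion of \<open>crule_compose\<close> is its hypothesis
  \<open>ya\<close> for the next cell, so the composition propagates along the row.\<close>

lemma cstep_compose:
  assumes ch: "chain m k R" and cp: "col_path m k R i \<iota>"
    and Y: "cstep m k (plus_box R \<iota>) Y" "strip m (plus_box R \<iota> 0) (Y 0)"
    and Y0: "\<And>p. i < p \<Longrightarrow> p < m \<Longrightarrow> Y 0 p = R 0 p"
  shows "cstep m k R Y"
proof -
  note Z = cstep_chain[OF ch strip_plus_box[OF ch cp] cstep_plus_box[OF ch cp]]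
  have loc: "crule m (R j) (Y j) (R (Suc j)) (Y (Suc j)) \<and>
      (\<forall>p. \<iota> (Suc j) < p \<and> p < m \<longrightarrow> Y (Suc j) p = R (Suc j) p)"
    if j: "j < k" and tl: "\<forall>p. \<iota> j < p \<and> p < m \<longrightarrow> Y j p = R j p" for j
  proof -
    have "strip m (plus_box R \<iota> (Suc j)) (Y (Suc j))"
      using cstep_strip[OF Z Y(2,1), of "Suc j"] j by simp
    moreover have "crule m (plus_box R \<iota> j) (Y j) (plus_box R \<iota> (Suc j)) (Y (Suc j))"
      using Y(1) j by (simp add: cstep_def)
    moreover have "strip m (R j) (R (Suc j))" using ch j by (simp add: chain_def)
    moreover have "\<iota> (Suc j) \<le> \<iota> j" "\<iota> j < m"
      "\<And>p. \<iota> (Suc j) < p \<Longrightarrow> p \<le> \<iota> j \<Longrightarrow> R (Suc j) p = R j (p - 1)"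
      using cp j col_path_le[OF cp, of j] by (auto simp: col_path_def)
    ultimately show ?thesis
      using crule_compose[of "\<iota> (Suc j)" "\<iota> j" m "plus_box R \<iota> j" "R j" "plus_box R \<iota> (Suc j)"
          "R (Suc j)" "Y j" "Y (Suc j)"] tl
      by (auto simp: plus_box_def)
  qed
  have "\<forall>p. \<iota> j < p \<and> p < m \<longrightarrow> Y j p = R j p" if "j \<le> k" for j
    using that
  proof (induction j)
    case 0
    then show ?case using cp Y0 by (simp add: col_path_def)
  next
    case (Suc j)
    then show ?case using loc[of j] by simp
  qed
  then show ?thesis using loc by (simp add: cstep_def)
qed

section \<open>Realignment and bumps\<close>

definition shift :: "(nat \<Rightarrow> nat \<Rightarrow> int) \<Rightarrow> (nat \<Rightarrow> int) \<Rightarrow> nat \<Rightarrow> nat \<Rightarrow> int" where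
  "shift R v j i = R j i + v i"

abbreviation unit_row :: "nat \<Rightarrow> nat \<Rightarrow> int" where
  "unit_row i \<equiv> \<lambda>a. of_bool (a = i)"

lemma shift_shift: "shift (shift R v) w = shift R (\<lambda>a. v a + w a)"
  by (simp add: shift_def fun_eq_iff)

lemma shift_0 [simp]: "shift R (\<lambda>_. 0) = R"
  by (simp add: shift_def fun_eq_iff)

text \<open>The flag is set by the first entry at which rows \<open>i\<close> and
  \<open>Suc i\<close> interlace tightly. It stays set because all later shapes contain the moved
  entry.\<close>

fun bumped :: "(nat \<Rightarrow> nat \<Rightarrow> int) \<Rightarrow> nat \<Rightarrow> nat \<Rightarrow> bool" where
  "bumped R i 0 \<longleftrightarrow> False"
| "bumped R i (Suc j) \<longleftrightarrow> bumped R i j \<or> R (Suc j) (Suc i) = R j i"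

definition bump :: "(nat \<Rightarrow> nat \<Rightarrow> int) \<Rightarrow> nat \<Rightarrow> nat \<Rightarrow> nat \<Rightarrow> int" where
  "bump R i j a = R j a + (if bumped R i j then of_bool (a = i) - of_bool (a = Suc i) else 0)"

text \<open>Only rows \<open>i\<close> and \<open>Suc i\<close> are involved, so the condition makes
  sense for families whose other rows are badly aligned.\<close>

definition bumpable :: "nat \<Rightarrow> nat \<Rightarrow> (nat \<Rightarrow> nat \<Rightarrow> int) \<Rightarrow> nat \<Rightarrow> bool" where
  "bumpable m k R i \<longleftrightarrow> Suc i < m \<and> R 0 (Suc i) < R 0 i \<and> (\<forall>j<k. R (Suc j) (Suc i) \<le> R j i)"

text \<open>Strict interlacing at every other pair of neighbouring rows keeps a hole or an added box
  from crossing there.\<close>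

definition slack :: "nat \<Rightarrow> nat \<Rightarrow> (nat \<Rightarrow> nat \<Rightarrow> int) \<Rightarrow> nat \<Rightarrow> bool" where
  "slack m k R i \<longleftrightarrow> (\<forall>a. Suc a < m \<and> a \<noteq> i \<longrightarrow> (\<forall>j<k. R (Suc j) (Suc a) < R j a))"

text \<open>Hence the entry that sets the flag, bringing row \<open>Suc i\<close> up to
  \<open>R j i\<close>, really owns a box in that row which can be moved.\<close>

lemma bumpable_strict:
  assumes "bumpable m k R i" "\<And>j. j < k \<Longrightarrow> R j i \<le> R (Suc j) i" "j \<le> k" "\<not> bumped R i j"
  shows "R j (Suc i) < R j i"
proof (cases j)
  case 0
  then show ?thesis using assms(1) by (simp add: bumpable_def)
next
  case (Suc j')
  then have "R j (Suc i) \<le> R j' i" "R j (Suc i) \<noteq> R j' i" "R j' i \<le> R j i"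
    using assms by (auto simp: bumpable_def)
  then show ?thesis by simp
qed

lemma chain_bump:
  assumes ch: "chain m k R" and b: "bumpable m k R i" and s: "slack m k R i"
  shows "chain m k (bump R i)"
  unfolding chain_def strip_def
proof (intro conjI allI impI)
  fix a assume "Suc a < m"
  then show "bump R i 0 (Suc a) \<le> bump R i 0 a"
    using chain_shapes[OF ch, of 0 a] by (simp add: bump_def)
next
  fix j a assume j: "j < k" and a: "a < m"
  have "R j (Suc i) < R j i" if "\<not> bumped R i j"
    using bumpable_strict[OF b _ _ that] chain_step[OF ch] b j by (auto simp: bumpable_def)
  then show "bump R i j a \<le> bump R i (Suc j) a"
    using chain_step[OF ch j a] by (auto simp: bump_def)
next
  fix j a assume j: "j < k" and a: "Suc a < m"
  show "bump R i (Suc j) (Suc a) \<le> bump R i j a"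
    using chain_diag[OF ch j a] s j a by (cases "a = i") (force simp: bump_def slack_def)+
qed

lemma bump_shift:
  assumes "v (Suc i) = v i"
  shows "bump (shift R v) i = shift (bump R i) v"
proof -
  have "bumped (shift R v) i j = bumped R i j" for j
    by (induction j) (auto simp: shift_def assms)
  then show ?thesis by (simp add: bump_def shift_def fun_eq_iff)
qed

lemma chain_bounded:
  fixes R :: "nat \<Rightarrow> nat \<Rightarrow> int"
  obtains N where "\<And>j a. j \<le> k \<Longrightarrow> a < m \<Longrightarrow> \<bar>R j a\<bar> \<le> N"
proof
  fix j a assume "j \<le> k" "a < m"
  then have "\<bar>R j a\<bar> \<le> (\<Sum>a<m. \<bar>R j a\<bar>)" by (intro member_le_sum) auto
  also have "\<dots> \<le> (\<Sum>j\<le>k. \<Sum>a<m. \<bar>R j a\<bar>)"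
    using \<open>j \<le> k\<close> by (intro member_le_sum[where f = "\<lambda>j. \<Sum>a<m. \<bar>R j a\<bar>"]) (auto intro: sum_nonneg)
  finally show "\<bar>R j a\<bar> \<le> (\<Sum>j\<le>k. \<Sum>a<m. \<bar>R j a\<bar>)" .
qed

text \<open>The common core of slides and insertions: moving one row by one unit is respected in
  both directions, a bump in one direction and under \<open>slack\<close>.\<close>

locale alignable =
  fixes D :: "tab \<Rightarrow> tab \<Rightarrow> bool"
  assumes same_shape: "D P P' \<Longrightarrow> tableau P \<and> tableau P' \<and> chain_shape P = chain_shape P'"
    and align: "\<lbrakk>i < m; chain m k R; chain m k' R'; chain m k (shift R (unit_row i));
      chain m k' (shift R' (unit_row i))\<rbrakk> \<Longrightarrow>
      D (tab_of m k (shift R (unit_row i))) (tab_of m k' (shift R' (unit_row i))) \<longleftrightarrow>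
      D (tab_of m k R) (tab_of m k' R')"
    and bump: "\<lbrakk>chain m k R; chain m k' R'; bumpable m k R i; bumpable m k' R' i; slack m k R i;
      slack m k' R' i; D (tab_of m k R) (tab_of m k' R')\<rbrakk> \<Longrightarrow>
      D (tab_of m k (bump R i)) (tab_of m k' (bump R' i))"
begin

text \<open>Units are taken from the lowest row that is still shifted. The rows below it are back in
  place, so every intermediate family is a chain.\<close>

lemma shift_up:
  assumes "chain m k R" "chain m k' R'" "chain m k (shift R v)" "chain m k' (shift R' v)"
    "\<And>i. i < m \<Longrightarrow> 0 \<le> v i"
  shows "D (tab_of m k (shift R v)) (tab_of m k' (shift R' v)) \<longleftrightarrow> D (tab_of m k R) (tab_of m k' R')"
  using assms
proof (induction "nat (\<Sum>i<m. v i)" arbitrary: v rule: less_induct)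
  case less
  show ?case
  proof (cases "\<exists>i<m. 0 < v i")
    case False
    then have "v i = 0" if "i < m" for i using less.prems(5)[OF that] that by force
    then have "tab_of m k (shift R v) = tab_of m k R" "tab_of m k' (shift R' v) = tab_of m k' R'"
      by (auto simp: tab_of_eq_iff shift_def)
    then show ?thesis by simp
  next
    case True
    define i where "i = Max {i. i < m \<and> 0 < v i}"
    have fin: "finite {i. i < m \<and> 0 < v i}" by simp
    have i: "i < m" "0 < v i" using Max_in[OF fin] True by (auto simp: i_def)
    have above: "v a = 0" if "i < a" "a < m" for a
      using Max_ge[OF fin, of a] less.prems(5)[OF that(2)] that unfolding i_def[symmetric] by force
    let ?w = "\<lambda>a. v a - of_bool (a = i)"
    have w0: "0 \<le> ?w a" if "a < m" for a using less.prems(5)[OF that] i by auto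
    have ch: "chain m n (shift S ?w)" if "chain m n S" "chain m n (shift S v)" for n S
    proof -
      \<comment> \<open>The comparison of rows \<open>i\<close> and \<open>Suc i\<close> is
        inherited from \<open>S\<close>, all others from \<open>shift S v\<close>.\<close>
      have c: "?w (Suc a) + S' \<le> ?w a + S''" if "Suc a < m" "S' \<le> S''" "v (Suc a) + S' \<le> v a + S''"
        for a S' S''
        using that above[of "Suc a"] i by (cases "a = i") auto
      show ?thesis
        unfolding chain_def strip_def
      proof (intro conjI allI impI)
        fix a assume a: "Suc a < m"
        show "shift S ?w 0 (Suc a) \<le> shift S ?w 0 a"
          using c[OF a, of "S 0 (Suc a)" "S 0 a"] chain_shapes[OF \<open>chain m n S\<close> _ a, of 0]
            chain_shapes[OF \<open>chain m n (shift S v)\<close> _ a, of 0] by (simp add: shift_def)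
      next
        fix j a assume "j < n" "a < m"
        then show "shift S ?w j a \<le> shift S ?w (Suc j) a"
          using chain_step[OF \<open>chain m n S\<close>] by (simp add: shift_def)
      next
        fix j a assume j: "j < n" and a: "Suc a < m"
        show "shift S ?w (Suc j) (Suc a) \<le> shift S ?w j a"
          using c[OF a, of "S (Suc j) (Suc a)" "S j a"] chain_diag[OF \<open>chain m n S\<close> j a]
            chain_diag[OF \<open>chain m n (shift S v)\<close> j a] by (simp add: shift_def)
      qed
    qed
    have sw: "shift (shift S ?w) (unit_row i) = shift S v" for S by (simp add: shift_def fun_eq_iff)
    have "(\<Sum>a<m. ?w a) < (\<Sum>a<m. v a)"
      using i by (intro sum_strict_mono_ex1) auto
    moreover have "0 \<le> (\<Sum>a<m. ?w a)" using w0 by (intro sum_nonneg) auto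
    ultimately have "nat (\<Sum>a<m. ?w a) < nat (\<Sum>a<m. v a)" by simp
    from less.hyps[OF this less.prems(1,2)]
    have "D (tab_of m k (shift R ?w)) (tab_of m k' (shift R' ?w)) \<longleftrightarrow> D (tab_of m k R) (tab_of m k' R')"
      using ch less.prems w0 by simp
    moreover have "D (tab_of m k (shift R v)) (tab_of m k' (shift R' v)) \<longleftrightarrow>
        D (tab_of m k (shift R ?w)) (tab_of m k' (shift R' ?w))"
      using align[of i m k "shift R ?w" k' "shift R' ?w"] i ch less.prems unfolding sw by simp
    ultimately show ?thesis by simp
  qed
qed

text \<open>Meaningful for families that are not chains: \<open>D\<close> itself forces the
  realigned ones to be tableaux.\<close>

definition aligned :: "nat \<Rightarrow> nat \<Rightarrow> nat \<Rightarrow> (nat \<Rightarrow> nat \<Rightarrow> int) \<Rightarrow> (nat \<Rightarrow> nat \<Rightarrow> int) \<Rightarrow> bool" where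
  "aligned m k k' R R' \<longleftrightarrow> (\<exists>v. D (tab_of m k (shift R v)) (tab_of m k' (shift R' v)))"

lemma D_chain: "D (tab_of m k R) (tab_of m' k' R') \<Longrightarrow> chain m k R \<and> chain m' k' R'"
  using same_shape tableau_tab_of by blast

lemma aligned_shift: "aligned m k k' (shift R w) (shift R' w) \<longleftrightarrow> aligned m k k' R R'"
proof
  assume "aligned m k k' (shift R w) (shift R' w)"
  then show "aligned m k k' R R'" by (auto simp: aligned_def shift_shift)
next
  assume "aligned m k k' R R'"
  then obtain v where "D (tab_of m k (shift R v)) (tab_of m k' (shift R' v))"
    by (auto simp: aligned_def)
  moreover have "shift S v = shift (shift S w) (\<lambda>a. v a - w a)" for S
    by (simp add: shift_def fun_eq_iff)
  ultimately show "aligned m k k' (shift R w) (shift R' w)" unfolding aligned_def by metis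
qed

lemma aligned_cong:
  assumes "\<And>j a. j \<le> k \<Longrightarrow> a < m \<Longrightarrow> R j a = S j a" "\<And>j a. j \<le> k' \<Longrightarrow> a < m \<Longrightarrow> R' j a = S' j a"
  shows "aligned m k k' R R' \<longleftrightarrow> aligned m k k' S S'"
proof -
  have "tab_of m k (shift R v) = tab_of m k (shift S v)"
    "tab_of m k' (shift R' v) = tab_of m k' (shift S' v)" for v
    using assms by (auto simp: tab_of_eq_iff shift_def)
  then show ?thesis by (simp add: aligned_def)
qed

text \<open>Shifts that make a family a chain are closed under componentwise minimum. The witness
  \<open>v\<close> and the zero shift are both reached from their minimum by
  \<open>shift_up\<close>.\<close>

lemma aligned_D:
  assumes "aligned m k k' R R'" "chain m k R" "chain m k' R'"
  shows "D (tab_of m k R) (tab_of m k' R')"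
proof -
  from assms(1) obtain v where v: "D (tab_of m k (shift R v)) (tab_of m k' (shift R' v))"
    by (auto simp: aligned_def)
  let ?u = "\<lambda>a. min (v a) 0"
  have ch: "chain m n (shift S ?u)" if "chain m n S" "chain m n (shift S v)" for n S
    using that by (fastforce simp: chain_def strip_def shift_def)
  have u: "chain m k (shift R ?u)" "chain m k' (shift R' ?u)"
    using ch assms(2,3) D_chain[OF v] by auto
  have sv: "shift (shift S ?u) (\<lambda>a. v a - ?u a) = shift S v" and
    s0: "shift (shift S ?u) (\<lambda>a. - ?u a) = S" for S
    by (simp_all add: shift_def fun_eq_iff)
  have "D (tab_of m k (shift R ?u)) (tab_of m k' (shift R' ?u))"
    using shift_up[OF u, of "\<lambda>a. v a - ?u a"] D_chain[OF v] v unfolding sv by simp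
  then show ?thesis
    using shift_up[OF u, of "\<lambda>a. - ?u a"] assms(2,3) unfolding s0 by simp
qed

lemma D_aligned: "D (tab_of m k R) (tab_of m k' R') \<Longrightarrow> aligned m k k' R R'"
  unfolding aligned_def by (intro exI[of _ "\<lambda>_. 0"]) simp

text \<open>Rows other than \<open>i\<close> and \<open>i + 1\<close> are moved so far apart that they do not interfere.\<close>

lemma aligned_bump:
  assumes al: "aligned m k k' R R'" and b: "bumpable m k R i" "bumpable m k' R' i"
  shows "aligned m k k' (bump R i) (bump R' i)"
proof -
  from al obtain v where v: "D (tab_of m k (shift R v)) (tab_of m k' (shift R' v))"
    by (auto simp: aligned_def)
  obtain N where N: "\<And>j a. j \<le> k \<Longrightarrow> a < m \<Longrightarrow> \<bar>R j a\<bar> \<le> N" using chain_bounded[of k m R] by blast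
  obtain N' where N': "\<And>j a. j \<le> k' \<Longrightarrow> a < m \<Longrightarrow> \<bar>R' j a\<bar> \<le> N'" using chain_bounded[of k' m R'] by blast
  \<comment> \<open>\<open>M\<close> exceeds the difference of any two row ends on either
    side.\<close>
  define M where "M = 2 * max N N' + 1"
  \<comment> \<open>Neighbouring rows are separated by \<open>M\<close>, except that
    \<open>i\<close> and \<open>Suc i\<close> keep their relative position, so that the bump
    commutes with the shift.\<close>
  define w where "w = (\<lambda>a. (if a \<le> i then int i - int a else int i + 1 - int a) * M)"
  have wi: "w (Suc i) = w i" by (simp add: w_def)
  have w: "w (Suc a) = w a - M" if "a \<noteq> i" for a
    using that by (simp add: w_def algebra_simps)
  have far: "chain m n (shift S w) \<and> slack m n (shift S w) i \<and> bumpable m n (shift S w) i"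
    if S: "chain m n (shift S v)" "bumpable m n S i" and B: "\<And>j a. j \<le> n \<Longrightarrow> a < m \<Longrightarrow> 2 * \<bar>S j a\<bar> < M"
    for n S
  proof -
    have lt: "shift S w j (Suc a) < shift S w j' a"
      if "Suc a < m" "a \<noteq> i" "j \<le> n" "j' \<le> n" for j j' a
      using w[OF that(2)] B[of j "Suc a"] B[of j' a] that by (simp add: shift_def)
    have sl: "slack m n (shift S w) i" using lt by (simp add: slack_def)
    have bu: "bumpable m n (shift S w) i" using S(2) wi by (simp add: bumpable_def shift_def)
    have "chain m n (shift S w)" unfolding chain_def strip_def
    proof (intro conjI allI impI)
      fix a assume a: "Suc a < m"
      show "shift S w 0 (Suc a) \<le> shift S w 0 a"
        using bu lt[OF a, of 0 0] by (cases "a = i") (auto simp: bumpable_def)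
    next
      fix j a assume "j < n" "a < m"
      then show "shift S w j a \<le> shift S w (Suc j) a"
        using chain_step[OF S(1)] by (simp add: shift_def)
    next
      fix j a assume j: "j < n" and a: "Suc a < m"
      show "shift S w (Suc j) (Suc a) \<le> shift S w j a"
        using bu lt[OF a, of "Suc j" j] j by (cases "a = i") (auto simp: bumpable_def)
    qed
    then show ?thesis using sl bu by simp
  qed
  have "2 * \<bar>R j a\<bar> < M" if "j \<le> k" "a < m" for j a using N[OF that] by (simp add: M_def)
  note R = far[OF conjunct1[OF D_chain[OF v]] b(1) this]
  have "2 * \<bar>R' j a\<bar> < M" if "j \<le> k'" "a < m" for j a using N'[OF that] by (simp add: M_def)
  note R' = far[OF conjunct2[OF D_chain[OF v]] b(2) this]
  have "D (tab_of m k (shift R w)) (tab_of m k' (shift R' w))"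
    using aligned_D[of m k k' "shift R w" "shift R' w"] al R R' by (simp add: aligned_shift)
  then have "D (tab_of m k (bump (shift R w) i)) (tab_of m k' (bump (shift R' w) i))"
    using bump R R' by blast
  then show ?thesis unfolding aligned_def bump_shift[of w, OF wi] by blast
qed

text \<open>The hole is followed down to row \<open>a\<close> only; going one row further is a bump.\<close>

lemma slide_respected:
  assumes D: "D (tab_of m k R) (tab_of m k' R')"
    and p: "slide_path m k R r \<rho>" "slide_path m k' R' r \<rho>'"
  shows "D (tab_of m k (minus_box R \<rho>)) (tab_of m k' (minus_box R' \<rho>'))"
proof -
  let ?W = "\<lambda>R \<rho> a. minus_box R (\<lambda>j. min (\<rho> j) a)"
  have ch: "chain m k R" "chain m k' R'" using D_chain[OF D] by auto
  have ge: "r \<le> \<sigma> j" if "slide_path m n S r \<sigma>" "j \<le> n" for n S \<sigma> j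
    using that(2)
  proof (induction j)
    case 0
    then show ?case using that by (simp add: slide_path_def)
  next
    case (Suc j)
    then show ?case using that(1) by (auto simp: slide_path_def split: if_splits)
  qed
  \<comment> \<open>The added unit restores row \<open>a\<close> in the shapes where the hole has
    reached it; the bump then affects exactly those shapes whose hole lies below row
    \<open>a\<close>.\<close>
  have bump_step: "bumpable m n (shift (?W S \<sigma> a) (unit_row a)) a \<and>
      (\<forall>j\<le>n. \<forall>b<m. bump (shift (?W S \<sigma> a) (unit_row a)) a j b = shift (?W S \<sigma> (Suc a)) (unit_row a) j b)"
    if S: "chain m n S" "slide_path m n S r \<sigma>" and a: "r \<le> a" "Suc a < m" for n S \<sigma> a
  proof
    let ?V = "shift (?W S \<sigma> a) (unit_row a)"
    have V: "?V j (Suc a) = S j (Suc a)" "?V j a = S j a + of_bool (\<sigma> j < a)" for j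
      by (auto simp: shift_def minus_box_def)
    show "bumpable m n ?V a"
      unfolding bumpable_def V
    proof (intro conjI allI impI)
      show "S 0 (Suc a) < S 0 a + of_bool (\<sigma> 0 < a)"
        using S(2) a chain_shapes[OF S(1), of 0 a] by (cases "a = r") (auto simp: slide_path_def)
      fix j assume "j < n"
      then show "S (Suc j) (Suc a) \<le> S j a + of_bool (\<sigma> j < a)"
        using chain_diag[OF S(1) _ a(2), of j] by simp
    qed (rule a)
    have "bumped ?V a j \<longleftrightarrow> a < \<sigma> j" if "j \<le> n" for j
      using that
    proof (induction j)
      case 0
      then show ?case using S a by (simp add: slide_path_def)
    next
      case (Suc j)
      have "\<sigma> (Suc j) = (if Suc (\<sigma> j) < m \<and> S (Suc j) (Suc (\<sigma> j)) = S j (\<sigma> j) then Suc (\<sigma> j) else \<sigma> j)"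
        using S(2) Suc.prems by (simp add: slide_path_def)
      moreover have "S (Suc j) (Suc a) \<le> S j a" using chain_diag[OF S(1) _ a(2)] Suc.prems by simp
      ultimately show ?case using Suc a by (auto simp: V)
    qed
    then show "\<forall>j\<le>n. \<forall>b<m. bump ?V a j b = shift (?W S \<sigma> (Suc a)) (unit_row a) j b"
      by (auto simp: bump_def shift_def minus_box_def min_def)
  qed
  have "aligned m k k' (?W R \<rho> a) (?W R' \<rho>' a)" if "r \<le> a" "a < m" for a
    using that
  proof (induction a rule: dec_induct)
    case base
    \<comment> \<open>A hole held in row \<open>r\<close> removes one box of that row from every
      shape, which is a realignment.\<close>
    have "aligned m k k' (shift (?W R \<rho> r) (unit_row r)) (shift (?W R' \<rho>' r) (unit_row r)) \<longleftrightarrow>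
        aligned m k k' R R'"
      using ge[OF p(1)] ge[OF p(2)] by (intro aligned_cong) (auto simp: shift_def minus_box_def min_absorb2)
    then show ?case using D_aligned[OF D] by (simp add: aligned_shift)
  next
    case (step a)
    then have al: "aligned m k k' (shift (?W R \<rho> a) (unit_row a)) (shift (?W R' \<rho>' a) (unit_row a))"
      by (simp add: aligned_shift)
    have a: "r \<le> a" "Suc a < m" using step by auto
    note R = bump_step[OF ch(1) p(1) a] and R' = bump_step[OF ch(2) p(2) a]
    have "aligned m k k' (bump (shift (?W R \<rho> a) (unit_row a)) a)
        (bump (shift (?W R' \<rho>' a) (unit_row a)) a)"
      using aligned_bump[OF al] R R' by blast
    also have "?this \<longleftrightarrow> aligned m k k' (shift (?W R \<rho> (Suc a)) (unit_row a))
        (shift (?W R' \<rho>' (Suc a)) (unit_row a))"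
      using R R' by (intro aligned_cong) auto
    finally have "aligned m k k' (shift (?W R \<rho> (Suc a)) (unit_row a))
        (shift (?W R' \<rho>' (Suc a)) (unit_row a))" .
    then show ?case by (simp add: aligned_shift)
  qed
  from this[of "m - 1"] have "aligned m k k' (?W R \<rho> (m - 1)) (?W R' \<rho>' (m - 1))"
    using p by (auto simp: slide_path_def)
  moreover have "aligned m k k' (?W R \<rho> (m - 1)) (?W R' \<rho>' (m - 1)) \<longleftrightarrow>
      aligned m k k' (minus_box R \<rho>) (minus_box R' \<rho>')"
  proof (rule aligned_cong)
    fix j b assume "j \<le> k"
    then have "min (\<rho> j) (m - 1) = \<rho> j" using slide_path_corner[OF ch(1) p(1)] by force
    then show "?W R \<rho> (m - 1) j b = minus_box R \<rho> j b" by (simp add: minus_box_def)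
  next
    fix j b assume "j \<le> k'"
    then have "min (\<rho>' j) (m - 1) = \<rho>' j" using slide_path_corner[OF ch(2) p(2)] by force
    then show "?W R' \<rho>' (m - 1) j b = minus_box R' \<rho>' j b" by (simp add: minus_box_def)
  qed
  ultimately show ?thesis
    using aligned_D chain_minus_box[OF ch(1) p(1)] chain_minus_box[OF ch(2) p(2)] by blast
qed

end

context alignable
begin

text \<open>The added box is followed upwards to row \<open>a\<close> only. Held in row
  \<open>i\<close> it amounts to a realignment; letting it climb from row \<open>Suc a\<close> to
  row \<open>a\<close> is a bump.\<close>

lemma box_respected:
  assumes D: "D (tab_of m k R) (tab_of m k' R')"
    and p: "col_path m k R i \<iota>" "col_path m k' R' i \<iota>'"
  shows "D (tab_of m k (plus_box R \<iota>)) (tab_of m k' (plus_box R' \<iota>'))"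
proof -
  let ?W = "\<lambda>R \<iota> a. plus_box R (\<lambda>j. max (\<iota> j) a)"
  let ?V = "\<lambda>R \<iota> a. shift (?W R \<iota> a) (\<lambda>b. - unit_row a b)"
  have ch: "chain m k R" "chain m k' R'" using D_chain[OF D] by auto
  have bump_step: "bumpable m n (?V S \<sigma> (Suc a)) a \<and>
      (\<forall>j\<le>n. \<forall>b<m. bump (?V S \<sigma> (Suc a)) a j b = shift (?W S \<sigma> a) (\<lambda>b. - unit_row (Suc a) b) j b)"
    if S: "chain m n S" "col_path m n S i \<sigma>" and a: "a < i" for n S \<sigma> a
  proof
    have am: "Suc a < m" using S(2) a by (simp add: col_path_def)
    have V: "?V S \<sigma> (Suc a) j (Suc a) = S j (Suc a) - of_bool (Suc a < \<sigma> j)"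
      "?V S \<sigma> (Suc a) j a = S j a" for j
      by (auto simp: shift_def plus_box_def)
    show "bumpable m n (?V S \<sigma> (Suc a)) a"
      unfolding bumpable_def V
    proof (intro conjI allI impI)
      show "S 0 (Suc a) - of_bool (Suc a < \<sigma> 0) < S 0 a"
        using S(2) a chain_shapes[OF S(1) _ am, of 0] by (cases "Suc a = i") (auto simp: col_path_def)
      fix j assume "j < n"
      then show "S (Suc j) (Suc a) - of_bool (Suc a < \<sigma> (Suc j)) \<le> S j a"
        using chain_diag[OF S(1) _ am, of j] by simp
    qed (rule am)
    have "bumped (?V S \<sigma> (Suc a)) a j \<longleftrightarrow> \<sigma> j \<le> a" if "j \<le> n" for j
      using that
    proof (induction j)
      case 0
      then show ?case using S a by (simp add: col_path_def)
    next
      case (Suc j)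
      have s: "\<sigma> (Suc j) \<le> \<sigma> j"
        "\<And>a. \<sigma> (Suc j) < a \<Longrightarrow> a \<le> \<sigma> j \<Longrightarrow> S (Suc j) a = S j (a - 1)"
        "0 < \<sigma> (Suc j) \<Longrightarrow> S (Suc j) (\<sigma> (Suc j)) \<noteq> S j (\<sigma> (Suc j) - 1)"
        using S(2) Suc.prems by (auto simp: col_path_def)
      have diag: "S (Suc j) (Suc a) \<le> S j a" using chain_diag[OF S(1) _ am] Suc.prems by simp
      show ?case
      proof (cases "\<sigma> j \<le> a")
        case True
        then show ?thesis using Suc s(1) by simp
      next
        case False
        then have IH: "\<not> bumped (?V S \<sigma> (Suc a)) a j" using Suc by simp
        consider "\<sigma> (Suc j) \<le> a" | "\<sigma> (Suc j) = Suc a" | "Suc a < \<sigma> (Suc j)" by linarith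
        then show ?thesis
        proof cases
          case 1
          then show ?thesis using s(2)[of "Suc a"] False by (simp add: V)
        next
          case 2
          then show ?thesis using s(3) IH by (simp add: V)
        next
          case 3
          then show ?thesis using IH diag by (simp add: V)
        qed
      qed
    qed
    then show "\<forall>j\<le>n. \<forall>b<m. bump (?V S \<sigma> (Suc a)) a j b
        = shift (?W S \<sigma> a) (\<lambda>b. - unit_row (Suc a) b) j b"
      by (auto simp: bump_def shift_def plus_box_def max_def)
  qed
  have "aligned m k k' (?W R \<iota> a) (?W R' \<iota>' a)" if "a \<le> i" for a
    using that
  proof (induction a rule: inc_induct)
    case base
    have "aligned m k k' (?V R \<iota> i) (?V R' \<iota>' i) \<longleftrightarrow> aligned m k k' R R'"
      using col_path_le(1)[OF p(1)] col_path_le(1)[OF p(2)]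
      by (intro aligned_cong) (auto simp: shift_def plus_box_def max_def)
    then show ?case using D_aligned[OF D] by (simp add: aligned_shift)
  next
    case (step a)
    then have al: "aligned m k k' (?V R \<iota> (Suc a)) (?V R' \<iota>' (Suc a))"
      by (simp add: aligned_shift)
    note R = bump_step[OF ch(1) p(1) \<open>a < i\<close>] and R' = bump_step[OF ch(2) p(2) \<open>a < i\<close>]
    have "aligned m k k' (bump (?V R \<iota> (Suc a)) a) (bump (?V R' \<iota>' (Suc a)) a)"
      using aligned_bump[OF al] R R' by blast
    also have "?this \<longleftrightarrow> aligned m k k' (shift (?W R \<iota> a) (\<lambda>b. - unit_row (Suc a) b))
        (shift (?W R' \<iota>' a) (\<lambda>b. - unit_row (Suc a) b))"
      using R R' by (intro aligned_cong) auto
    finally show ?case by (simp add: aligned_shift)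
  qed
  from this[of 0] have "aligned m k k' (plus_box R \<iota>) (plus_box R' \<iota>')" by simp
  moreover have "chain m k (plus_box R \<iota>)" "chain m k' (plus_box R' \<iota>')"
    using cstep_chain strip_plus_box cstep_plus_box ch p by blast+
  ultimately show ?thesis using aligned_D by blast
qed

text \<open>A horizontal strip is inserted box by box, starting in its lowest row.\<close>

lemma cstep_respected:
  assumes "D (tab_of m k R) (tab_of m k' R')" "cstep m k R T" "cstep m k' R' T'"
    "strip m (R 0) (T 0)" "\<And>p. p < m \<Longrightarrow> T' 0 p = T 0 p"
  shows "D (tab_of m k T) (tab_of m k' T')"
  using assms
proof (induction "nat (\<Sum>p<m. T 0 p - R 0 p)" arbitrary: R R' rule: less_induct)
  case less
  note D = less.prems(1) and c = less.prems(2,3) and st = less.prems(4) and T0 = less.prems(5)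
  have ch: "chain m k R" "chain m k' R'" using D_chain[OF D] by auto
  have R0: "R' 0 p = R 0 p" if "p < m" for p
    using same_shape[OF D] that by (simp add: chain_shape_tab_of)
  have st': "strip m (R' 0) (T' 0)" using st R0 T0 by (simp add: strip_def Suc_lessD)
  have ge: "R 0 p \<le> T 0 p" if "p < m" for p using st that by (simp add: strip_def)
  show ?case
  proof (cases "\<exists>p<m. R 0 p < T 0 p")
    case False
    then have eq: "T 0 p = R 0 p" if "p < m" for p using ge[OF that] that by force
    have "cstep m k R R" "cstep m k' R' R'" using ch by (auto simp: cstep_def chain_def intro: crule_refl)
    then have "\<forall>j\<le>k. \<forall>p<m. T j p = R j p" "\<forall>j\<le>k'. \<forall>p<m. T' j p = R' j p"
      using cstep_unique[of m k R T R R] cstep_unique[of m k' R' T' R' R'] c eq R0 T0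
      by auto
    then have "tab_of m k T = tab_of m k R" "tab_of m k' T' = tab_of m k' R'"
      by (auto simp: tab_of_eq_iff)
    then show ?thesis using D by simp
  next
    case True
    define i where "i = Max {i. i < m \<and> R 0 i < T 0 i}"
    have fin: "finite {i. i < m \<and> R 0 i < T 0 i}" by simp
    have i: "i < m" "R 0 i < T 0 i" using Max_in[OF fin] True by (auto simp: i_def)
    have above: "T 0 a = R 0 a" if "i < a" "a < m" for a
      using Max_ge[OF fin, of a] ge[OF that(2)] that unfolding i_def[symmetric] by force
    have corner: "0 < i \<longrightarrow> R 0 i < R 0 (i - 1)"
    proof
      assume "0 < i"
      then have "T 0 i \<le> R 0 (i - 1)" using st i by (auto simp: strip_def dest: spec[of _ "i - 1"])
      then show "R 0 i < R 0 (i - 1)" using i by simp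
    qed
    then have corner': "0 < i \<longrightarrow> R' 0 i < R' 0 (i - 1)" using R0 i by auto
    obtain \<iota> where \<iota>: "col_path m k R i \<iota>" using col_path_exists[OF i(1), of R k] corner by auto
    obtain \<iota>' where \<iota>': "col_path m k' R' i \<iota>'" using col_path_exists[OF i(1), of R' k'] corner' by auto
    \<comment> \<open>What remains after one box is again an insertion: inserting the rest into the
      enlarged tableau composes to an insertion into \<open>S\<close> with the same left border, and
      that one is unique.\<close>
    have rest: "cstep m n (plus_box S \<sigma>) Y \<and> strip m (plus_box S \<sigma> 0) (Y 0)"
      if S: "chain m n S" "col_path m n S i \<sigma>" "cstep m n S Y" "strip m (S 0) (Y 0)" "S 0 i < Y 0 i"
        "\<And>a. i < a \<Longrightarrow> a < m \<Longrightarrow> Y 0 a = S 0 a" for n S \<sigma> Y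
    proof -
      obtain Z where Z: "Z 0 = Y 0" "cstep m n (plus_box S \<sigma>) Z" using cstep_exists by blast
      have "plus_box S \<sigma> 0 p \<le> Y 0 p" if "p < m" for p
        using S(2,4,5) that by (auto simp: strip_def plus_box_def col_path_def)
      moreover have "Y 0 (Suc p) \<le> plus_box S \<sigma> 0 p" if "Suc p < m" for p
        using S(4) that by (auto simp: strip_def plus_box_def intro: order_trans)
      ultimately have s: "strip m (plus_box S \<sigma> 0) (Y 0)" by (simp add: strip_def)
      have "cstep m n S Z"
        using cstep_compose[OF S(1,2) Z(2)] s Z(1) S(6) by simp
      then have "Z j p = Y j p" if "j \<le> n" "p < m" for j p
        using cstep_unique[OF _ S(3), of S Z] Z(1) that by simp
      then have "crule m (plus_box S \<sigma> j) (Z j) (plus_box S \<sigma> (Suc j)) (Z (Suc j)) =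
          crule m (plus_box S \<sigma> j) (Y j) (plus_box S \<sigma> (Suc j)) (Y (Suc j))" if "j < n" for j
        using that by (intro crule_cong) auto
      then have "cstep m n (plus_box S \<sigma>) Y" using Z(2) by (simp add: cstep_def)
      then show ?thesis using s by simp
    qed
    note Z = rest[OF ch(1) \<iota> c(1) st i(2) above]
    have "R' 0 i < T' 0 i" using R0 T0 i by simp
    note Z' = rest[OF ch(2) \<iota>' c(2) st' this]
    have "(\<Sum>p<m. T 0 p - plus_box R \<iota> 0 p) < (\<Sum>p<m. T 0 p - R 0 p)"
      using i \<iota> by (intro sum_strict_mono_ex1) (auto simp: plus_box_def col_path_def)
    moreover have "0 \<le> (\<Sum>p<m. T 0 p - plus_box R \<iota> 0 p)"
      using Z by (intro sum_nonneg) (auto simp: strip_def)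
    ultimately have "nat (\<Sum>p<m. T 0 p - plus_box R \<iota> 0 p) < nat (\<Sum>p<m. T 0 p - R 0 p)" by simp
    then show ?thesis
      using less.hyps[of "plus_box R \<iota>" "plus_box R' \<iota>'"] box_respected[OF D \<iota> \<iota>'] Z Z' T0 R0 above
      by simp
  qed
qed

lemma jdt_slide_respected:
  assumes "D P P'" "jdt_slide r s P T" "jdt_slide r s' P' T'"
  shows "D T T'"
proof -
  obtain m k R \<rho> where 1: "P = tab_of m k R" "chain m k R" "slide_path m k R r \<rho>"
    "T = tab_of m k (minus_box R \<rho>)" by (rule jdt_slideE[OF assms(2)])
  obtain m' k' R' \<rho>' where 2: "P' = tab_of m' k' R'" "chain m' k' R'" "slide_path m' k' R' r \<rho>'"
    "T' = tab_of m' k' (minus_box R' \<rho>')" by (rule jdt_slideE[OF assms(3)])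
  have "m' = m" using same_shape[OF assms(1)] 1(1) 2(1) by (simp add: chain_shape_tab_of)
  then show ?thesis using slide_respected assms(1) 1 2 by simp
qed

lemma cgrow_respected:
  assumes "D P P'" "cgrow P Q T U" "cgrow P' Q T' U'"
  shows "D T T'"
proof -
  from assms(2) obtain m l k X where X: "fgrow m l k X" "P = tab_of m k (X 0)"
     "Q = tab_of m l (\<lambda>i. X i 0)" "T = tab_of m k (X l)"
    unfolding cgrow_def by blast
  from assms(3) obtain m' l' k' X' where X': "fgrow m' l' k' X'" "P' = tab_of m' k' (X' 0)"
     "Q = tab_of m' l' (\<lambda>i. X' i 0)" "T' = tab_of m' k' (X' l')"
    unfolding cgrow_def by blast
  have l: "l' = l" using X(3) X'(3) length_tab_of by (metis Suc_inject)
  have m: "m' = m" using same_shape[OF assms(1)] X X' by (simp add: chain_shape_tab_of)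
  have "D (tab_of m k (X i)) (tab_of m k' (X' i))" if "i \<le> l" for i
    using that
  proof (induction i)
    case 0
    then show ?case using assms(1) X X' m by simp
  next
    case (Suc i)
    have "chain m l (\<lambda>i. X i 0)" using X(1) by (simp add: fgrow_def)
    then have "strip m (X i 0) (X (Suc i) 0)" using Suc.prems by (simp add: chain_def)
    moreover have "X' (Suc i) 0 p = X (Suc i) 0 p" if "p < m" for p
      using X(3) X'(3) l m Suc.prems that by (simp add: tab_of_eq_iff)
    moreover have "cstep m k (X i) (X (Suc i))" "cstep m k' (X' i) (X' (Suc i))"
      using X(1) X'(1) l m Suc.prems by (auto simp: fgrow_def)
    ultimately show ?case using Suc cstep_respected[of m k "X i" k' "X' i" "X (Suc i)" "X' (Suc i)"] by simp
  qed
  then show ?thesis using X X' l m by simp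
qed

end

section \<open>Slides and column insertion preserve the same relations\<close>

text \<open>Hopscotch moves with \<open>compl_tab\<close> stripped off: from the labels for
  tableaux, from the objects for stable tableaux.\<close>

fun col_move :: "position \<times> tab \<Rightarrow> tab \<Rightarrow> tab \<Rightarrow> bool" where
  "col_move (Stable_Inside, Q) P T \<longleftrightarrow> (\<exists>U. cgrow P Q T U)"
| "col_move (Stable_Outside, Q) P T \<longleftrightarrow> (\<exists>U. cgrow T U P Q)"

definition shape_respecting :: "(tab \<Rightarrow> tab \<Rightarrow> bool) \<Rightarrow> bool" where
  "shape_respecting D \<longleftrightarrow>
     (\<forall>P P'. D P P' \<longrightarrow> tableau P \<and> tableau P' \<and> chain_shape P = chain_shape P')"

definition preserved :: "('l \<Rightarrow> 'b \<Rightarrow> 'b \<Rightarrow> bool) \<Rightarrow> ('b \<Rightarrow> 'b \<Rightarrow> bool) \<Rightarrow> bool" where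
  "preserved mv D \<longleftrightarrow> (\<forall>a P P' T T'. D P P' \<and> mv a P T \<and> mv a P' T' \<longrightarrow> D T T')"

text \<open>Neither path leaves rows \<open>i\<close> and \<open>Suc i\<close>, so the bump alone
  decides both; here slides and insertions meet.\<close>

lemma slack_path:
  assumes "bumpable m k R i" "slack m k R i"
  shows "slide_path m k R i (\<lambda>j. if bumped R i j then Suc i else i)"
    "col_path m k R (Suc i) (\<lambda>j. if bumped R i j then i else Suc i)"
proof -
  have "R (Suc j) (Suc (Suc i)) \<noteq> R j (Suc i)" if "j < k" "Suc (Suc i) < m" for j
    using assms(2)[unfolded slack_def, rule_format, of "Suc i" j] that by simp
  then show "slide_path m k R i (\<lambda>j. if bumped R i j then Suc i else i)"
    using assms(1) by (auto simp: slide_path_def bumpable_def)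
  have "R (Suc j) i \<noteq> R j (i - 1)" if "j < k" "0 < i" for j
    using assms(2)[unfolded slack_def, rule_format, of "i - 1" j] assms(1) that
    by (cases i) (auto simp: bumpable_def)
  then show "col_path m k R (Suc i) (\<lambda>j. if bumped R i j then i else Suc i)"
    using assms(1) by (auto simp: col_path_def bumpable_def le_Suc_eq)
qed

text \<open>A slide into row \<open>i\<close> of the shifted tableau keeps its hole in that row and
  undoes the shift; the reverse slide, with the same label on both sides, restores it. A bump is a
  slide from row \<open>i\<close> with the lost unit added back.\<close>

lemma alignable_slide:
  assumes sr: "shape_respecting D" and pr: "preserved slide_move D"
  shows "alignable D"
proof
  have fwd: "D P P' \<Longrightarrow> jdt_slide r s P T \<Longrightarrow> jdt_slide r s' P' T' \<Longrightarrow> D T T'" for P P' T T' r s s'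
    using pr[unfolded preserved_def, rule_format, of P P' "Forward r" T T'] by auto
  have bwd: "D T T' \<Longrightarrow> jdt_slide r s P T \<Longrightarrow> jdt_slide r' s P' T' \<Longrightarrow> D P P'" for P P' T T' r r' s
    using pr[unfolded preserved_def, rule_format, of T T' "Reverse s" P P'] by auto
  have slide: "jdt_slide i i (tab_of m k (shift R (unit_row i))) (tab_of m k R)"
    if "i < m" "chain m k R" "chain m k (shift R (unit_row i))" for i m k R
  proof -
    have "R j' (Suc i) < R j i + 1" if "Suc i < m" "j' = j \<and> j \<le> k \<or> j' = Suc j \<and> j < k" for j j'
      using chain_shapes[OF \<open>chain m k R\<close> _ that(1), of j] chain_diag[OF \<open>chain m k R\<close> _ that(1), of j] that
      by auto
    then have "slide_path m k (shift R (unit_row i)) i (\<lambda>_. i)"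
      using that(1) by (fastforce simp: slide_path_def shift_def)
    moreover have "minus_box (shift R (unit_row i)) (\<lambda>_. i) = R"
      by (simp add: minus_box_def shift_def fun_eq_iff)
    ultimately show ?thesis using jdt_slide_path[OF that(3)] by fastforce
  qed
  show al: "D (tab_of m k (shift R (unit_row i))) (tab_of m k' (shift R' (unit_row i))) \<longleftrightarrow>
      D (tab_of m k R) (tab_of m k' R')"
    if "i < m" "chain m k R" "chain m k' R'" "chain m k (shift R (unit_row i))"
      "chain m k' (shift R' (unit_row i))" for i m k R k' R'
    using that slide fwd bwd by meson
  show "D P P' \<Longrightarrow> tableau P \<and> tableau P' \<and> chain_shape P = chain_shape P'" for P P'
    using sr by (auto simp: shape_respecting_def)
  show "D (tab_of m k (bump R i)) (tab_of m k' (bump R' i))"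
    if "chain m k R" "chain m k' R'" "bumpable m k R i" "bumpable m k' R' i" "slack m k R i"
      "slack m k' R' i" "D (tab_of m k R) (tab_of m k' R')" for m k R k' R' i
  proof -
    let ?\<rho> = "\<lambda>R j. if bumped R i j then Suc i else i"
    have "D (tab_of m k (minus_box R (?\<rho> R))) (tab_of m k' (minus_box R' (?\<rho> R')))"
      using fwd[OF that(7)] jdt_slide_path slack_path(1) that by blast
    moreover have "shift (minus_box S (?\<rho> S)) (unit_row i) = bump S i" for S
      by (auto simp: minus_box_def shift_def bump_def fun_eq_iff)
    moreover have "chain m k (minus_box R (?\<rho> R))" "chain m k' (minus_box R' (?\<rho> R'))"
      using chain_minus_box slack_path(1) that by blast+
    moreover have "i < m" using that(3) by (simp add: bumpable_def)
    ultimately show ?thesis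
      using al[of i m k "minus_box R (?\<rho> R)" k' "minus_box R' (?\<rho> R')"] chain_bump that by simp
  qed
qed

lemma cgrow_single:
  assumes "chain m k R" "strip m (R 0) (T 0)" "cstep m k R T"
  shows "cgrow (tab_of m k R) [map (R 0) [0..<m], map (T 0) [0..<m]]
    (tab_of m k T) [map (R k) [0..<m], map (T k) [0..<m]]"
proof -
  let ?X = "\<lambda>i::nat. if i = 0 then R else T"
  have "fgrow m 1 k ?X"
    using assms cstep_chain[OF assms] cstep_strip[OF assms] chain_shapes[OF assms(1)]
    by (auto simp: fgrow_def chain_def le_Suc_eq)
  then show ?thesis
    unfolding cgrow_def by (intro exI[of _ m] exI[of _ 1] exI[of _ k] exI[of _ ?X]) (simp add: tab_of_def)
qed

text \<open>Shifting row \<open>i\<close> inserts a box that never climbs. The way back is labelled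
  by the last column of the diagram, which coincides on both sides since the outer borders agree. A
  bump is the insertion of a box in row \<open>Suc i\<close> with a unit of that row taken away
  again.\<close>

lemma alignable_col:
  assumes sr: "shape_respecting D" and pr: "preserved col_move D"
  shows "alignable D"
proof
  show shape: "D P P' \<Longrightarrow> tableau P \<and> tableau P' \<and> chain_shape P = chain_shape P'" for P P'
    using sr by (auto simp: shape_respecting_def)
  have fwd: "D P P' \<Longrightarrow> cgrow P Q T U \<Longrightarrow> cgrow P' Q T' U' \<Longrightarrow> D T T'" for P P' Q T T' U U'
    using pr[unfolded preserved_def, rule_format, of P P' "(Stable_Inside, Q)" T T'] by auto
  have bwd: "D T T' \<Longrightarrow> cgrow P Q T U \<Longrightarrow> cgrow P' Q' T' U \<Longrightarrow> D P P'" for P P' Q Q' T T' U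
    using pr[unfolded preserved_def, rule_format, of T T' "(Stable_Outside, U)" P P'] by auto
  have box: "cstep m k R (shift R (unit_row i)) \<and> strip m (R 0) (shift R (unit_row i) 0)"
    if "i < m" "chain m k R" "chain m k (shift R (unit_row i))" for i m k R
  proof -
    have "R 0 i < R 0 (i - 1)" if "0 < i"
      using chain_shapes[OF \<open>chain m k (shift R _)\<close>, of 0 "i - 1"] that \<open>i < m\<close>
      by (cases i) (auto simp: shift_def)
    moreover have "R (Suc j) i \<noteq> R j (i - 1)" if "0 < i" "j < k" for j
      using chain_diag[OF \<open>chain m k (shift R _)\<close>, of j "i - 1"] that \<open>i < m\<close>
      by (cases i) (auto simp: shift_def)
    ultimately have "col_path m k R i (\<lambda>_. i)"
      using that(1) by (auto simp: col_path_def)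
    moreover have "plus_box R (\<lambda>_. i) = shift R (unit_row i)"
      by (simp add: plus_box_def shift_def fun_eq_iff)
    ultimately show ?thesis using cstep_plus_box strip_plus_box that(2) by metis
  qed
  show al: "D (tab_of m k (shift R (unit_row i))) (tab_of m k' (shift R' (unit_row i))) \<longleftrightarrow>
      D (tab_of m k R) (tab_of m k' R')"
    if c: "i < m" "chain m k R" "chain m k' R'" "chain m k (shift R (unit_row i))"
      "chain m k' (shift R' (unit_row i))" for i m k R k' R'
  proof -
    let ?S = "shift R (unit_row i)" and ?S' = "shift R' (unit_row i)"
    note g = cgrow_single[of m k R ?S] and g' = cgrow_single[of m k' R' ?S']
    note b = box[OF c(1,2,4)] box[OF c(1,3,5)]
    show ?thesis
    proof
      assume D: "D (tab_of m k ?S) (tab_of m k' ?S')"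
      have eq: "R 0 p = R' 0 p \<and> R k p = R' k' p \<and> ?S 0 p = ?S' 0 p \<and> ?S k p = ?S' k' p" if "p < m" for p
        using shape[OF D] that by (simp add: chain_shape_tab_of shift_def)
      then have "[map (R k) [0..<m], map (?S k) [0..<m]] = [map (R' k') [0..<m], map (?S' k') [0..<m]]"
        by simp
      then show "D (tab_of m k R) (tab_of m k' R')" using bwd[OF D] g g' b c by metis
    next
      assume D: "D (tab_of m k R) (tab_of m k' R')"
      have eq: "R 0 p = R' 0 p \<and> R k p = R' k' p \<and> ?S 0 p = ?S' 0 p \<and> ?S k p = ?S' k' p" if "p < m" for p
        using shape[OF D] that by (simp add: chain_shape_tab_of shift_def)
      then have "[map (R 0) [0..<m], map (?S 0) [0..<m]] = [map (R' 0) [0..<m], map (?S' 0) [0..<m]]"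
        by simp
      then show "D (tab_of m k ?S) (tab_of m k' ?S')" using fwd[OF D] g g' b c by metis
    qed
  qed
  show "D (tab_of m k (bump R i)) (tab_of m k' (bump R' i))"
    if c: "chain m k R" "chain m k' R'" "bumpable m k R i" "bumpable m k' R' i" "slack m k R i"
      "slack m k' R' i" "D (tab_of m k R) (tab_of m k' R')" for m k R k' R' i
  proof -
    let ?\<iota> = "\<lambda>R j. if bumped R i j then i else Suc i"
    let ?T = "plus_box R (?\<iota> R)" and ?T' = "plus_box R' (?\<iota> R')"
    have T: "strip m (R 0) (?T 0)" "cstep m k R ?T" "strip m (R' 0) (?T' 0)" "cstep m k' R' ?T'"
      using strip_plus_box cstep_plus_box slack_path(2) c by blast+
    have "R 0 p = R' 0 p \<and> ?T 0 p = ?T' 0 p" if "p < m" for p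
      using shape[OF c(7)] that by (simp add: chain_shape_tab_of plus_box_def)
    then have "[map (R 0) [0..<m], map (?T 0) [0..<m]] = [map (R' 0) [0..<m], map (?T' 0) [0..<m]]"
      by simp
    then have "D (tab_of m k ?T) (tab_of m k' ?T')"
      using fwd[OF c(7)] cgrow_single[OF c(1) T(1,2)] cgrow_single[OF c(2) T(3,4)] by metis
    moreover have "plus_box S (?\<iota> S) = shift (bump S i) (unit_row (Suc i))" for S
      by (auto simp: plus_box_def shift_def bump_def fun_eq_iff)
    moreover have "chain m k ?T" "chain m k' ?T'"
      using cstep_chain c(1,2) T by blast+
    moreover have "Suc i < m" using c(3) by (simp add: bumpable_def)
    ultimately show ?thesis
      using al[of "Suc i" m k "bump R i" k' "bump R' i"] chain_bump c by simp
  qed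
qed

text \<open>\<open>alignable\<close> handles moves that start at the inner border; the others are
  such moves for this relation.\<close>

definition rot_rel :: "(tab \<Rightarrow> tab \<Rightarrow> bool) \<Rightarrow> tab \<Rightarrow> tab \<Rightarrow> bool" where
  "rot_rel D P P' \<longleftrightarrow> D (rot P) (rot P')"

lemma shape_respecting_rot:
  assumes "shape_respecting D"
  shows "shape_respecting (rot_rel D)"
  unfolding shape_respecting_def rot_rel_def
proof (intro allI impI)
  fix P P' assume "D (rot P) (rot P')"
  then have *: "tableau (rot P) \<and> tableau (rot P') \<and> chain_shape (rot P) = chain_shape (rot P')"
    using assms by (simp add: shape_respecting_def)
  then have "chain_shape (rot (rot P)) = chain_shape (rot (rot P'))"
    using chain_shape_rot[of "rot P"] chain_shape_rot[of "rot P'"] unfolding tableau_def by metis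
  then show "tableau P \<and> tableau P' \<and> chain_shape P = chain_shape P'" using * by (simp add: tableau_rot)
qed

text \<open>Rotation mirrors the row in a label. A common label stays common because related
  tableaux have equally many rows.\<close>

lemma preserved_slide_rot:
  assumes sr: "shape_respecting D" and pr: "preserved slide_move D"
  shows "preserved slide_move (rot_rel D)"
  unfolding preserved_def
proof (intro allI impI, elim conjE)
  fix a P P' T T' assume D: "rot_rel D P P'" and mv: "slide_move a P T" "slide_move a P' T'"
  have "chain_shape P = chain_shape P'"
    using shape_respecting_rot[OF sr] D by (simp add: shape_respecting_def)
  then have m: "length (inner P') = length (inner P)" by (simp add: chain_shape_def)
  let ?m = "length (inner P) - 1"
  have ex: "\<exists>b. slide_move b (rot P) (rot T) \<and> slide_move b (rot P') (rot T')"
  proof (cases a)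
    case (Forward r)
    then show ?thesis using mv m jdt_slide_rot
      by (intro exI[of _ "Reverse (?m - r)"]) (fastforce)
  next
    case (Reverse s)
    with mv obtain r r' where j: "jdt_slide r s T P" "jdt_slide r' s T' P'" by auto
    then have "length (inner T) = length (inner P)" "length (inner T') = length (inner P')"
      by (auto simp: jdt_slide_def)
    then show ?thesis using jdt_slide_rot[OF j(1)] jdt_slide_rot[OF j(2)] m
      by (intro exI[of _ "Forward (?m - s)"]) auto
  qed
  then show "rot_rel D T T'" using pr D unfolding preserved_def rot_rel_def by blast
qed

lemma preserved_col_rot:
  assumes "preserved col_move D"
  shows "preserved col_move (rot_rel D)"
  unfolding preserved_def
proof (intro allI impI, elim conjE)
  fix a P P' T T' assume D: "rot_rel D P P'" and mv: "col_move a P T" "col_move a P' T'"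
  obtain p Q where a: "a = (p, Q)" by force
  have "\<exists>b. col_move b (rot P) (rot T) \<and> col_move b (rot P') (rot T')"
  proof (cases p)
    case Stable_Outside
    then show ?thesis using mv a cgrow_rot
      by (intro exI[of _ "(Stable_Inside, rot Q)"]) (auto, blast+)
  next
    case Stable_Inside
    then show ?thesis using mv a cgrow_rot
      by (intro exI[of _ "(Stable_Outside, rot Q)"]) (auto, blast+)
  qed
  then show "rot_rel D T T'" using assms D unfolding preserved_def rot_rel_def by blast
qed

lemma preserved_slide_iff_col:
  assumes sr: "shape_respecting D"
  shows "preserved slide_move D \<longleftrightarrow> preserved col_move D"
proof
  assume pr: "preserved slide_move D"
  interpret A: alignable D using sr pr by (rule alignable_slide)
  interpret B: alignable "rot_rel D"
    using shape_respecting_rot[OF sr] preserved_slide_rot[OF sr pr] by (rule alignable_slide)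
  show "preserved col_move D" unfolding preserved_def
  proof (intro allI impI, elim conjE)
    fix a P P' T T' assume D: "D P P'" and mv: "col_move a P T" "col_move a P' T'"
    obtain p Q where a: "a = (p, Q)" by force
    show "D T T'"
    proof (cases p)
      case Stable_Inside
      then show ?thesis using mv a A.cgrow_respected[OF D] by auto
    next
      case Stable_Outside
      then obtain U U' where g: "cgrow T U P Q" "cgrow T' U' P' Q" using mv a by auto
      have "rot_rel D (rot P) (rot P')" using D by (simp add: rot_rel_def)
      from B.cgrow_respected[OF this cgrow_rot[OF g(1)] cgrow_rot[OF g(2)]]
      have "rot_rel D (rot T) (rot T')" .
      then show ?thesis by (simp add: rot_rel_def)
    qed
  qed
next
  assume pr: "preserved col_move D"
  interpret A: alignable D using sr pr by (rule alignable_col)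
  interpret B: alignable "rot_rel D"
    using shape_respecting_rot[OF sr] preserved_col_rot[OF pr] by (rule alignable_col)
  show "preserved slide_move D" unfolding preserved_def
  proof (intro allI impI, elim conjE)
    fix a P P' T T' assume D: "D P P'" and mv: "slide_move a P T" "slide_move a P' T'"
    show "D T T'"
    proof (cases a)
      case (Forward r)
      then show ?thesis using mv A.jdt_slide_respected[OF D] by auto
    next
      case (Reverse s)
      then obtain r r' where j: "jdt_slide r s T P" "jdt_slide r' s T' P'" using mv by auto
      have "inner P = inner P'" using A.same_shape[OF D] by (simp add: chain_shape_def)
      then have "length (inner T) = length (inner T')" using j by (auto simp: jdt_slide_def) (metis length_list_update)
      then have j': "jdt_slide (length (inner T) - 1 - s) (length (inner T) - 1 - r') (rot P') (rot T')"
        using jdt_slide_rot[OF j(2)] by simp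
      have "rot_rel D (rot P) (rot P')" using D by (simp add: rot_rel_def)
      from B.jdt_slide_respected[OF this jdt_slide_rot[OF j(1)] j'] have "rot_rel D (rot T) (rot T')" .
      then show ?thesis by (simp add: rot_rel_def)
    qed
  qed
qed

section \<open>Stable complements\<close>

lemma prefix_inf_prefix_inf: "prefix_inf i (prefix_inf j \<sigma>) = prefix_inf (i + j) \<sigma>"
  by (auto simp: prefix_inf_def fun_eq_iff)

lemma prefix_inf_0 [simp]: "prefix_inf 0 \<sigma> = \<sigma>"
  by (simp add: prefix_inf_def)

lemma prefix_of_shape:
  "prefix_inf i (of_shape \<gamma>) q =
     (if q < i then Pinf else if q < i + length \<gamma> then Fin (\<gamma> ! (q - i)) else Minf)"
  by (auto simp: prefix_inf_def of_shape_def)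

lemma prefix_of_shape_inject:
  "prefix_inf i (of_shape \<gamma>) = prefix_inf j (of_shape \<delta>) \<longleftrightarrow> i = j \<and> \<gamma> = \<delta>"
proof
  assume eq: "prefix_inf i (of_shape \<gamma>) = prefix_inf j (of_shape \<delta>)"
  have q: "prefix_inf i (of_shape \<gamma>) q = prefix_inf j (of_shape \<delta>) q" for q using eq by simp
  have ij: "i = j"
    using q[of i] q[of j] by (cases i j rule: linorder_cases) (auto simp: prefix_of_shape split: if_splits)
  have len: "length \<gamma> = length \<delta>"
    using q[of "i + length \<gamma>"] q[of "i + length \<delta>"] ij by (auto simp: prefix_of_shape split: if_splits)
  have "\<gamma> ! p = \<delta> ! p" if "p < length \<gamma>" for p
    using q[of "i + p"] ij len that by (simp add: prefix_of_shape)
  then show "i = j \<and> \<gamma> = \<delta>" using ij len by (simp add: list_eq_iff_nth_eq)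
qed simp

lemma finite_parts_prefix [simp]: "finite_parts (prefix_inf i (of_shape \<gamma>)) = \<gamma>"
  unfolding finite_parts_def by (rule the_equality) (auto simp: prefix_of_shape_inject)

lemma is_shape_nth: "is_shape \<gamma> \<Longrightarrow> i \<le> j \<Longrightarrow> j < length \<gamma> \<Longrightarrow> \<gamma> ! j \<le> \<gamma> ! i"
  unfolding is_shape_def by (cases "i = j") (auto simp: sorted_wrt_iff_nth_less)

lemma stable_shape_prefix:
  assumes "is_shape \<gamma>"
  shows "stable_shape (prefix_inf i (of_shape \<gamma>))"
  unfolding stable_shape_def
proof
  show "antimono (prefix_inf i (of_shape \<gamma>))"
    using is_shape_nth[OF assms] by (auto simp: monotone_def prefix_of_shape)
  show "\<exists>n. \<forall>q\<ge>n. prefix_inf i (of_shape \<gamma>) q = Minf"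
    by (intro exI[of _ "i + length \<gamma>"]) (auto simp: prefix_of_shape)
qed

lemma stable_shapeE:
  assumes "stable_shape \<sigma>"
  obtains i \<gamma> where "is_shape \<gamma>" "\<sigma> = prefix_inf i (of_shape \<gamma>)"
proof -
  from assms obtain n where n: "\<sigma> n = Minf" and "antimono \<sigma>" by (auto simp: stable_shape_def)
  then have anti: "\<sigma> q \<le> \<sigma> p" if "p \<le> q" for p q using that by (simp add: antimono_def)
  define i where "i = (LEAST q. \<sigma> q \<noteq> Pinf)"
  define e where "e = (LEAST q. \<sigma> q = Minf)"
  define g where "g q = (case \<sigma> q of Fin x \<Rightarrow> x | _ \<Rightarrow> 0)" for q
  have i: "\<sigma> i \<noteq> Pinf" unfolding i_def by (rule LeastI[of _ n]) (simp add: n)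
  have e: "\<sigma> e = Minf" unfolding e_def by (rule LeastI[of "\<lambda>q. \<sigma> q = Minf", OF n])
  have lo: "\<sigma> q = Pinf" if "q < i" for q using not_less_Least[of q "\<lambda>q. \<sigma> q \<noteq> Pinf"] that by (simp add: i_def)
  have hi: "\<sigma> q = Minf" if "e \<le> q" for q using anti[OF that] e by simp
  have ie: "i \<le> e" unfolding i_def by (rule Least_le) (simp add: e)
  have mid: "\<sigma> q = Fin (g q)" if "i \<le> q" "q < e" for q
  proof -
    have "\<sigma> q \<noteq> Minf" using not_less_Least[of q "\<lambda>q. \<sigma> q = Minf"] that by (simp add: e_def)
    moreover have "\<sigma> q \<noteq> Pinf" using anti[OF that(1)] i by auto
    ultimately show ?thesis by (simp add: g_def split: extended.split)
  qed
  let ?\<gamma> = "map (\<lambda>q. g (i + q)) [0..<e - i]"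
  have "g (i + Suc q) \<le> g (i + q)" if "Suc q < e - i" for q
    using anti[of "i + q" "i + Suc q"] mid[of "i + q"] mid[of "i + Suc q"] that by simp
  then have "is_shape ?\<gamma>" by (simp add: is_shape_map)
  moreover have "\<sigma> = prefix_inf i (of_shape ?\<gamma>)"
    using lo mid hi ie by (auto simp: prefix_of_shape fun_eq_iff)
  ultimately show ?thesis using that by blast
qed

text \<open>The finite parts start one row lower in \<open>\<beta>\<close>. Hence comparing row
  \<open>q\<close> of the inner shape with row \<open>Suc q\<close> of \<open>\<beta>\<close>
  compares parts in equal position, and componentwise inclusion is the diagonal comparison: an
  ordinary strip with the roles of its two shapes exchanged.\<close>

lemma stable_hstrip_iff:
  assumes "is_shape \<gamma>"
  shows "stable_hstrip (prefix_inf i (of_shape \<gamma>)) \<beta> \<longleftrightarrow>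
    (\<exists>\<delta>. \<beta> = prefix_inf (Suc i) (of_shape \<delta>) \<and> hstrip \<delta> \<gamma>)"
proof
  let ?\<alpha> = "prefix_inf i (of_shape \<gamma>)"
  assume s: "stable_hstrip ?\<alpha> \<beta>"
  then obtain i' \<delta> where \<delta>: "is_shape \<delta>" "\<beta> = prefix_inf i' (of_shape \<delta>)"
    by (auto simp: stable_hstrip_def elim: stable_shapeE)
  from s obtain m n where mn: "m \<le> n" "\<And>q. q < m \<Longrightarrow> ?\<alpha> q = Pinf" "\<beta> m = Pinf"
    "\<And>q. m \<le> q \<Longrightarrow> q < n \<Longrightarrow> Pinf > ?\<alpha> q \<and> ?\<alpha> q \<ge> \<beta> (Suc q) \<and> \<beta> (Suc q) > Minf"
    "?\<alpha> n = Minf" "\<beta> (Suc n) = Minf" and le: "?\<alpha> \<le> \<beta>"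
    unfolding stable_hstrip_def by (metis atLeastLessThan_iff)
  have \<alpha>m: "?\<alpha> m \<noteq> Pinf" using mn(4)[of m] mn(5) mn(1) by (cases "m = n") auto
  have \<alpha>fin: "?\<alpha> q \<noteq> Minf" if "q < n" for q
    using mn(2)[of q] mn(4)[of q] that by (cases "q < m") auto
  have \<beta>m: "\<beta> (Suc m) \<noteq> Pinf"
    using mn(4)[of m] mn(6) mn(1) by (cases "m = n") (auto dest: le_less_trans)
  have \<beta>fin: "\<beta> (Suc q) \<noteq> Minf" if "m \<le> q" "q < n" for q using mn(4)[OF that] by auto
  \<comment> \<open>The infinite parts force \<open>m\<close> and \<open>n\<close> to be the ends of
    the block of finite parts.\<close>
  have i: "i = m"
    using mn(2)[of i] \<alpha>m by (cases i m rule: linorder_cases) (auto simp: prefix_of_shape split: if_splits)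
  have n: "n = i + length \<gamma>"
    using mn(5) \<alpha>fin[of "i + length \<gamma>"] mn(1) i
    by (cases n "i + length \<gamma>" rule: linorder_cases) (auto simp: prefix_of_shape split: if_splits)
  have i': "i' = Suc m"
    using mn(3) \<beta>m unfolding \<delta>(2) by (auto simp: prefix_of_shape split: if_splits)
  have len: "length \<delta> = length \<gamma>"
  proof (rule antisym)
    show "length \<delta> \<le> length \<gamma>"
      using mn(6) unfolding \<delta>(2) by (auto simp: prefix_of_shape i' i n split: if_splits)
    show "length \<gamma> \<le> length \<delta>"
    proof (rule ccontr)
      assume "\<not> length \<gamma> \<le> length \<delta>"
      then show False using \<beta>fin[of "m + length \<delta>"] unfolding \<delta>(2)
        by (simp add: prefix_of_shape i' i n)
    qed
  qed
  have "\<delta> ! q \<le> \<gamma> ! q" if "q < length \<gamma>" for q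
    using mn(4)[of "m + q"] that len unfolding \<delta>(2) by (simp add: prefix_of_shape i' i n)
  moreover have "\<gamma> ! Suc q \<le> \<delta> ! q" if "Suc q < length \<gamma>" for q
    using le_funD[OF le, of "Suc (i + q)"] that len unfolding \<delta>(2) by (simp add: prefix_of_shape i' i)
  ultimately have "hstrip \<delta> \<gamma>" using assms \<delta>(1) len by (simp add: hstrip_def)
  then show "\<exists>\<delta>. \<beta> = prefix_inf (Suc i) (of_shape \<delta>) \<and> hstrip \<delta> \<gamma>" using \<delta>(2) i i' by auto
next
  assume "\<exists>\<delta>. \<beta> = prefix_inf (Suc i) (of_shape \<delta>) \<and> hstrip \<delta> \<gamma>"
  then obtain \<delta> where \<beta>: "\<beta> = prefix_inf (Suc i) (of_shape \<delta>)" and h: "hstrip \<delta> \<gamma>" by blast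
  have len: "length \<delta> = length \<gamma>" using h by (simp add: hstrip_def)
  have up: "\<gamma> ! (q - i) \<le> \<delta> ! (q - Suc i)" if "Suc i \<le> q" "q < i + length \<gamma>" for q
  proof -
    from that have "q - i = Suc (q - Suc i)" "Suc (q - Suc i) < length \<gamma>" by auto
    then show ?thesis using h by (simp add: hstrip_def)
  qed
  show "stable_hstrip (prefix_inf i (of_shape \<gamma>)) \<beta>"
    unfolding stable_hstrip_def
  proof (intro conjI)
    show "prefix_inf i (of_shape \<gamma>) \<le> \<beta>"
      unfolding \<beta> using up len by (auto simp: le_fun_def prefix_of_shape not_less less_Suc_eq_le)
    show "\<exists>m n. m \<le> n \<and> (\<forall>q<m. prefix_inf i (of_shape \<gamma>) q = Pinf) \<and> \<beta> m = Pinf \<and>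
        (\<forall>q\<in>{m..<n}. Pinf > prefix_inf i (of_shape \<gamma>) q \<and>
          prefix_inf i (of_shape \<gamma>) q \<ge> \<beta> (Suc q) \<and> \<beta> (Suc q) > Minf) \<and>
        prefix_inf i (of_shape \<gamma>) n = Minf \<and> \<beta> (Suc n) = Minf"
      by (rule exI[of _ i], rule exI[of _ "i + length \<gamma>"])
        (use h len in \<open>auto simp: \<beta> prefix_of_shape hstrip_def\<close>)
  qed (use h in \<open>auto simp: \<beta> hstrip_def intro!: stable_shape_prefix\<close>)
qed

lemma length_compl_tab [simp]: "length (compl_tab T) = length T"
  by (simp add: compl_tab_def stable_compl_def)

lemma compl_tab_nth:
  "i < length T \<Longrightarrow> compl_tab T ! i = prefix_inf i (of_shape (T ! (length T - 1 - i)))"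
  by (simp add: compl_tab_def stable_compl_def)

text \<open>Complementing twice puts \<open>length T - 1\<close> parts \<open>Pinf\<close> before
  every shape, a vertical shift that \<open>finite_parts\<close> discards.\<close>

lemma compl_stab_compl_tab [simp]: "compl_stab (compl_tab T) = T"
proof (rule nth_equalityI)
  fix i assume "i < length (compl_stab (compl_tab T))"
  then have i: "i < length T" by (simp add: compl_stab_def stable_compl_def)
  then show "compl_stab (compl_tab T) ! i = T ! i"
    by (simp add: compl_stab_def stable_compl_def compl_tab_nth prefix_inf_prefix_inf)
qed (simp add: compl_stab_def stable_compl_def)

lemma compl_tab_inject: "compl_tab T = compl_tab U \<longleftrightarrow> T = U"
  using compl_stab_compl_tab by metis

lemma inner_compl_tab: "T \<noteq> [] \<Longrightarrow> inner (compl_tab T) = of_shape (outer T)"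
  using compl_tab_nth[of 0 T] hd_conv_nth[of "compl_tab T"] length_compl_tab[of T]
  by (cases "compl_tab T = []") (auto simp: inner_def outer_def last_conv_nth)

lemma outer_compl_tab:
  "T \<noteq> [] \<Longrightarrow> outer (compl_tab T) = prefix_inf (length T - 1) (of_shape (inner T))"
  using compl_tab_nth[of "length T - 1" T] last_conv_nth[of "compl_tab T"] length_compl_tab[of T]
  by (cases "compl_tab T = []") (auto simp: inner_def outer_def hd_conv_nth)

text \<open>The outer border of \<open>compl_tab T\<close> begins with \<open>length T - 1\<close>
  parts \<open>Pinf\<close>, information that \<open>chain_shape T\<close> lacks; the lengths are
  therefore assumed equal.\<close>

lemma chain_shape_compl_tab:
  assumes "T \<noteq> []" "U \<noteq> []" "length T = length U"
  shows "chain_shape (compl_tab T) = chain_shape (compl_tab U) \<longleftrightarrow> chain_shape T = chain_shape U"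
  using assms prefix_of_shape_inject[of 0 _ 0]
  by (auto simp: chain_shape_def inner_compl_tab outer_compl_tab prefix_of_shape_inject)

lemma stable_tableau_rep_compl_tab:
  assumes "tableau T"
  shows "stable_tableau_rep (compl_tab T)"
proof -
  have ne: "T \<noteq> []" and sh: "\<And>i. i < length T \<Longrightarrow> is_shape (T ! i)"
    and st: "\<And>i. Suc i < length T \<Longrightarrow> hstrip (T ! i) (T ! Suc i)"
    using assms by (auto simp: tableau_def)
  have "stable_shape \<sigma>" if "\<sigma> \<in> set (compl_tab T)" for \<sigma>
    using that sh by (auto simp: in_set_conv_nth compl_tab_nth intro!: stable_shape_prefix)
  moreover have "stable_hstrip (compl_tab T ! i) (compl_tab T ! Suc i)" if "Suc i < length T" for i
  proof -
    have "hstrip (T ! (length T - 1 - Suc i)) (T ! (length T - 1 - i))"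
      using st[of "length T - 1 - Suc i"] that by (simp add: Suc_diff_Suc)
    then show ?thesis using that sh[of "length T - 1 - i"]
      by (auto simp: compl_tab_nth stable_hstrip_iff)
  qed
  moreover have "compl_tab T \<noteq> []" using ne length_compl_tab[of T] by (metis length_0_conv)
  moreover have "inner (compl_tab T) 0 \<noteq> Pinf" using ne by (simp add: inner_compl_tab of_shape_def)
  ultimately show ?thesis by (simp add: stable_tableau_rep_def stable_tableau_def)
qed

text \<open>Each stable strip pushes the finite parts down by one row, and a representative starts
  in row 0, so shape \<open>j\<close> has exactly \<open>j\<close> parts \<open>Pinf\<close>, as in
  a complement.\<close>

lemma stable_tableau_repE:
  assumes "stable_tableau_rep Q"
  obtains T where "tableau T" "Q = compl_tab T"
proof -
  have ne: "Q \<noteq> []" and sh: "\<And>j. j < length Q \<Longrightarrow> stable_shape (Q ! j)"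
    and st: "\<And>j. Suc j < length Q \<Longrightarrow> stable_hstrip (Q ! j) (Q ! Suc j)" and top: "(Q ! 0) 0 \<noteq> Pinf"
    using assms by (auto simp: stable_tableau_rep_def stable_tableau_def inner_def hd_conv_nth)
  let ?f = "\<lambda>j. finite_parts (Q ! j)"
  have nth: "is_shape (?f j) \<and> Q ! j = prefix_inf j (of_shape (?f j))" if "j < length Q" for j
    using that
  proof (induction j)
    case 0
    then obtain i \<gamma> where \<gamma>: "is_shape \<gamma>" "Q ! 0 = prefix_inf i (of_shape \<gamma>)"
      using sh stable_shapeE by metis
    then have "i = 0" using top by (simp add: prefix_of_shape split: if_splits)
    then show ?case using \<gamma> finite_parts_prefix[of 0 \<gamma>] by simp
  next
    case (Suc j)
    then have "is_shape (?f j)" "stable_hstrip (prefix_inf j (of_shape (?f j))) (Q ! Suc j)"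
      using st[of j] by auto
    then show ?case by (auto simp: stable_hstrip_iff hstrip_def)
  qed
  have strip: "hstrip (?f (Suc j)) (?f j)" if j: "Suc j < length Q" for j
  proof -
    have "is_shape (?f j)" "stable_hstrip (prefix_inf j (of_shape (?f j))) (Q ! Suc j)"
      using st[OF j] nth[of j] j by auto
    then obtain \<delta> where "Q ! Suc j = prefix_inf (Suc j) (of_shape \<delta>)" "hstrip \<delta> (?f j)"
      by (auto simp: stable_hstrip_iff)
    then show ?thesis by simp
  qed
  let ?T = "rev (map finite_parts Q)"
  have "hstrip (?T ! i) (?T ! Suc i)" if "Suc i < length Q" for i
    using strip[of "length Q - Suc (Suc i)"] that by (simp add: rev_nth Suc_diff_Suc)
  moreover have "is_shape \<beta>" if "\<beta> \<in> set ?T" for \<beta>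
    using that nth by (auto simp: in_set_conv_nth)
  ultimately have "tableau ?T" using ne by (simp add: tableau_def)
  moreover have "Q = compl_tab ?T"
    using nth by (intro nth_equalityI) (auto simp: compl_tab_nth rev_nth)
  ultimately show ?thesis using that by blast
qed

section \<open>Hopscotch\<close>

text \<open>One growth diagram read from its inner and from its outer borders: the two readings are
  inverse to each other.\<close>

lemma hopscotch_cgrow:
  assumes "cgrow P U T V"
  shows "(P, compl_tab U) \<in> hop_pairs Stable_Inside" "(T, compl_tab V) \<in> hop_pairs Stable_Outside"
    "hopscotch Stable_Inside (P, compl_tab U) = (T, compl_tab V)"
    "hopscotch Stable_Outside (T, compl_tab V) = (P, compl_tab U)"
proof -
  note t = cgrow_tableaux[OF assms]
  have "U \<noteq> []" "V \<noteq> []" using t by (auto simp: tableau_def)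
  then show "(P, compl_tab U) \<in> hop_pairs Stable_Inside" "(T, compl_tab V) \<in> hop_pairs Stable_Outside"
    using t finite_parts_prefix[of 0 "outer V"] stable_tableau_rep_compl_tab
    by (auto simp: tab_extends_def stab_extends_def inner_compl_tab outer_compl_tab)
  show "hopscotch Stable_Inside (P, compl_tab U) = (T, compl_tab V)"
    "hopscotch Stable_Outside (T, compl_tab V) = (P, compl_tab U)"
    using col_insert_inner_eq[OF assms] col_insert_outer_eq[OF assms] by simp_all
qed

lemma hop_pairs_InsideE:
  assumes "(P, Q) \<in> hop_pairs Stable_Inside"
  obtains U T V where "Q = compl_tab U" "cgrow P U T V"
proof -
  from assms obtain U where U: "tableau U" "Q = compl_tab U" by (auto elim: stable_tableau_repE)
  have "U \<noteq> []" using U by (simp add: tableau_def)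
  then have "inner P = inner U" "tableau P" using assms U by (auto simp: tab_extends_def outer_compl_tab)
  then show ?thesis using that cgrow_exists U by metis
qed

lemma hop_pairs_OutsideE:
  assumes "(T, Q) \<in> hop_pairs Stable_Outside"
  obtains V P U where "Q = compl_tab V" "cgrow P U T V"
proof -
  from assms obtain V where V: "tableau V" "Q = compl_tab V" by (auto elim: stable_tableau_repE)
  have "V \<noteq> []" using V by (simp add: tableau_def)
  then have "outer T = outer V" "tableau T"
    using assms V finite_parts_prefix[of 0 "outer V"] by (auto simp: stab_extends_def inner_compl_tab)
  then show ?thesis using that cgrow_exists_outer V by metis
qed

lemma hop_move_tab_iff:
  "hop_move_tab (p, Q) P T \<longleftrightarrow> (\<exists>U. Q = compl_tab U \<and> col_move (p, U) P T)"
proof (cases p)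
  case Stable_Inside
  show ?thesis
  proof
    assume "hop_move_tab (p, Q) P T"
    then have *: "(P, Q) \<in> hop_pairs Stable_Inside" "T = fst (hopscotch Stable_Inside (P, Q))"
      using Stable_Inside by auto
    from *(1) obtain U T' V where "Q = compl_tab U" "cgrow P U T' V" by (rule hop_pairs_InsideE)
    then show "\<exists>U. Q = compl_tab U \<and> col_move (p, U) P T"
      using *(2) hopscotch_cgrow(3) Stable_Inside by auto
  next
    assume "\<exists>U. Q = compl_tab U \<and> col_move (p, U) P T"
    then obtain U V where "Q = compl_tab U" "cgrow P U T V" using Stable_Inside by auto
    then show "hop_move_tab (p, Q) P T"
      using hopscotch_cgrow(1,3) Stable_Inside by auto
  qed
next
  case Stable_Outside
  show ?thesis
  proof
    assume "hop_move_tab (p, Q) P T"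
    then have *: "(P, Q) \<in> hop_pairs Stable_Outside" "T = fst (hopscotch Stable_Outside (P, Q))"
      using Stable_Outside by auto
    from *(1) obtain U T' V where "Q = compl_tab U" "cgrow T' V P U" by (rule hop_pairs_OutsideE)
    then show "\<exists>U. Q = compl_tab U \<and> col_move (p, U) P T"
      using *(2) hopscotch_cgrow(4) Stable_Outside by auto
  next
    assume "\<exists>U. Q = compl_tab U \<and> col_move (p, U) P T"
    then obtain U V where "Q = compl_tab U" "cgrow T V P U" using Stable_Outside by auto
    then show "hop_move_tab (p, Q) P T"
      using hopscotch_cgrow(2,4) Stable_Outside by auto
  qed
qed

text \<open>\<open>cgrow_sym\<close> exchanges rows and columns, so that the complement of the
  stable tableau becomes the moving object.\<close>

lemma hop_move_stab_iff:
  "hop_move_stab (p, P) Q Q' \<longleftrightarrow>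
     (\<exists>U V. Q = compl_tab U \<and> Q' = compl_tab V \<and> col_move (p, P) U V)"
proof (cases p)
  case Stable_Inside
  show ?thesis
  proof
    assume "hop_move_stab (p, P) Q Q'"
    then have *: "(P, Q) \<in> hop_pairs Stable_Inside" "Q' = snd (hopscotch Stable_Inside (P, Q))"
      using Stable_Inside by auto
    from *(1) obtain U T V where c: "Q = compl_tab U" "cgrow P U T V" by (rule hop_pairs_InsideE)
    then have "Q' = compl_tab V" using *(2) hopscotch_cgrow(3)[OF c(2)] by simp
    moreover have "col_move (p, P) U V" using cgrow_sym[OF c(2)] Stable_Inside by auto
    ultimately show "\<exists>U V. Q = compl_tab U \<and> Q' = compl_tab V \<and> col_move (p, P) U V"
      using c(1) by blast
  next
    assume "\<exists>U V. Q = compl_tab U \<and> Q' = compl_tab V \<and> col_move (p, P) U V"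
    then obtain U V T where c: "Q = compl_tab U" "Q' = compl_tab V" "cgrow U P V T"
      using Stable_Inside by auto
    note cgrow_sym[OF c(3)]
    with c(1,2) show "hop_move_stab (p, P) Q Q'"
      using hopscotch_cgrow(1,3) Stable_Inside by auto
  qed
next
  case Stable_Outside
  show ?thesis
  proof
    assume "hop_move_stab (p, P) Q Q'"
    then have *: "(P, Q) \<in> hop_pairs Stable_Outside" "Q' = snd (hopscotch Stable_Outside (P, Q))"
      using Stable_Outside by auto
    from *(1) obtain U T V where c: "Q = compl_tab U" "cgrow T V P U" by (rule hop_pairs_OutsideE)
    then have "Q' = compl_tab V" using *(2) hopscotch_cgrow(4)[OF c(2)] by simp
    moreover have "col_move (p, P) U V" using cgrow_sym[OF c(2)] Stable_Outside by auto
    ultimately show "\<exists>U V. Q = compl_tab U \<and> Q' = compl_tab V \<and> col_move (p, P) U V"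
      using c(1) by blast
  next
    assume "\<exists>U V. Q = compl_tab U \<and> Q' = compl_tab V \<and> col_move (p, P) U V"
    then obtain U V T where c: "Q = compl_tab U" "Q' = compl_tab V" "cgrow V T U P"
      using Stable_Outside by auto
    note cgrow_sym[OF c(3)]
    with c(1,2) show "hop_move_stab (p, P) Q Q'"
      using hopscotch_cgrow(2,4) Stable_Outside by auto
  qed
qed

section \<open>Dual equivalence\<close>

lemma dual_by_coinduct:
  assumes "D x y" "preserved mv D" "\<And>x y. D x y \<Longrightarrow> chain_shape x = chain_shape y"
  shows "dual_by mv x y"
proof -
  have "D x' y'" if "moves mv as x x'" "moves mv as y y'" for as x' y'
    using that assms(1)
  proof (induction as arbitrary: x y)
    case (Cons a as)
    then obtain z w where "mv a x z" "moves mv as z x'" "mv a y w" "moves mv as w y'" by auto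
    moreover from this have "D z w" using assms(2) Cons.prems unfolding preserved_def by blast
    ultimately show ?case using Cons.IH by blast
  qed simp
  then show ?thesis using assms by (auto simp: dual_by_def)
qed

lemma dual_by_preserved: "preserved mv (dual_by mv)"
  unfolding preserved_def
proof (intro allI impI, elim conjE)
  fix a P P' T T' assume d: "dual_by mv P P'" and mv: "mv a P T" "mv a P' T'"
  have "chain_shape x' = chain_shape y'" if "moves mv as T x'" "moves mv as T' y'" for as x' y'
    using d mv that unfolding dual_by_def by (metis moves.simps(2))
  moreover from this[of "[]"] have "chain_shape T = chain_shape T'" by simp
  ultimately show "dual_by mv T T'" by (auto simp: dual_by_def)
qed

text \<open>The greatest fixed point view: \<open>dual_by mv\<close>, restricted to tableaux, is
  itself a witness, and any witness is contained in it by induction on the sequence of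
  moves.\<close>

lemma dual_by_iff:
  fixes mv :: "'l \<Rightarrow> tab \<Rightarrow> tab \<Rightarrow> bool"
  assumes "tableau P" "tableau T" "\<And>a P T. mv a P T \<Longrightarrow> tableau T"
  shows "dual_by mv P T \<longleftrightarrow> (\<exists>D. D P T \<and> shape_respecting D \<and> preserved mv D)"
proof
  assume d: "dual_by mv P T"
  let ?D = "\<lambda>P T. dual_by mv P T \<and> tableau P \<and> tableau T"
  have "shape_respecting ?D" by (auto simp: shape_respecting_def dual_by_def)
  moreover have "preserved mv ?D"
    using dual_by_preserved[of mv] assms(3) unfolding preserved_def by blast
  ultimately show "\<exists>D. D P T \<and> shape_respecting D \<and> preserved mv D"
    using d assms by (intro exI[of _ ?D]) simp
next
  assume "\<exists>D. D P T \<and> shape_respecting D \<and> preserved mv D"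
  then obtain D where D: "D P T" "shape_respecting D" "preserved mv D" by blast
  show "dual_by mv P T"
    by (rule dual_by_coinduct[OF D(1,3)]) (use D(2) in \<open>simp add: shape_respecting_def\<close>)
qed

lemma slide_move_tableau: "slide_move a P T \<Longrightarrow> tableau T"
  by (cases a) (auto simp: jdt_slide_def)

lemma col_move_tableau: "col_move a P T \<Longrightarrow> tableau T \<and> length T = length P"
  by (cases a, cases "fst a") (auto dest: cgrow_tableaux)

lemma dual_by_col_iff_slide:
  assumes "tableau P" "tableau T"
  shows "dual_by col_move P T \<longleftrightarrow> dual_equiv P T"
  using dual_by_iff[OF assms, of col_move] dual_by_iff[OF assms, of slide_move]
    col_move_tableau slide_move_tableau preserved_slide_iff_col
  unfolding dual_equiv_def by metis

text \<open>As \<open>compl_tab\<close> is injective, two hopscotch moves share a label exactly when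
  the underlying insertions do.\<close>

lemma hop_dual_tab_iff:
  assumes "tableau P" "tableau T"
  shows "hop_dual_tab P T \<longleftrightarrow> dual_equiv P T"
proof -
  have "preserved hop_move_tab D \<longleftrightarrow> preserved col_move D" for D
  proof
    assume D: "preserved hop_move_tab D"
    show "preserved col_move D" unfolding preserved_def
    proof (intro allI impI, elim conjE)
      fix a P P' T T' assume *: "D P P'" "col_move a P T" "col_move a P' T'"
      obtain p U where "a = (p, U)" by force
      then have "hop_move_tab (p, compl_tab U) P T" "hop_move_tab (p, compl_tab U) P' T'"
        using * hop_move_tab_iff by blast+
      then show "D T T'" using D *(1) unfolding preserved_def by blast
    qed
  next
    assume D: "preserved col_move D"
    show "preserved hop_move_tab D" unfolding preserved_def
    proof (intro allI impI, elim conjE)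
      fix a P P' T T' assume *: "D P P'" "hop_move_tab a P T" "hop_move_tab a P' T'"
      obtain p Q where "a = (p, Q)" by force
      then obtain U where "col_move (p, U) P T" "col_move (p, U) P' T'"
        using * hop_move_tab_iff compl_tab_inject by metis
      then show "D T T'" using D *(1) unfolding preserved_def by blast
    qed
  qed
  moreover have "hop_move_tab a P T \<Longrightarrow> tableau T" for a P T
    using hop_move_tab_iff col_move_tableau by (cases a) blast
  ultimately show ?thesis
    using dual_by_iff[OF assms, of hop_move_tab] dual_by_iff[OF assms, of col_move]
      dual_by_col_iff_slide[OF assms] col_move_tableau
    unfolding hop_dual_tab_def by metis
qed

text \<open>Complements have equal shapes exactly when the tableaux do, provided the lengths agree.
  Equality of lengths is therefore built into both relations used for coinduction; insertions keep
  it.\<close>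

lemma hop_dual_stab_iff:
  assumes "tableau A" "tableau B" "length A = length B"
  shows "hop_dual_stab (compl_tab A) (compl_tab B) \<longleftrightarrow> dual_equiv A B"
proof -
  have ne: "A \<noteq> []" if "tableau A" for A using that by (simp add: tableau_def)
  have "hop_dual_stab (compl_tab A) (compl_tab B) \<longleftrightarrow> dual_by col_move A B"
  proof
    assume d: "hop_dual_stab (compl_tab A) (compl_tab B)"
    let ?D = "\<lambda>A B. tableau A \<and> tableau B \<and> length A = length B \<and>
      dual_by hop_move_stab (compl_tab A) (compl_tab B)"
    show "dual_by col_move A B"
    proof (rule dual_by_coinduct[of ?D])
      show "?D A B" using d assms by (simp add: hop_dual_stab_def)
      show "chain_shape A = chain_shape B" if "?D A B" for A B
        using that chain_shape_compl_tab[of A B] ne by (simp add: dual_by_def)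
      show "preserved col_move ?D" unfolding preserved_def
      proof (intro allI impI, elim conjE)
        fix a A B A' B'
        assume *: "col_move a A A'" "col_move a B B'" "length A = length B"
          "dual_by hop_move_stab (compl_tab A) (compl_tab B)"
        obtain p P where "a = (p, P)" by force
        then have "hop_move_stab (p, P) (compl_tab A) (compl_tab A')"
          "hop_move_stab (p, P) (compl_tab B) (compl_tab B')"
          using * hop_move_stab_iff by blast+
        then have "dual_by hop_move_stab (compl_tab A') (compl_tab B')"
          using *(4) dual_by_preserved[of hop_move_stab] unfolding preserved_def by blast
        then show "?D A' B'" using * col_move_tableau by simp
      qed
    qed
  next
    assume d: "dual_by col_move A B"
    let ?D = "\<lambda>Q Q'. \<exists>A B. Q = compl_tab A \<and> Q' = compl_tab B \<and> tableau A \<and> tableau B \<and>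
      length A = length B \<and> dual_by col_move A B"
    have "dual_by hop_move_stab (compl_tab A) (compl_tab B)"
    proof (rule dual_by_coinduct[of ?D])
      show "?D (compl_tab A) (compl_tab B)" using d assms by blast
      show "chain_shape Q = chain_shape Q'" if "?D Q Q'" for Q Q'
        using that chain_shape_compl_tab ne by (fastforce simp: dual_by_def)
      show "preserved hop_move_stab ?D" unfolding preserved_def
      proof (intro allI impI, elim conjE exE)
        fix a Q Q' R R' A B
        assume *: "hop_move_stab a Q R" "hop_move_stab a Q' R'" "Q = compl_tab A" "Q' = compl_tab B"
          "length A = length B" "dual_by col_move A B"
        obtain p P where "a = (p, P)" by force
        then obtain A' B' where c: "R = compl_tab A'" "R' = compl_tab B'"
          "col_move (p, P) A A'" "col_move (p, P) B B'"
          using * hop_move_stab_iff compl_tab_inject by metis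
        then have "dual_by col_move A' B'"
          using *(6) dual_by_preserved[of col_move] unfolding preserved_def by blast
        then show "?D R R'" using c *(5) col_move_tableau by fastforce
      qed
    qed
    then show "hop_dual_stab (compl_tab A) (compl_tab B)" by (simp add: hop_dual_stab_def)
  qed
  then show ?thesis using dual_by_col_iff_slide[OF assms(1,2)] by simp
qed

section \<open>Knuth equivalence\<close>

lemma jdt_slide_length: "jdt_slide r s P T \<Longrightarrow> length (inner T) = length (inner P)"
  by (simp add: jdt_slide_def)

lemma jdt_slide_unique_reverse:
  assumes "jdt_slide r s P T" "jdt_slide r' s P' T"
  shows "P = P'"
proof -
  have len: "length (inner P) = length (inner T)" "length (inner P') = length (inner T)"
    using jdt_slide_length[OF assms(1)] jdt_slide_length[OF assms(2)] by simp_all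
  have "rot P = rot P'"
    using jdt_slide_unique jdt_slide_rot[OF assms(1)] jdt_slide_rot[OF assms(2)] unfolding len by blast
  then show ?thesis using rot_rot by metis
qed

text \<open>The relation \<open>X = X'\<close> on the Knuth class of \<open>P\<close> is preserved by slides, hence by column
  insertion.\<close>

lemma col_move_knuth:
  assumes "col_move a P T" "tableau P"
  shows "knuth_equiv P T"
proof -
  let ?D = "\<lambda>X X'. knuth_equiv P X \<and> tableau X \<and> X = X'"
  have "preserved slide_move ?D" unfolding preserved_def
  proof (intro allI impI, elim conjE)
    fix a X X' Y Y' assume *: "knuth_equiv P X" "X = X'" "slide_move a X Y" "slide_move a X' Y'"
    \<comment> \<open>Slides are single-valued in both directions, so equality is preserved.\<close>
    have "Y = Y'"
      using *(2-4) by (cases a) (auto dest: jdt_slide_unique jdt_slide_unique_reverse)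
    moreover have "knuth_equiv P Y"
      using *(1,3) unfolding knuth_equiv_def
      by (cases a) (auto intro: equivclp_into_equivclp)
    ultimately show "?D Y Y'" using slide_move_tableau *(3) by auto
  qed
  moreover have "shape_respecting ?D" by (simp add: shape_respecting_def)
  ultimately have "preserved col_move ?D" using preserved_slide_iff_col by blast
  \<comment> \<open>Applying the insertion to \<open>P\<close> on both sides yields
    \<open>?D T T\<close>, whose first component is the claim.\<close>
  moreover have "?D P P" using assms by (simp add: knuth_equiv_def)
  ultimately show ?thesis using assms(1) unfolding preserved_def by blast
qed

theorem theorem5p6:
  shows
    "bij_betw (hopscotch Stable_Outside) (hop_pairs Stable_Outside) (hop_pairs Stable_Inside)
     \<and> (\<forall>x\<in>hop_pairs Stable_Outside. hopscotch Stable_Inside (hopscotch Stable_Outside x) = x)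
     \<and> (\<forall>x\<in>hop_pairs Stable_Inside. hopscotch Stable_Outside (hopscotch Stable_Inside x) = x)
     \<and> (\<forall>p P Q T U. (P, Q) \<in> hop_pairs p \<and> hopscotch p (P, Q) = (T, U) \<longrightarrow> knuth_equiv P T)
     \<and> (\<forall>P T. tableau P \<and> tableau T \<longrightarrow> (hop_dual_tab P T \<longleftrightarrow> dual_equiv P T))
     \<and> (\<forall>Q U. stable_tableau_rep Q \<and> stable_tableau_rep U \<and> length Q = length U \<longrightarrow>
           (hop_dual_stab Q U \<longleftrightarrow> dual_equiv (compl_stab Q) (compl_stab U)))"
proof -
  have out: "hopscotch Stable_Outside x \<in> hop_pairs Stable_Inside \<and>
      hopscotch Stable_Inside (hopscotch Stable_Outside x) = x" if x: "x \<in> hop_pairs Stable_Outside" for x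
  proof -
    obtain T Q where TQ: "x = (T, Q)" by force
    obtain V P U where "Q = compl_tab V" "cgrow P U T V"
      using x unfolding TQ by (rule hop_pairs_OutsideE)
    then show ?thesis using hopscotch_cgrow TQ by metis
  qed
  have inn: "hopscotch Stable_Inside x \<in> hop_pairs Stable_Outside \<and>
      hopscotch Stable_Outside (hopscotch Stable_Inside x) = x" if x: "x \<in> hop_pairs Stable_Inside" for x
  proof -
    obtain P Q where PQ: "x = (P, Q)" by force
    obtain U T V where "Q = compl_tab U" "cgrow P U T V"
      using x unfolding PQ by (rule hop_pairs_InsideE)
    then show ?thesis using hopscotch_cgrow PQ by metis
  qed
  have "bij_betw (hopscotch Stable_Outside) (hop_pairs Stable_Outside) (hop_pairs Stable_Inside)"
    using out inn by (intro bij_betw_byWitness[where f' = "hopscotch Stable_Inside"]) blast+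
  moreover have "knuth_equiv P T" if "(P, Q) \<in> hop_pairs p" "hopscotch p (P, Q) = (T, U)" for p P Q T U
  proof -
    have "hop_move_tab (p, Q) P T" using that by simp
    moreover have "tableau P" using that(1) by (cases p) auto
    ultimately show ?thesis using hop_move_tab_iff col_move_knuth by blast
  qed
  moreover have "hop_dual_stab Q U \<longleftrightarrow> dual_equiv (compl_stab Q) (compl_stab U)"
    if QU: "stable_tableau_rep Q" "stable_tableau_rep U" "length Q = length U" for Q U
  proof -
    obtain A where "tableau A" "Q = compl_tab A" using QU(1) by (rule stable_tableau_repE)
    moreover obtain B where "tableau B" "U = compl_tab B" using QU(2) by (rule stable_tableau_repE)
    ultimately show ?thesis using QU(3) by (simp add: hop_dual_stab_iff)
  qed
  ultimately show ?thesis using out inn hop_dual_tab_iff by blast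
qed

end
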